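(* Let $q\ge 2$, let $F\in\mathcal C^2(\Delta)$ be such that $G$ satisfies (A) and (B), assume that the matrices $\Sigma^{(1)},\dots,\Sigma^{(p)}$ are positive definite, and let $0<\delta<\tfrac16$ be the truncation exponent in the definition of the mixtures $\nu_N$. Then, as $N\to\infty$, the mixture $\nu_N$ approximates the Gibbs measure $\mu_N$ in relative entropy, i.e. $$H(\mu_N|\nu_N)\to 0\qquad\text{as well as}\qquad H(\nu_N|\mu_N)\to 0 .$$
   Context: Gibbs measure: fix an integer $q\ge 2$ and let $\Delta=\{m\in[0,1]^q:\sum_{k=1}^q m_k=1\}$. For $\sigma=(\sigma_i)_{i=1}^N\in\{1,\dots,q\}^N$ let $m_N(\sigma)=\big(\frac1N\sum_{i=1}^N \mathbf 1\{\sigma_i=k\}\big)_{k=1,\dots,q}\in\Delta$. For a fixed function $F\in\mathcal C^2(\Delta)$ the Gibbs measure is the probability measure on $\{1,\dots,q\}^N$ given by $\mu_N(\sigma)=\frac1{Z_N}\exp(NF(m_N(\sigma)))$, with $Z_N=\sum_{\sigma\in\{1,\dots,q\}^N}\exp(NF(m_N(\sigma)))$. Free energy: let $\hat\Delta=\{\hat m\in[0,1]^{q-1}:\sum_{k=1}^{q-1}\hat m_k\le 1\}$. A point $\hat m\in\hat\Delta$ is identified with $m=(\hat m,1-\sum_{k=1}^{q-1}\hat m_k)\in\Delta$. Let $\mathrm{ent}(m)=-\sum_{k=1}^q m_k\log m_k$ (with $0\log 0=0$) and $G(\hat m)=F(m)+\mathrm{ent}(m)$, viewed as a function of the $q-1$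 coordinates $\hat m\in\hat\Delta$. Assumptions: (A) $G$ has exactly $p\in\mathbb N$ global maximizers $M_1,\dots,M_p$ on $\hat\Delta$; they are isolated and lie in the interior of $\hat\Delta$. (B) For each $j=1,\dots,p$ the $(q-1)\times(q-1)$ matrix $H_j:=-\mathrm{Hess}_G(M_j)$ is positive definite. Write $M_j=(M_{j,1},\dots,M_{j,q-1})$ and $M_{j,q}=1-\sum_{k=1}^{q-1}M_{j,k}$. Set $w_j=\big(\det(H_j)\prod_{k=1}^q M_{j,k}\big)^{-1/2}$ and $|w|=\sum_{j=1}^p w_j$. Mixture: let $\Sigma^{(j)}=H_j^{-1}-\mathrm{diag}(M_j)+M_jM_j^T$, where $M_j$ is the column vector $(M_{j,1},\dots,M_{j,q-1})$ and $\mathrm{diag}(M_j)$ is the diagonal matrix with these entries. Let $\tilde\xi^{(j)}\sim\mathcal N_{q-1}(0,\Sigma^{(j)})$, $j=1,\dots,p$, be independent. For $\delta>0$ let $(\xi^{(j)}_k)_{k=1}^{q-1}=\tilde\xi^{(j)}\mathbf 1\{\|\tilde\xi^{(j)}\|\le N^\delta\}$ ($\|\cdot\|$ the Euclidean norm), and $\xi^{(j)}_q=-\sum_{k=1}^{q-1}\xi^{(j)}_k$. Define, for $\sigma\in\{1,\dots,q\}^N$, $$\nu_N(\sigma)=\frac1{|w|}\sum_{j=1}^p w_j\,\mathbb E_\xi\Big[\prod_{i=1}^N\sum_{k=1}^q\Big(M_{j,k}+\frac{\xi^{(j)}_k}{\sqrt N}\Big)\mathbf 1\{\sigma_i=k\}\Big].$$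 For $0<\delta<1/6$ and all sufficiently large $N$ this is a probability measure on $\{1,\dots,q\}^N$; only such $N$ are considered. Relative entropy: $H(\varrho|\pi)=\int\log\frac{d\varrho}{d\pi}\,d\varrho$ if $\varrho\ll\pi$, and $+\infty$ otherwise. *)

theory Defs
  imports "HOL-Probability.Probability"
begin

text \<open>
  The \<open>q\<close> colours are the elements of the type \<open>'n option\<close>, where \<open>CARD('n) = q - 1\<close>: the colour
  \<open>Some i\<close> is one of the first \<open>q - 1\<close> colours and \<open>None\<close> is the last one. As types are nonempty,
  a free type variable \<open>'n :: finite\<close> ranges over exactly the values \<open>q \<ge> 2\<close>. The spaces
  \<open>\<real>\<^sup>q\<close> and \<open>\<real>\<^sup>q\<^sup>-\<^sup>1\<close> are \<open>real^('n option)\<close> and \<open>real^'n\<close>.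
\<close>

section \<open>Calculus and linear algebra\<close>

text \<open>
  Derivatives are taken within \<open>S\<close>, so for \<open>S = prob_simplex\<close> only values on the simplex
  matter. Gradient and Hessian need not be unique there, because the simplex spans only a hyperplane;
  their existence amounts to \<open>f\<close> being \<open>C\<^sup>2\<close> up to the boundary in the coordinates
  \<open>m\<^sub>1, \<dots>, m\<^sub>q\<^sub>-\<^sub>1\<close>.
\<close>

definition C2_on :: "(real^'k) set \<Rightarrow> (real^'k \<Rightarrow> real) \<Rightarrow> bool" where
  "C2_on S f \<longleftrightarrow> (\<exists>(g :: real^'k \<Rightarrow> real^'k) (h :: real^'k \<Rightarrow> real^'k^'k).
     (\<forall>x\<in>S. (f has_derivative (\<lambda>v. g x \<bullet> v)) (at x within S)) \<and>
     (\<forall>x\<in>S. (g has_derivative (\<lambda>v. h x *v v)) (at x within S)) \<and>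
     continuous_on S h)"

definition partial :: "'n::finite \<Rightarrow> (real^'n \<Rightarrow> real) \<Rightarrow> real^'n \<Rightarrow> real" where
  "partial i f x = deriv (\<lambda>t. f (x + t *\<^sub>R axis i 1)) 0"

definition hessian :: "(real^'n::finite \<Rightarrow> real) \<Rightarrow> real^'n \<Rightarrow> real^'n^'n" where
  "hessian f x = (\<chi> i k. partial i (partial k f) x)"

definition pos_def_matrix :: "real^'n::finite^'n \<Rightarrow> bool" where
  "pos_def_matrix A \<longleftrightarrow> transpose A = A \<and> (\<forall>x. x \<noteq> 0 \<longrightarrow> x \<bullet> (A *v x) > 0)"

definition diag_matrix :: "real^'n::finite \<Rightarrow> real^'n^'n" where
  "diag_matrix v = (\<chi> i k. if i = k then v $ i else 0)"

definition outer_product :: "real^'n::finite \<Rightarrow> real^'n \<Rightarrow> real^'n^'n" where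
  "outer_product u v = (\<chi> i k. u $ i * v $ k)"

section \<open>Probability\<close>

definition multi_normal_density :: "real^'n::finite \<Rightarrow> real^'n^'n \<Rightarrow> real^'n \<Rightarrow> real" where
  "multi_normal_density \<mu> S x =
     exp (- ((x - \<mu>) \<bullet> (matrix_inv S *v (x - \<mu>))) / 2) / sqrt ((2 * pi) ^ CARD('n) * det S)"

text \<open>
  The library's \<open>KL_divergence b M N\<close> is the real-valued divergence of \<open>N\<close> with
  respect to \<open>M\<close> (reference measure first), which is \<open>0\<close> when the integral does
  not exist. For probability measures with \<open>\<rho> \<lless> \<pi>\<close> the negative part of the integrand is
  integrable, so in that case the integral is \<open>\<infinity>\<close>.
\<close>

definition rel_entropy :: "'a measure \<Rightarrow> 'a measure \<Rightarrow> ereal" where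
  "rel_entropy \<rho> \<pi> =
     (if absolutely_continuous \<pi> \<rho> \<and> integrable \<rho> (entropy_density (exp 1) \<pi> \<rho>)
      then ereal (KL_divergence (exp 1) \<pi> \<rho>) else \<infinity>)"

section \<open>The Gibbs measure\<close>

definition prob_simplex :: "(real^'k::finite) set" where
  "prob_simplex = {m. (\<forall>k. 0 \<le> m $ k \<and> m $ k \<le> 1) \<and> (\<Sum>k\<in>UNIV. m $ k) = 1}"

definition hat_simplex :: "(real^'n::finite) set" where
  "hat_simplex = {m. (\<forall>k. 0 \<le> m $ k \<and> m $ k \<le> 1) \<and> (\<Sum>k\<in>UNIV. m $ k) \<le> 1}"

definition configs :: "nat \<Rightarrow> (nat \<Rightarrow> 'c) set" where
  "configs N = {1..N} \<rightarrow>\<^sub>E UNIV"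

definition magnetization :: "nat \<Rightarrow> (nat \<Rightarrow> 'c::finite) \<Rightarrow> real^'c" where
  "magnetization N \<sigma> = (\<chi> k. (\<Sum>i=1..N. of_bool (\<sigma> i = k)) / real N)"

definition partition_function :: "(real^'c::finite \<Rightarrow> real) \<Rightarrow> nat \<Rightarrow> real" where
  "partition_function F N = (\<Sum>\<sigma>\<in>configs N. exp (real N * F (magnetization N \<sigma>)))"

definition gibbs_measure :: "(real^'c::finite \<Rightarrow> real) \<Rightarrow> nat \<Rightarrow> (nat \<Rightarrow> 'c) measure" where
  "gibbs_measure F N = point_measure (configs N)
     (\<lambda>\<sigma>. ennreal (exp (real N * F (magnetization N \<sigma>)) / partition_function F N))"

section \<open>The free energy\<close>

definition full_point :: "real^'n::finite \<Rightarrow> real^('n option)" where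
  "full_point m = (\<chi> k. case k of None \<Rightarrow> 1 - (\<Sum>i\<in>UNIV. m $ i) | Some i \<Rightarrow> m $ i)"

definition ent :: "real^'c::finite \<Rightarrow> real" where
  "ent m = - (\<Sum>k\<in>UNIV. m $ k * ln (m $ k))"

definition free_energy :: "(real^('n::finite option) \<Rightarrow> real) \<Rightarrow> real^'n \<Rightarrow> real" where
  "free_energy F m = F (full_point m) + ent (full_point m)"

definition global_maximizers :: "('a \<Rightarrow> real) \<Rightarrow> 'a set \<Rightarrow> 'a set" where
  "global_maximizers f S = {x \<in> S. \<forall>y\<in>S. f y \<le> f x}"

definition H_matrix :: "(real^('n::finite option) \<Rightarrow> real) \<Rightarrow> real^'n \<Rightarrow> real^'n^'n" where
  "H_matrix F m = - hessian (free_energy F) m"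

section \<open>The mixture\<close>

definition Sigma_matrix :: "(real^('n::finite option) \<Rightarrow> real) \<Rightarrow> real^'n \<Rightarrow> real^'n^'n" where
  "Sigma_matrix F m = matrix_inv (H_matrix F m) - diag_matrix m + outer_product m m"

definition weight :: "(real^('n::finite option) \<Rightarrow> real) \<Rightarrow> real^'n \<Rightarrow> real" where
  "weight F m = (det (H_matrix F m) * (\<Prod>k\<in>UNIV. full_point m $ k)) powr (-1/2)"

definition truncate_vec :: "real \<Rightarrow> nat \<Rightarrow> real^'n::finite \<Rightarrow> real^'n" where
  "truncate_vec \<delta> N v = (if norm v \<le> real N powr \<delta> then v else 0)"

definition full_vec :: "real^'n::finite \<Rightarrow> real^('n option)" where
  "full_vec v = (\<chi> k. case k of None \<Rightarrow> - (\<Sum>i\<in>UNIV. v $ i) | Some i \<Rightarrow> v $ i)"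

definition mixture_weight ::
  "(real^('n::finite option) \<Rightarrow> real) \<Rightarrow> nat \<Rightarrow> (nat \<Rightarrow> real^'n) \<Rightarrow> 'w measure \<Rightarrow>
    (nat \<Rightarrow> 'w \<Rightarrow> real^'n) \<Rightarrow> real \<Rightarrow> nat \<Rightarrow> (nat \<Rightarrow> 'n option) \<Rightarrow> real" where
  "mixture_weight F p M P \<xi> \<delta> N \<sigma> =
     1 / (\<Sum>j=1..p. weight F (M j)) *
     (\<Sum>j=1..p. weight F (M j) *
        (\<integral>\<omega>. (\<Prod>i=1..N. \<Sum>k\<in>UNIV.
            (full_point (M j) $ k + full_vec (truncate_vec \<delta> N (\<xi> j \<omega>)) $ k / sqrt (real N))
            * of_bool (\<sigma> i = k)) \<partial>P))"

text \<open>
  For the finitely many \<open>N\<close> for which some \<open>mixture_weight\<close> may be negative, \<open>ennreal\<close>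
  cuts it off at \<open>0\<close>; this does not affect limits as \<open>N\<close> tends to infinity.
\<close>

definition mixture_measure ::
  "(real^('n::finite option) \<Rightarrow> real) \<Rightarrow> nat \<Rightarrow> (nat \<Rightarrow> real^'n) \<Rightarrow> 'w measure \<Rightarrow>
    (nat \<Rightarrow> 'w \<Rightarrow> real^'n) \<Rightarrow> real \<Rightarrow> nat \<Rightarrow> (nat \<Rightarrow> 'n option) measure" where
  "mixture_measure F p M P \<xi> \<delta> N =
     point_measure (configs N) (\<lambda>\<sigma>. ennreal (mixture_weight F p M P \<xi> \<delta> N \<sigma>))"

end

theory Submission
  imports Defs
begin

text \<open>
  Up to normalisation, the Gibbs measure has density \<open>f(\<sigma>) = exp (N (F m - max G))\<close> and the mixture
  has density \<open>g(\<sigma>) = \<Sum>\<^sub>j w\<^sub>j Q\<^sub>j(m)\<close>, both functions of the magnetization \<open>m\<close>. Both divergences are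
  nonnegative, and in their sum \<open>\<Sum> (\<mu> - \<nu>) ln (f / g)\<close> the normalising constants cancel. So
  it is enough that \<open>ln (f / g)\<close> tends to \<open>0\<close> in mean under \<open>\<mu>\<close> and under \<open>\<nu>\<close>.

  Let \<open>d\<close> be \<open>N\<close> times the squared distance of \<open>m\<close> to the nearest maximizer. On \<open>{d \<le> K}\<close> the ratio
  \<open>f / g\<close> tends to \<open>1\<close> uniformly: the Taylor expansion of \<open>F\<close> handles \<open>f\<close>, and dominated convergence
  together with a Gaussian integral handles \<open>g\<close>. Here \<open>\<Sigma>\<^sub>j = H\<^sub>j\<^sup>-\<^sup>1 - V\<^sub>j\<close>, with \<open>V\<^sub>j\<close> the covariance
  of a single spin, makes the exponents agree, and \<open>det V\<^sub>j = \<Prod>\<^sub>k M\<^sub>j\<^sub>k\<close> makes the weights agree. Everywhere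
  \<open>\<bar>ln (f / g)\<bar> \<le> C (1 + d)\<close>, so that it remains to bound the second moment of \<open>d\<close> under \<open>g\<close> and \<open>f\<close>.
  Under \<open>g\<close> this is the fourth moment of a sum of independent bounded variables; near a maximizer \<open>f\<close> is
  dominated by another Gaussian mixture of product measures, and far away it is exponentially small.
\<close>

section \<open>Relative entropy of finite measures\<close>

text \<open>Counting is done through product measures: \<open>exp (- N * ent m)\<close> is the
  probability of a configuration with magnetization \<open>m\<close> under the product measure with
  parameter \<open>m\<close>. At every maximizer both densities are divided by the likelihood under
  the product measure with parameter \<open>M j\<close>. The Gibbs density then becomes
  \<open>exp (N * phi j)\<close>, and \<open>phi j\<close> is of second order at \<open>M j\<close>
  because \<open>M j\<close> is a critical point. The mixture becomes an average of likelihood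
  ratios for shifts of order \<open>1 / sqrt N\<close>, whose limits are Gaussian exponentials. The
  obstacle is that convergence of \<open>f / g\<close> is controlled only on the scale
  \<open>1 / sqrt N\<close> around the maximizers, while its logarithm is unbounded elsewhere. Since
  the logarithm grows at most linearly in \<open>d\<close>, a bounded second moment of
  \<open>d\<close> leaves only \<open>O(1 / K)\<close> for the region \<open>d > K\<close>. For the
  Gibbs measure a lower bound on the sum of \<open>f\<close> is also required; it comes from
  comparing \<open>f\<close> with \<open>g\<close>, whose total mass is known exactly.\<close>

lemma rel_entropy_point_measure:
  fixes a b :: "'a \<Rightarrow> real"
  assumes A: "finite A" and a: "\<And>x. x \<in> A \<Longrightarrow> a x > 0" and b: "\<And>x. x \<in> A \<Longrightarrow> b x > 0"
  shows "rel_entropy (point_measure A (\<lambda>x. ennreal (a x))) (point_measure A (\<lambda>x. ennreal (b x))) =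
    ereal (\<Sum>x\<in>A. a x * ln (a x / b x))"
proof -
  let ?C = "count_space A"
  interpret C: sigma_finite_measure ?C
    by (rule sigma_finite_measure_count_space_finite[OF A])
  have ac: "absolutely_continuous (point_measure A (\<lambda>x. ennreal (b x))) (point_measure A (\<lambda>x. ennreal (a x)))"
    unfolding absolutely_continuous_def point_measure_def
    using b by (auto simp: null_sets_density_iff AE_count_space subset_eq ennreal_eq_0_iff)
      (meson leD)
  have KL: "KL_divergence (exp 1) (point_measure A (\<lambda>x. ennreal (b x))) (point_measure A (\<lambda>x. ennreal (a x)))
     = (\<Sum>x\<in>A. a x * ln (a x / b x))"
    unfolding point_measure_def
    by (subst C.KL_density_density)
       (use a b b[THEN less_imp_neq] A in \<open>auto simp: AE_count_space lebesgue_integral_count_space_finite log_def less_imp_le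
          intro!: sum.cong\<close>)
  \<comment> \<open>On a finite set everything is integrable, which rules out the value
    \<open>\<infinity>\<close> of \<open>rel_entropy\<close>.\<close>
  have "integrable (point_measure A (\<lambda>x. ennreal (a x))) f" for f :: "'a \<Rightarrow> real"
    unfolding point_measure_def
    by (subst integrable_density) (use A a in \<open>auto simp: AE_count_space less_imp_le intro!: integrable_count_space\<close>)
  then show ?thesis
    unfolding rel_entropy_def using ac KL by simp
qed

text \<open>Gibbs' inequality: \<open>ln t \<le> t - 1\<close> bounds each term from below by
  \<open>a x - b x\<close>, and these differences cancel in the sum because the masses
  agree.\<close>

lemma relative_entropy_nonneg:
  fixes a b :: "'a \<Rightarrow> real"
  assumes a: "\<And>x. x \<in> A \<Longrightarrow> a x > 0" and b: "\<And>x. x \<in> A \<Longrightarrow> b x > 0"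
    and eq: "(\<Sum>x\<in>A. a x) = (\<Sum>x\<in>A. b x)"
  shows "(\<Sum>x\<in>A. a x * ln (a x / b x)) \<ge> 0"
proof -
  have "a x - b x \<le> a x * ln (a x / b x)" if x: "x \<in> A" for x
  proof -
    have "ln (b x / a x) \<le> b x / a x - 1"
      using a[OF x] b[OF x] by (intro ln_le_minus_one) auto
    then have "a x * (1 - b x / a x) \<le> a x * ln (a x / b x)"
      using a[OF x] b[OF x] by (intro mult_left_mono) (auto simp: ln_div)
    then show ?thesis using a[OF x] by (simp add: algebra_simps)
  qed
  then have "(\<Sum>x\<in>A. a x - b x) \<le> (\<Sum>x\<in>A. a x * ln (a x / b x))" by (rule sum_mono)
  then show ?thesis using eq by (simp add: sum_subtractf)
qed

text \<open>
  The normalising constants cancel in the symmetrised divergence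
  \<open>\<Sum> (a - b) * ln (a / b)\<close> of \<open>a = f / \<Sum>f\<close> and \<open>b = g / \<Sum>g\<close>, and this sum bounds both
  divergences, as both are nonnegative.
\<close>

lemma symmetrised_divergence:
  fixes f g :: "'a \<Rightarrow> real"
  assumes A: "finite A" "A \<noteq> {}" and f: "\<And>x. x \<in> A \<Longrightarrow> f x > 0" and g: "\<And>x. x \<in> A \<Longrightarrow> g x > 0"
  defines "a \<equiv> \<lambda>x. f x / sum f A" and "b \<equiv> \<lambda>x. g x / sum g A"
  shows "(\<Sum>x\<in>A. a x * ln (a x / b x)) \<in> {0..(\<Sum>x\<in>A. \<bar>ln (f x / g x)\<bar> * (a x + b x))}"
    and "(\<Sum>x\<in>A. b x * ln (b x / a x)) \<in> {0..(\<Sum>x\<in>A. \<bar>ln (f x / g x)\<bar> * (a x + b x))}"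
proof -
  have sf: "sum f A > 0" and sg: "sum g A > 0"
    using A f g by (auto intro!: sum_pos)
  have a: "a x > 0" and b: "b x > 0" if "x \<in> A" for x
    using f g sf sg that by (auto simp: a_def b_def)
  have sa: "sum a A = 1" and sb: "sum b A = 1"
    using sf sg by (auto simp: a_def b_def simp flip: sum_divide_distrib)
  let ?c = "ln (sum g A / sum f A)"
  have l: "ln (a x / b x) = ln (f x / g x) + ?c" if "x \<in> A" for x
    using f[OF that] g[OF that] sf sg by (simp add: a_def b_def ln_div ln_mult)
  have ab: "ln (b x / a x) = - ln (a x / b x)" if "x \<in> A" for x
    using a[OF that] b[OF that] by (simp add: ln_div)
  have "(\<Sum>x\<in>A. a x * ln (a x / b x)) + (\<Sum>x\<in>A. b x * ln (b x / a x))
      = (\<Sum>x\<in>A. (a x - b x) * (ln (f x / g x) + ?c))"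
    unfolding sum.distrib[symmetric] by (intro sum.cong) (auto simp: ab l algebra_simps)
  also have "\<dots> = (\<Sum>x\<in>A. (a x - b x) * ln (f x / g x)) + ?c * (sum a A - sum b A)"
    by (simp add: algebra_simps sum.distrib sum_subtractf sum_distrib_left sum_distrib_right)
  also have "\<dots> = (\<Sum>x\<in>A. (a x - b x) * ln (f x / g x))"
    using sa sb by simp
  also have "\<dots> \<le> (\<Sum>x\<in>A. \<bar>ln (f x / g x)\<bar> * (a x + b x))"
  proof (rule sum_mono)
    fix x assume x: "x \<in> A"
    have "(a x - b x) * ln (f x / g x) \<le> \<bar>a x - b x\<bar> * \<bar>ln (f x / g x)\<bar>"
      by (metis abs_ge_self abs_mult)
    also have "\<dots> \<le> (a x + b x) * \<bar>ln (f x / g x)\<bar>"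
      using a[OF x] b[OF x] by (intro mult_right_mono) auto
    finally show "(a x - b x) * ln (f x / g x) \<le> \<bar>ln (f x / g x)\<bar> * (a x + b x)"
      by (simp add: mult.commute)
  qed
  finally have le: "(\<Sum>x\<in>A. a x * ln (a x / b x)) + (\<Sum>x\<in>A. b x * ln (b x / a x))
      \<le> (\<Sum>x\<in>A. \<bar>ln (f x / g x)\<bar> * (a x + b x))" .
  have "(\<Sum>x\<in>A. a x * ln (a x / b x)) \<ge> 0" "(\<Sum>x\<in>A. b x * ln (b x / a x)) \<ge> 0"
    using relative_entropy_nonneg[of A a b] relative_entropy_nonneg[of A b a] a b sa sb by auto
  with le show "(\<Sum>x\<in>A. a x * ln (a x / b x)) \<in> {0..(\<Sum>x\<in>A. \<bar>ln (f x / g x)\<bar> * (a x + b x))}"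
    "(\<Sum>x\<in>A. b x * ln (b x / a x)) \<in> {0..(\<Sum>x\<in>A. \<bar>ln (f x / g x)\<bar> * (a x + b x))}"
    by auto
qed

text \<open>The sum is split at \<open>d = K\<close>. Below, the uniform bound \<open>e\<close>
  applies; above, \<open>1 + d \<le> 2 * d\<^sup>2 / K\<close> (this uses \<open>K \<ge> 1\<close>)
  turns the linear growth of \<open>l\<close> into the second moment of \<open>d\<close>, as in
  Chebyshev's inequality.\<close>

lemma sum_abs_log_ratio_bound:
  fixes f g h d :: "'a \<Rightarrow> real"
  assumes h: "\<And>x. x \<in> A \<Longrightarrow> h x \<ge> 0" and d: "\<And>x. x \<in> A \<Longrightarrow> d x \<ge> 0" and K: "K \<ge> 1"
    and C: "\<And>x. x \<in> A \<Longrightarrow> \<bar>l x\<bar> \<le> C * (1 + d x)" "(\<Sum>x\<in>A. h x * (d x)\<^sup>2) \<le> C"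
    and e: "\<And>x. x \<in> A \<Longrightarrow> d x \<le> K \<Longrightarrow> \<bar>l x\<bar> \<le> e" and e0: "e \<ge> 0" and C0: "C \<ge> 0"
  shows "(\<Sum>x\<in>A. \<bar>l x\<bar> * h x) \<le> e * sum h A + 2 * C\<^sup>2 / K"
proof -
  have "\<bar>l x\<bar> * h x \<le> e * h x + 2 * C / K * (h x * (d x)\<^sup>2)" if x: "x \<in> A" for x
  proof (cases "d x \<le> K")
    case True
    have "\<bar>l x\<bar> * h x \<le> e * h x" using e[OF x True] h[OF x] by (rule mult_right_mono)
    moreover have "2 * C / K * (h x * (d x)\<^sup>2) \<ge> 0" using C0 K h[OF x] by simp
    ultimately show ?thesis by simp
  next
    case False
    have "(1 + d x) * K \<le> (2 * d x) * d x" using False K d[OF x] by (intro mult_mono) auto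
    then have "1 + d x \<le> 2 * (d x)\<^sup>2 / K"
      using K by (simp add: field_simps power2_eq_square)
    then have "\<bar>l x\<bar> \<le> C * (2 * (d x)\<^sup>2 / K)"
      using C(1)[OF x] C0 by (meson mult_left_mono order_trans)
    then have "\<bar>l x\<bar> * h x \<le> C * (2 * (d x)\<^sup>2 / K) * h x"
      using h[OF x] by (rule mult_right_mono)
    moreover have "e * h x \<ge> 0" using e0 h[OF x] by simp
    ultimately show ?thesis by (simp add: mult_ac)
  qed
  then have "(\<Sum>x\<in>A. \<bar>l x\<bar> * h x) \<le> (\<Sum>x\<in>A. e * h x + 2 * C / K * (h x * (d x)\<^sup>2))"
    by (rule sum_mono)
  also have "\<dots> = e * sum h A + 2 * C / K * (\<Sum>x\<in>A. h x * (d x)\<^sup>2)"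
    by (simp add: sum.distrib sum_distrib_left)
  also have "\<dots> \<le> e * sum h A + 2 * C / K * C"
    using C(2) C0 K by (intro add_left_mono mult_left_mono) auto
  finally show ?thesis by (simp add: power2_eq_square mult_ac)
qed

text \<open>The abstract form of the whole argument. The mass \<open>W\<close> of \<open>g\<close>
  is known and constant, while \<open>f\<close> is left unnormalised; a positive lower bound for its
  mass is part of the proof.\<close>

lemma relative_entropy_tendsto_zero:
  fixes A :: "nat \<Rightarrow> 'a set" and f g d :: "nat \<Rightarrow> 'a \<Rightarrow> real" and C W :: real
  assumes W: "W > 0"
    and fin: "\<And>N. finite (A N)" "\<And>N. A N \<noteq> {}"
    and f: "\<And>N x. x \<in> A N \<Longrightarrow> f N x > 0" and d: "\<And>N x. x \<in> A N \<Longrightarrow> d N x \<ge> 0"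
    and g: "\<forall>\<^sub>F N in sequentially. \<forall>x\<in>A N. g N x > 0"
    and gW: "\<forall>\<^sub>F N in sequentially. sum (g N) (A N) = W"
    and l: "\<forall>\<^sub>F N in sequentially. \<forall>x\<in>A N. \<bar>ln (f N x / g N x)\<bar> \<le> C * (1 + d N x)"
    and fd: "\<forall>\<^sub>F N in sequentially. (\<Sum>x\<in>A N. f N x * (d N x)\<^sup>2) \<le> C"
    and gd: "\<forall>\<^sub>F N in sequentially. (\<Sum>x\<in>A N. g N x * (d N x)\<^sup>2) \<le> C"
    and unif: "\<And>K e. e > 0 \<Longrightarrow>
      \<forall>\<^sub>F N in sequentially. \<forall>x\<in>A N. d N x \<le> K \<longrightarrow> \<bar>ln (f N x / g N x)\<bar> \<le> e"
  shows "(\<lambda>N. \<Sum>x\<in>A N. f N x / sum (f N) (A N) *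
      ln ((f N x / sum (f N) (A N)) / (g N x / W))) \<longlonglongrightarrow> 0" (is "?F \<longlonglongrightarrow> 0")
    and "(\<lambda>N. \<Sum>x\<in>A N. g N x / W *
      ln ((g N x / W) / (f N x / sum (f N) (A N)))) \<longlonglongrightarrow> 0" (is "?G \<longlonglongrightarrow> 0")
proof -
  have *: "\<forall>\<^sub>F N in sequentially. ?F N \<in> {0..e} \<and> ?G N \<in> {0..e}" if e: "e > 0" for e
  proof -
    have C0: "C \<ge> 0"
    proof -
      obtain N where "\<forall>x\<in>A N. g N x > 0" "(\<Sum>x\<in>A N. g N x * (d N x)\<^sup>2) \<le> C"
        using eventually_happens[OF eventually_conj[OF g gd]] by auto
      moreover have "(\<Sum>x\<in>A N. g N x * (d N x)\<^sup>2) \<ge> 0"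
        using calculation(1) by (intro sum_nonneg) (auto simp: less_imp_le)
      ultimately show ?thesis by linarith
    qed
    \<comment> \<open>The second summand makes the part of \<open>g\<close> beyond \<open>K\<close>
      small compared with \<open>W\<close>; the third makes the total tail contribution
      \<open>10 * C\<^sup>2 / (K * W)\<close> at most \<open>e / 2\<close>.\<close>
    define K where "K = 1 + 2 * C / W + 20 * C\<^sup>2 / (W * e)"
    have K: "K \<ge> 1" "C / K \<le> W / 2" "10 * C\<^sup>2 / (K * W) \<le> e / 2"
    proof -
      have nn: "2 * C / W \<ge> 0" "20 * C\<^sup>2 / (W * e) \<ge> 0" using C0 W e by auto
      then show K1: "K \<ge> 1" by (simp add: K_def)
      have "2 * C / W \<le> K" using nn by (simp add: K_def)
      then show "C / K \<le> W / 2" using K1 W by (simp add: field_simps)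
      have "20 * C\<^sup>2 / (W * e) \<le> K" using nn by (simp add: K_def)
      then show "10 * C\<^sup>2 / (K * W) \<le> e / 2" using K1 W e by (simp add: field_simps)
    qed
    \<comment> \<open>The bound \<open>1/2\<close> gives
      \<open>g \<le> exp (1/2) * f \<le> 2 * f\<close> on \<open>d \<le> K\<close>; the bound
      \<open>e / 4\<close> leaves \<open>e / 2\<close> once the errors under both measures are
      added.\<close>
    define \<epsilon> where "\<epsilon> = min (e / 4) (1/2)"
    have \<epsilon>: "\<epsilon> > 0" "\<epsilon> \<le> e / 4" "\<epsilon> \<le> 1/2" using e by (auto simp: \<epsilon>_def)
    show ?thesis
      using g gW l fd gd unif[OF \<epsilon>(1), of K]
    proof eventually_elim
      case (elim N)
      note g = elim(1)[rule_format] and gW = elim(2) and l = elim(3)[rule_format]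
        and fd = elim(4) and gd = elim(5) and un = elim(6)[rule_format]
      let ?A = "A N" and ?f = "f N" and ?g = "g N" and ?d = "d N"
      define Z where "Z = sum ?f ?A"
      have Zpos: "Z > 0" unfolding Z_def using fin f by (intro sum_pos) auto
      \<comment> \<open>Where \<open>d \<le> K\<close>, \<open>f\<close> is at least
        \<open>g / 2\<close>. Where \<open>d > K\<close>, the subtracted moment term already exceeds
        \<open>g / 2\<close>, so the left side is nonpositive. Summing leaves
        \<open>W / 2 - C / (2 * K)\<close>.\<close>
      have Z: "Z \<ge> W / 4"
      proof -
        have "?g x / 2 - 1 / (2 * K) * (?g x * (?d x)\<^sup>2) \<le> ?f x" if x: "x \<in> ?A" for x
        proof (cases "?d x \<le> K")
          case True
          have "ln (?g x / ?f x) \<le> 1/2"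
            using un[OF x True] \<epsilon> f[OF x] g[OF x] by (simp add: ln_div abs_le_iff)
          then have "?g x / ?f x \<le> exp (1/2)"
            using f[OF x] g[OF x] by (metis divide_pos_pos exp_le_cancel_iff exp_ln)
          also have "exp (1/2::real) \<le> 2" by (rule exp_half_le2)
          finally have "?g x / 2 \<le> ?f x" using f[OF x] by (simp add: field_simps)
          moreover have "1 / (2 * K) * (?g x * (?d x)\<^sup>2) \<ge> 0"
            using K g[OF x] by simp
          ultimately show ?thesis by linarith
        next
          case False
          have "K * 1 \<le> ?d x * ?d x" using False K by (intro mult_mono) auto
          then have "?g x * K \<le> ?g x * (?d x)\<^sup>2"
            using g[OF x] by (simp add: power2_eq_square)
          then have "?g x / 2 - 1 / (2 * K) * (?g x * (?d x)\<^sup>2) \<le> 0"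
            using K by (simp add: field_simps)
          then show ?thesis using f[OF x] by simp
        qed
        then have "(\<Sum>x\<in>?A. ?g x / 2 - 1 / (2 * K) * (?g x * (?d x)\<^sup>2)) \<le> Z"
          unfolding Z_def by (rule sum_mono)
        moreover have "(\<Sum>x\<in>?A. ?g x / 2 - 1 / (2 * K) * (?g x * (?d x)\<^sup>2))
          = W / 2 - 1 / (2 * K) * (\<Sum>x\<in>?A. ?g x * (?d x)\<^sup>2)"
          by (simp add: sum_subtractf sum_distrib_left gW[symmetric] sum_divide_distrib)
        moreover have "1 / (2 * K) * (\<Sum>x\<in>?A. ?g x * (?d x)\<^sup>2) \<le> 1 / (2 * K) * C"
          using K gd by (intro mult_left_mono) auto
        moreover have "1 / (2 * K) * C = C / K / 2" by simp
        moreover have "W / 4 \<le> Z" if "u = W / 2 - v" "u \<le> Z" "v \<le> w" "w = t / 2" "t \<le> W / 2" for u v w t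
          using that by linarith
        ultimately show ?thesis using K(2) by blast
      qed
      have "(\<Sum>x\<in>?A. \<bar>ln (?f x / ?g x)\<bar> * ?f x) \<le> \<epsilon> * Z + 2 * C\<^sup>2 / K"
        unfolding Z_def
        by (rule sum_abs_log_ratio_bound[where d = ?d])
          (use f d K l fd un \<epsilon> C0 in \<open>auto simp: less_imp_le\<close>)
      \<comment> \<open>Dividing the tail \<open>2 * C\<^sup>2 / K\<close> by
        \<open>Z \<ge> W / 4\<close> produces the factor 8; together with the 2 from the mixture
        this is the 10 in the choice of \<open>K\<close>.\<close>
      then have 1: "(\<Sum>x\<in>?A. \<bar>ln (?f x / ?g x)\<bar> * ?f x) / Z \<le> \<epsilon> + 8 * C\<^sup>2 / (K * W)"
      proof -
        assume *: "(\<Sum>x\<in>?A. \<bar>ln (?f x / ?g x)\<bar> * ?f x) \<le> \<epsilon> * Z + 2 * C\<^sup>2 / K"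
        have "(\<Sum>x\<in>?A. \<bar>ln (?f x / ?g x)\<bar> * ?f x) / Z \<le> (\<epsilon> * Z + 2 * C\<^sup>2 / K) / Z"
          using * Zpos by (intro divide_right_mono) auto
        also have "\<dots> = \<epsilon> + (2 * C\<^sup>2 / K) / Z" using Zpos by (simp add: field_simps)
        also have "(2 * C\<^sup>2 / K) / Z \<le> (2 * C\<^sup>2 / K) / (W / 4)"
          using Z W K by (intro divide_left_mono) auto
        finally show ?thesis by (simp add: field_simps)
      qed
      have "(\<Sum>x\<in>?A. \<bar>ln (?f x / ?g x)\<bar> * ?g x) \<le> \<epsilon> * sum ?g ?A + 2 * C\<^sup>2 / K"
        by (rule sum_abs_log_ratio_bound[where d = ?d])
          (use g d K l gd un \<epsilon> C0 in \<open>auto simp: less_imp_le\<close>)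
      then have 2: "(\<Sum>x\<in>?A. \<bar>ln (?f x / ?g x)\<bar> * ?g x) / W \<le> \<epsilon> + 2 * C\<^sup>2 / (K * W)"
        using W by (simp add: gW field_simps)
      have "(\<Sum>x\<in>?A. \<bar>ln (?f x / ?g x)\<bar> * (?f x / Z + ?g x / W)) \<le> e"
      proof -
        have "(\<Sum>x\<in>?A. \<bar>ln (?f x / ?g x)\<bar> * (?f x / Z + ?g x / W)) =
          (\<Sum>x\<in>?A. \<bar>ln (?f x / ?g x)\<bar> * ?f x) / Z + (\<Sum>x\<in>?A. \<bar>ln (?f x / ?g x)\<bar> * ?g x) / W"
          by (simp add: sum_divide_distrib distrib_left sum.distrib)
        also have "\<dots> \<le> 2 * \<epsilon> + 10 * C\<^sup>2 / (K * W)"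
          using add_mono[OF 1 2] by (simp add: add_divide_distrib[symmetric])
        also have "\<dots> \<le> e" using K \<epsilon> by linarith
        finally show ?thesis .
      qed
      then show ?case
        using symmetrised_divergence[of ?A ?f ?g, OF fin f g] unfolding gW Z_def by fastforce
    qed
  qed
  have **: "X \<longlonglongrightarrow> 0" if "\<And>e. e > 0 \<Longrightarrow> \<forall>\<^sub>F N in sequentially. X N \<in> {0..e}" for X :: "nat \<Rightarrow> real"
  proof (rule tendstoI)
    fix e :: real assume "e > 0"
    then show "\<forall>\<^sub>F N in sequentially. dist (X N) 0 < e"
      using that[of "e / 2"] by (auto elim!: eventually_mono)
  qed
  show "?F \<longlonglongrightarrow> 0" by (rule **, rule eventually_mono[OF *]) auto
  show "?G \<longlonglongrightarrow> 0" by (rule **, rule eventually_mono[OF *]) auto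
qed

section \<open>Product measures and magnetizations\<close>

text \<open>Fubini for a single spin. It drives the induction on the number of spins in the moment
  bound.\<close>

lemma sum_PiE_insert_prod:
  fixes \<pi> X :: "'c::finite \<Rightarrow> real" and \<Phi> :: "real \<Rightarrow> real"
  assumes I: "finite I" "i \<notin> I"
  shows "(\<Sum>\<sigma>\<in>insert i I \<rightarrow>\<^sub>E UNIV. (\<Prod>k\<in>insert i I. \<pi> (\<sigma> k)) * \<Phi> (\<Sum>k\<in>insert i I. X (\<sigma> k)))
    = (\<Sum>c\<in>UNIV. \<pi> c * (\<Sum>\<sigma>\<in>I \<rightarrow>\<^sub>E UNIV. (\<Prod>k\<in>I. \<pi> (\<sigma> k)) * \<Phi> (X c + (\<Sum>k\<in>I. X (\<sigma> k)))))"
proof -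
  have inj: "inj_on (\<lambda>(c, \<sigma>). \<sigma>(i := c)) (UNIV \<times> (I \<rightarrow>\<^sub>E (UNIV :: 'c set)))"
    using inj_combinator[OF I(2), of "\<lambda>_. UNIV"] by simp
  have eq: "(\<Prod>k\<in>I. \<pi> (if k = i then c else \<sigma> k)) = (\<Prod>k\<in>I. \<pi> (\<sigma> k))"
    "(\<Sum>k\<in>I. X (if k = i then c else \<sigma> k)) = (\<Sum>k\<in>I. X (\<sigma> k))" for c \<sigma>
    using I by (auto intro!: prod.cong sum.cong)
  show ?thesis
    unfolding PiE_insert_eq sum.reindex[OF inj]
    using I by (simp add: sum.cartesian_product case_prod_unfold eq sum_distrib_left mult_ac)
qed

lemma sum_PiE_prod_one:
  fixes \<pi> :: "'c::finite \<Rightarrow> real"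
  assumes "finite I" "(\<Sum>c\<in>UNIV. \<pi> c) = 1"
  shows "(\<Sum>\<sigma>\<in>I \<rightarrow>\<^sub>E UNIV. \<Prod>k\<in>I. \<pi> (\<sigma> k)) = 1"
  using prod_sum_PiE[of I "\<lambda>_. UNIV" "\<lambda>_. \<pi>"] assms by simp

text \<open>Adding one centred variable \<open>x\<close> to the sum \<open>s\<close> and expanding
  \<open>(x + s) ^ 4\<close>, the terms \<open>x ^ 3 * s\<close> and \<open>x * s ^ 3\<close> vanish
  in mean. What is added is at most \<open>1 + 6 * n\<close>, which fits into
  \<open>3 * (n + 1)\<^sup>2 - 3 * n\<^sup>2\<close>.\<close>

lemma fourth_moment_iid_sum:
  fixes \<pi> X :: "'c::finite \<Rightarrow> real" and I :: "'i set"
  assumes I: "finite I" and \<pi>: "\<And>c. \<pi> c \<ge> 0" "(\<Sum>c\<in>UNIV. \<pi> c) = 1"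
    and X: "\<And>c. \<bar>X c\<bar> \<le> 1" "(\<Sum>c\<in>UNIV. \<pi> c * X c) = 0"
  shows "(\<Sum>\<sigma>\<in>I \<rightarrow>\<^sub>E UNIV. (\<Prod>k\<in>I. \<pi> (\<sigma> k)) * (\<Sum>k\<in>I. X (\<sigma> k)) ^ 4) \<le> 3 * (real (card I))\<^sup>2"
proof -
  define E where "E J \<Phi> = (\<Sum>\<sigma>\<in>J \<rightarrow>\<^sub>E UNIV. (\<Prod>k\<in>J. \<pi> (\<sigma> k)) * \<Phi> (\<Sum>k\<in>J. X (\<sigma> k)))"
    for J :: "'i set" and \<Phi> :: "real \<Rightarrow> real"
  have E_add: "E J (\<lambda>s. \<Phi> s + \<Psi> s) = E J \<Phi> + E J \<Psi>" for J \<Phi> \<Psi>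
    by (simp add: E_def distrib_left sum.distrib)
  have E_cmult: "E J (\<lambda>s. a * \<Phi> s) = a * E J \<Phi>" for J a \<Phi>
    by (simp add: E_def sum_distrib_left mult_ac)
  have E_const: "E J (\<lambda>_. a) = a" if "finite J" for J a
    using sum_PiE_prod_one[OF that \<pi>(2)] by (simp add: E_def flip: sum_distrib_right)
  have pm: "\<bar>\<Sum>c\<in>UNIV. \<pi> c * X c ^ n\<bar> \<le> 1" for n
  proof -
    have "\<bar>\<Sum>c\<in>UNIV. \<pi> c * X c ^ n\<bar> \<le> (\<Sum>c\<in>UNIV. \<pi> c)"
    proof (rule order_trans[OF sum_abs sum_mono])
      fix c
      have "\<bar>X c\<bar> ^ n \<le> 1" using X(1)[of c] by (intro power_le_one) auto
      then show "\<bar>\<pi> c * X c ^ n\<bar> \<le> \<pi> c"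
        using \<pi>(1)[of c] by (simp add: abs_mult power_abs mult_left_le)
    qed
    then show ?thesis using \<pi>(2) by simp
  qed
  have E_insert: "E (insert i J) \<Phi> = (\<Sum>c\<in>UNIV. \<pi> c * E J (\<lambda>s. \<Phi> (X c + s)))"
    if "finite J" "i \<notin> J" for i J \<Phi>
    unfolding E_def by (rule sum_PiE_insert_prod[OF that])
  \<comment> \<open>The first two moments are carried along because the expansion of the fourth one
    refers to them.\<close>
  have "E I (\<lambda>s. s) = 0 \<and> E I (\<lambda>s. s ^ 2) \<le> real (card I) \<and> E I (\<lambda>s. s ^ 4) \<le> 3 * (real (card I))\<^sup>2"
    using I
  proof induction
    case empty
    show ?case by (simp add: E_def)
  next
    case (insert i J)
    note ins = E_insert[OF insert(1,2)] and const = E_const[OF insert(1)]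
    note IH = insert.IH
    have id: "E J (\<lambda>s. s) = 0" using IH by simp
    have "E (insert i J) (\<lambda>s. s) = (\<Sum>c\<in>UNIV. \<pi> c * X c)"
      unfolding ins by (simp add: E_add const id)
    then have 1: "E (insert i J) (\<lambda>s. s) = 0" using X(2) by simp
    have *: "E J (\<lambda>s. (x + s) ^ 2) = x ^ 2 + E J (\<lambda>s. s ^ 2)" for x
    proof -
      have "(\<lambda>s. (x + s) ^ 2) = (\<lambda>s. x ^ 2 + (2 * x * s + s ^ 2))"
        by (auto simp: power2_sum algebra_simps)
      then show ?thesis by (simp add: E_add E_cmult const id)
    qed
    have "E (insert i J) (\<lambda>s. s ^ 2) = (\<Sum>c\<in>UNIV. \<pi> c * X c ^ 2) + E J (\<lambda>s. s ^ 2)"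
      unfolding ins * using \<pi>(2) by (simp add: distrib_left sum.distrib sum_distrib_right[symmetric])
    then have 2: "E (insert i J) (\<lambda>s. s ^ 2) \<le> real (card (insert i J))"
      using abs_le_D1[OF pm[of 2]] IH insert(1,2) by simp
    have *: "E J (\<lambda>s. (x + s) ^ 4) = x ^ 4 + 6 * x ^ 2 * E J (\<lambda>s. s ^ 2) + 4 * x * E J (\<lambda>s. s ^ 3)
       + E J (\<lambda>s. s ^ 4)" for x
    proof -
      have "(x + s) ^ 4 = x ^ 4 + (4 * x ^ 3 * s + (6 * x ^ 2 * s ^ 2 + (4 * x * s ^ 3 + s ^ 4)))" for s
        by algebra
      then have "(\<lambda>s. (x + s) ^ 4) = (\<lambda>s. x ^ 4 + (4 * x ^ 3 * s + (6 * x ^ 2 * s ^ 2 + (4 * x * s ^ 3 + s ^ 4))))"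
        by blast
      then show ?thesis by (simp add: E_add E_cmult const id)
    qed
    have "E (insert i J) (\<lambda>s. s ^ 4) = (\<Sum>c\<in>UNIV. \<pi> c * X c ^ 4)
        + 6 * E J (\<lambda>s. s ^ 2) * (\<Sum>c\<in>UNIV. \<pi> c * X c ^ 2)
        + 4 * E J (\<lambda>s. s ^ 3) * (\<Sum>c\<in>UNIV. \<pi> c * X c) + (\<Sum>c\<in>UNIV. \<pi> c * E J (\<lambda>s. s ^ 4))"
      unfolding ins * by (simp add: distrib_left sum.distrib sum_distrib_left mult_ac)
    also have "6 * E J (\<lambda>s. s ^ 2) * (\<Sum>c\<in>UNIV. \<pi> c * X c ^ 2) \<le> 6 * E J (\<lambda>s. s ^ 2) * 1"
    proof (rule mult_left_mono)
      show "0 \<le> 6 * E J (\<lambda>s. s ^ 2)"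
        unfolding E_def using \<pi>(1) by (auto intro!: sum_nonneg mult_nonneg_nonneg prod_nonneg)
    qed (use pm[of 2] in auto)
    finally have "E (insert i J) (\<lambda>s. s ^ 4) \<le> 1 + 6 * real (card J) + 3 * (real (card J))\<^sup>2"
      using abs_le_D1[OF pm[of 4]] IH X(2) \<pi>(2) by (simp flip: sum_distrib_right)
    also have "\<dots> \<le> 3 * (real (card (insert i J)))\<^sup>2"
      using insert(1,2) by (simp add: power2_eq_square algebra_simps)
    finally show ?case using 1 2 by blast
  qed
  then show ?thesis by (simp add: E_def)
qed

section \<open>Entropy inequalities on the simplex\<close>

lemma mult_ln_div_ge:
  fixes m p :: real
  assumes "m \<ge> 0" "p > 0"
  shows "m * ln (m / p) \<ge> m - p + (sqrt m - sqrt p)\<^sup>2"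
proof (cases "m = 0")
  case True
  then show ?thesis using assms by simp
next
  case False
  then have m: "m > 0" using assms by simp
  \<comment> \<open>Using \<open>ln t \<le> t - 1\<close> at the square root of the ratio, and not
    at the ratio itself, leaves the squared Hellinger distance as a surplus.\<close>
  have "ln (sqrt (p / m)) \<le> sqrt (p / m) - 1"
    using m assms by (intro ln_le_minus_one) auto
  then have "ln (p / m) \<le> 2 * (sqrt (p / m) - 1)"
    using m assms by (simp add: ln_sqrt)
  then have "m * (- (2 * (sqrt (p / m) - 1))) \<le> m * ln (m / p)"
    using m assms by (intro mult_left_mono) (auto simp: ln_div)
  moreover have "m * sqrt (p / m) = sqrt m * sqrt p"
    using m assms by (simp add: real_sqrt_divide field_simps)
  ultimately show ?thesis
    using m assms by (simp add: power2_diff algebra_simps)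
qed

lemma mult_ln_div_eq: "m * ln (m / p) = m * ln m - m * ln p" if "m \<ge> 0" "p > 0" for m p :: real
  using that by (cases "m = 0") (auto simp: ln_div right_diff_distrib)

text \<open>A bound of Pinsker type: the relative entropy of \<open>m\<close> with respect to
  \<open>p\<close> dominates the squared Hellinger distance, and
  \<open>\<bar>m - p\<bar> \<le> 2 * \<bar>sqrt m - sqrt p\<bar>\<close> in each coordinate.
  Multiplied by \<open>N\<close>, it says how unlikely a magnetization far from the parameter
  is.\<close>

lemma sum_mult_ln_le_neg_ent:
  fixes m p :: "real^'k::finite"
  assumes m: "m \<in> prob_simplex" and p: "\<And>k. p $ k > 0" "(\<Sum>k\<in>UNIV. p $ k) = 1"
  shows "(\<Sum>k\<in>UNIV. m $ k * ln (p $ k)) \<le> - ent m - (norm (m - p))\<^sup>2 / 4"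
proof -
  have p1: "p $ k \<le> 1" for k
    using p by (metis UNIV_I finite_class.finite_UNIV less_imp_le member_le_sum)
  have m01: "0 \<le> m $ k" "m $ k \<le> 1" for k using m by (auto simp: prob_simplex_def)
  have "m $ k - p $ k + (m $ k - p $ k)\<^sup>2 / 4 \<le> m $ k * ln (m $ k) - m $ k * ln (p $ k)" for k
  proof -
    have "(m $ k - p $ k)\<^sup>2 = (sqrt (m $ k) - sqrt (p $ k))\<^sup>2 * (sqrt (m $ k) + sqrt (p $ k))\<^sup>2"
      using m01[of k] p(1)[of k] by (simp add: power_mult_distrib[symmetric] square_diff_square_factored[symmetric]
          algebra_simps)
    also have "\<dots> \<le> (sqrt (m $ k) - sqrt (p $ k))\<^sup>2 * 2\<^sup>2"
    proof (intro mult_left_mono power_mono)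
      have "sqrt (m $ k) \<le> 1" "sqrt (p $ k) \<le> 1" using m01[of k] p1[of k] by auto
      then show "sqrt (m $ k) + sqrt (p $ k) \<le> 2" by linarith
    qed (use m01[of k] p(1)[of k] in auto)
    finally have "(m $ k - p $ k)\<^sup>2 / 4 \<le> (sqrt (m $ k) - sqrt (p $ k))\<^sup>2" by simp
    then show ?thesis
      using mult_ln_div_ge[OF m01(1)[of k] p(1)[of k]] mult_ln_div_eq[OF m01(1)[of k] p(1)[of k]] by linarith
  qed
  then have "(\<Sum>k\<in>UNIV. m $ k - p $ k + (m $ k - p $ k)\<^sup>2 / 4)
      \<le> (\<Sum>k\<in>UNIV. m $ k * ln (m $ k) - m $ k * ln (p $ k))" by (rule sum_mono)
  moreover have "(norm (m - p))\<^sup>2 = (\<Sum>k\<in>UNIV. (m $ k - p $ k)\<^sup>2)"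
    by (simp only: power2_norm_eq_inner) (simp add: inner_vec_def power2_eq_square)
  ultimately show ?thesis
    using m p(2) by (simp add: prob_simplex_def ent_def sum.distrib sum_subtractf sum_divide_distrib)
qed

text \<open>The counterpart in the other direction: relative entropy is at most the chi-square
  distance, again by \<open>ln t \<le> t - 1\<close>, and the latter is a squared norm up to
  \<open>1 / a\<close>. Coordinates with \<open>m $ k = 0\<close> are treated apart, where
  \<open>p \<le> p\<^sup>2 / a\<close>.\<close>

lemma neg_ent_le_sum_mult_ln:
  fixes m p :: "real^'k::finite"
  assumes m: "m \<in> prob_simplex" and p: "\<And>k. p $ k \<ge> a" "a > 0" "(\<Sum>k\<in>UNIV. p $ k) = 1"
  shows "- ent m \<le> (\<Sum>k\<in>UNIV. m $ k * ln (p $ k)) + (norm (m - p))\<^sup>2 / a"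
proof -
  have m01: "0 \<le> m $ k" "m $ k \<le> 1" for k using m by (auto simp: prob_simplex_def)
  have pp: "p $ k > 0" for k using p(1)[of k] p(2) by linarith
  have "m $ k * ln (m $ k) - m $ k * ln (p $ k) \<le> (m $ k - p $ k)\<^sup>2 / a + m $ k - p $ k" for k
  proof (cases "m $ k = 0")
    case True
    have "p $ k * a \<le> p $ k * p $ k" using p(1)[of k] pp[of k] by (intro mult_left_mono) auto
    then show ?thesis using True p(2) by (simp add: field_simps power2_eq_square)
  next
    case False
    then have mk: "m $ k > 0" using m01(1)[of k] by simp
    have "m $ k * ln (m $ k / p $ k) \<le> m $ k * (m $ k / p $ k - 1)"
      using mk pp[of k] by (intro mult_left_mono ln_le_minus_one) auto
    also have "\<dots> = (m $ k - p $ k)\<^sup>2 / p $ k + m $ k - p $ k"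
      using pp[of k] by (simp add: field_simps power2_eq_square)
    also have "(m $ k - p $ k)\<^sup>2 / p $ k \<le> (m $ k - p $ k)\<^sup>2 / a"
      using p pp by (intro divide_left_mono) auto
    finally show ?thesis using mult_ln_div_eq[OF m01(1)[of k] pp[of k]] by simp
  qed
  then have "(\<Sum>k\<in>UNIV. m $ k * ln (m $ k) - m $ k * ln (p $ k))
      \<le> (\<Sum>k\<in>UNIV. (m $ k - p $ k)\<^sup>2 / a + m $ k - p $ k)" by (rule sum_mono)
  moreover have "(norm (m - p))\<^sup>2 = (\<Sum>k\<in>UNIV. (m $ k - p $ k)\<^sup>2)"
    by (simp only: power2_norm_eq_inner) (simp add: inner_vec_def power2_eq_square)
  ultimately show ?thesis
    using m p(3) by (simp add: prob_simplex_def ent_def sum.distrib sum_subtractf sum_divide_distrib)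
qed

section \<open>Magnetizations under product measures\<close>

lemma sum_magnetization_mult:
  assumes "N \<ge> 1"
  shows "real N * (\<Sum>k\<in>UNIV. magnetization N \<sigma> $ k * c k) = (\<Sum>i=1..N. c (\<sigma> i))"
proof -
  have "real N * (\<Sum>k\<in>UNIV. magnetization N \<sigma> $ k * c k)
     = (\<Sum>k\<in>UNIV. \<Sum>i=1..N. of_bool (\<sigma> i = k) * c k)"
    using assms by (simp add: magnetization_def sum_distrib_left sum_distrib_right sum_divide_distrib)
  also have "\<dots> = (\<Sum>i=1..N. \<Sum>k\<in>UNIV. of_bool (\<sigma> i = k) * c k)"
    by (rule sum.swap)
  also have "\<dots> = (\<Sum>i=1..N. c (\<sigma> i))"
    by (simp add: of_bool_def if_distrib[of "\<lambda>x. x * _"] cong: if_cong)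
  finally show ?thesis .
qed

lemma magnetization_in_prob_simplex:
  assumes "N \<ge> 1"
  shows "magnetization N \<sigma> \<in> prob_simplex"
proof -
  have "(\<Sum>i=1..N. of_bool (\<sigma> i = k)) \<le> (\<Sum>i=1..N. 1::real)" for k
    by (rule sum_mono) auto
  then show ?thesis
    using sum_magnetization_mult[OF assms, of \<sigma> "\<lambda>_. 1"] assms
    by (auto simp: prob_simplex_def magnetization_def sum_nonneg divide_le_eq)
qed

text \<open>Positivity is asked only of the colours that occur in \<open>\<sigma>\<close>; the
  others have magnetization 0 and drop out. Hence the magnetization itself may serve as
  \<open>c\<close>, even if some of its entries vanish.\<close>

lemma prod_eq_exp_magnetization:
  assumes "N \<ge> 1" and c: "\<And>i. i \<in> {1..N} \<Longrightarrow> c (\<sigma> i) > 0"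
  shows "(\<Prod>i=1..N. c (\<sigma> i)) = exp (real N * (\<Sum>k\<in>UNIV. magnetization N \<sigma> $ k * ln (c k)))"
  unfolding sum_magnetization_mult[OF assms(1), where c = "\<lambda>k. ln (c k)"] using c
  by (simp add: exp_sum)

lemma finite_configs: "finite (configs N :: (nat \<Rightarrow> 'c::finite) set)"
  by (simp add: configs_def finite_PiE)

text \<open>The method of types: each summand is the probability of \<open>\<sigma>\<close> under
  the product measure whose parameter is the magnetization of \<open>\<sigma>\<close>. Summing over
  all attainable parameters \<open>t\<close> as well only enlarges the sum, each \<open>t\<close>
  then contributes total mass 1, and there are at most \<open>N + 1\<close> values per
  coordinate.\<close>

lemma sum_exp_ent_le:
  "(\<Sum>\<sigma>\<in>configs N. exp (- real N * ent (magnetization N \<sigma> :: real^'c::finite))) \<le> (real N + 1) ^ CARD('c)"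
  if N: "N \<ge> 1"
proof -
  let ?m = "magnetization N :: (nat \<Rightarrow> 'c) \<Rightarrow> real^'c"
  define T where "T = ?m ` configs N"
  have T: "finite T" by (simp add: T_def finite_configs)
  have "exp (- real N * ent (?m \<sigma>)) = (\<Prod>i=1..N. ?m \<sigma> $ \<sigma> i)" for \<sigma>
  proof -
    have "?m \<sigma> $ \<sigma> i > 0" if "i \<in> {1..N}" for i
    proof -
      have "(of_bool (\<sigma> i = \<sigma> i) :: real) \<le> (\<Sum>l=1..N. of_bool (\<sigma> l = \<sigma> i))"
        by (rule member_le_sum[OF that]) auto
      then show ?thesis using N by (simp add: magnetization_def)
    qed
    then have "(\<Prod>i=1..N. ?m \<sigma> $ \<sigma> i) = exp (real N * (\<Sum>k\<in>UNIV. ?m \<sigma> $ k * ln (?m \<sigma> $ k)))"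
      by (rule prod_eq_exp_magnetization[OF N, where c = "\<lambda>k. ?m \<sigma> $ k" and \<sigma> = \<sigma>])
    then show ?thesis by (simp add: ent_def)
  qed
  then have "(\<Sum>\<sigma>\<in>configs N. exp (- real N * ent (?m \<sigma>))) = (\<Sum>\<sigma>\<in>configs N. \<Prod>i=1..N. ?m \<sigma> $ \<sigma> i)"
    by simp
  also have "\<dots> \<le> (\<Sum>\<sigma>\<in>configs N. \<Sum>t\<in>T. \<Prod>i=1..N. t $ \<sigma> i)"
  proof (rule sum_mono)
    fix \<sigma> :: "nat \<Rightarrow> 'c" assume "\<sigma> \<in> configs N"
    then have "?m \<sigma> \<in> T" by (simp add: T_def)
    then show "(\<Prod>i=1..N. ?m \<sigma> $ \<sigma> i) \<le> (\<Sum>t\<in>T. \<Prod>i=1..N. t $ \<sigma> i)"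
      using T magnetization_in_prob_simplex[OF N]
      by (intro member_le_sum[of _ T "\<lambda>t. \<Prod>i=1..N. t $ \<sigma> i"] prod_nonneg) (auto simp: T_def prob_simplex_def)
  qed
  also have "\<dots> = (\<Sum>t\<in>T. \<Sum>\<sigma>\<in>configs N. \<Prod>i=1..N. t $ \<sigma> i)" by (rule sum.swap)
  also have "\<dots> = (\<Sum>t\<in>T. 1)"
  proof (rule sum.cong[OF refl])
    fix t assume "t \<in> T"
    then have "(\<Sum>k\<in>UNIV. t $ k) = 1"
      using magnetization_in_prob_simplex[OF N] by (auto simp: T_def prob_simplex_def)
    then show "(\<Sum>\<sigma>\<in>configs N. \<Prod>i=1..N. t $ \<sigma> i) = 1"
      unfolding configs_def by (intro sum_PiE_prod_one) auto
  qed
  also have "\<dots> = real (card T)" by simp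
  also have "card T \<le> (N + 1) ^ CARD('c)"
  proof -
    have "T \<subseteq> (\<lambda>n. \<chi> k. real (n k) / real N) ` (UNIV \<rightarrow>\<^sub>E {0..N})"
    proof
      fix t assume "t \<in> T"
      then obtain \<sigma> where \<sigma>: "t = ?m \<sigma>" by (auto simp: T_def)
      let ?n = "\<lambda>k. card {i\<in>{1..N}. \<sigma> i = k}"
      have n: "(\<Sum>i=1..N. of_bool (\<sigma> i = k)) = real (?n k)" for k
        by (simp add: of_bool_def sum.If_cases Int_def)
      have "?n k \<le> N" for k
        using card_mono[of "{1..N}" "{i\<in>{1..N}. \<sigma> i = k}"] by (simp add: subset_iff)
      then have "?n \<in> UNIV \<rightarrow>\<^sub>E {0..N}" by (intro PiE_I) simp_all
      moreover have "t = (\<chi> k. real (?n k) / real N)" unfolding \<sigma> magnetization_def n ..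
      ultimately show "t \<in> (\<lambda>n. \<chi> k. real (n k) / real N) ` (UNIV \<rightarrow>\<^sub>E {0..N})"
        using imageI[of ?n "UNIV \<rightarrow>\<^sub>E {0..N}" "\<lambda>n. (\<chi> k. real (n k) / real N) :: real^'c"] by (simp only:)
    qed
    then have "card T \<le> card ((\<lambda>n. (\<chi> k. real (n k) / real N) :: real^'c) ` (UNIV \<rightarrow>\<^sub>E {0..N}))"
      by (rule card_mono[rotated]) (intro finite_imageI finite_PiE; simp)
    also have "\<dots> \<le> card ((UNIV :: 'c set) \<rightarrow>\<^sub>E {0..N})"
      by (intro card_image_le finite_PiE; simp)
    also have "\<dots> = (N + 1) ^ CARD('c)" by (simp add: card_PiE)
    finally show ?thesis .
  qed
  then have "real (card T) \<le> real ((N + 1) ^ CARD('c))" by (rule of_nat_mono)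
  finally show ?thesis by (simp add: add.commute)
qed

lemma norm_power4_le:
  fixes x :: "real^'k::finite"
  shows "norm x ^ 4 \<le> real CARD('k) * (\<Sum>k\<in>UNIV. x $ k ^ 4)"
proof -
  have "norm x ^ 4 = ((norm x)\<^sup>2)\<^sup>2" by simp
  also have "(norm x)\<^sup>2 = (\<Sum>k\<in>UNIV. 1 * (x $ k)\<^sup>2)"
    by (simp only: power2_norm_eq_inner) (simp add: inner_vec_def power2_eq_square)
  also have "\<dots>\<^sup>2 \<le> (\<Sum>k\<in>(UNIV::'k set). 1\<^sup>2) * (\<Sum>k\<in>UNIV. ((x $ k)\<^sup>2)\<^sup>2)"
    by (rule Cauchy_Schwarz_ineq_sum)
  finally show ?thesis by simp
qed

text \<open>Each coordinate of \<open>N * (m - \<pi>)\<close> is a sum of independent centred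
  variables bounded by 1. One factor \<open>CARD('c)\<close> is the price of passing from the norm
  to coordinates, the other comes from summing over them.\<close>

lemma fourth_moment_magnetization:
  fixes \<pi> :: "real^'c::finite"
  assumes N: "N \<ge> 1" and \<pi>: "\<pi> \<in> prob_simplex"
  shows "(\<Sum>\<sigma>\<in>configs N. (\<Prod>i=1..N. \<pi> $ \<sigma> i) * ((real N)\<^sup>2 * norm (magnetization N \<sigma> - \<pi>) ^ 4))
    \<le> 3 * (real CARD('c))\<^sup>2"
proof -
  let ?P = "\<lambda>\<sigma>. \<Prod>i=1..N. \<pi> $ \<sigma> i"
  have P0: "?P \<sigma> \<ge> 0" for \<sigma> using \<pi> by (auto simp: prob_simplex_def intro!: prod_nonneg)
  have k: "(\<Sum>\<sigma>\<in>configs N. ?P \<sigma> * (real N * (magnetization N \<sigma> $ k - \<pi> $ k)) ^ 4) \<le> 3 * (real N)\<^sup>2" for k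
  proof -
    let ?X = "\<lambda>c. of_bool (c = k) - \<pi> $ k"
    have eq: "real N * (magnetization N \<sigma> $ k - \<pi> $ k) = (\<Sum>i=1..N. ?X (\<sigma> i))" for \<sigma>
      using N by (simp add: magnetization_def sum_subtractf right_diff_distrib)
    have "(\<Sum>\<sigma>\<in>{1..N} \<rightarrow>\<^sub>E UNIV. ?P \<sigma> * (\<Sum>i=1..N. ?X (\<sigma> i)) ^ 4) \<le> 3 * (real (card {1..N}))\<^sup>2"
    proof (rule fourth_moment_iid_sum)
      show "\<bar>?X c\<bar> \<le> 1" for c
        using \<pi> by (cases "c = k") (auto simp: prob_simplex_def abs_le_iff intro: order_trans[of _ 1] order_trans[of _ 0])
      show "(\<Sum>c\<in>UNIV. \<pi> $ c * ?X c) = 0"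
        using \<pi> by (simp add: prob_simplex_def right_diff_distrib sum_subtractf flip: sum_distrib_right)
    qed (use \<pi> in \<open>auto simp: prob_simplex_def\<close>)
    then show ?thesis by (simp add: eq configs_def)
  qed
  have "?P \<sigma> * ((real N)\<^sup>2 * norm (magnetization N \<sigma> - \<pi>) ^ 4)
      \<le> real CARD('c) / (real N)\<^sup>2 * (\<Sum>k\<in>UNIV. ?P \<sigma> * (real N * (magnetization N \<sigma> $ k - \<pi> $ k)) ^ 4)" for \<sigma>
  proof -
    have "?P \<sigma> * ((real N)\<^sup>2 * norm (magnetization N \<sigma> - \<pi>) ^ 4)
      \<le> ?P \<sigma> * ((real N)\<^sup>2 * (real CARD('c) * (\<Sum>k\<in>UNIV. (magnetization N \<sigma> $ k - \<pi> $ k) ^ 4)))"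
      using norm_power4_le[of "magnetization N \<sigma> - \<pi>"] P0 by (intro mult_left_mono) auto
    also have "\<dots> = real CARD('c) / (real N)\<^sup>2 * (\<Sum>k\<in>UNIV. ?P \<sigma> * (real N * (magnetization N \<sigma> $ k - \<pi> $ k)) ^ 4)"
    proof -
      have "(\<Sum>k\<in>UNIV. ?P \<sigma> * (real N * (magnetization N \<sigma> $ k - \<pi> $ k)) ^ 4)
        = ?P \<sigma> * (real N ^ 4 * (\<Sum>k\<in>UNIV. (magnetization N \<sigma> $ k - \<pi> $ k) ^ 4))"
        by (simp only: power_mult_distrib sum_distrib_left)
      moreover have "x * (real N ^ 2 * (q * y)) = q / real N ^ 2 * (x * (real N ^ 4 * y))" for x q y
        using N by (simp add: power2_eq_square power4_eq_xxxx)
      ultimately show ?thesis by simp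
    qed
    finally show ?thesis .
  qed
  then have "(\<Sum>\<sigma>\<in>configs N. ?P \<sigma> * ((real N)\<^sup>2 * norm (magnetization N \<sigma> - \<pi>) ^ 4))
     \<le> (\<Sum>\<sigma>\<in>configs N. real CARD('c) / (real N)\<^sup>2 * (\<Sum>k\<in>UNIV. ?P \<sigma> * (real N * (magnetization N \<sigma> $ k - \<pi> $ k)) ^ 4))"
    by (rule sum_mono)
  also have "\<dots> = real CARD('c) / (real N)\<^sup>2 *
     (\<Sum>\<sigma>\<in>configs N. \<Sum>k\<in>UNIV. ?P \<sigma> * (real N * (magnetization N \<sigma> $ k - \<pi> $ k)) ^ 4)"
    by (rule sum_distrib_left[symmetric])
  also have "(\<Sum>\<sigma>\<in>configs N. \<Sum>k\<in>UNIV. ?P \<sigma> * (real N * (magnetization N \<sigma> $ k - \<pi> $ k)) ^ 4)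
     = (\<Sum>k\<in>UNIV. \<Sum>\<sigma>\<in>configs N. ?P \<sigma> * (real N * (magnetization N \<sigma> $ k - \<pi> $ k)) ^ 4)"
    by (rule sum.swap)
  also have "real CARD('c) / (real N)\<^sup>2 * (\<Sum>k\<in>UNIV. \<Sum>\<sigma>\<in>configs N. ?P \<sigma> * (real N * (magnetization N \<sigma> $ k - \<pi> $ k)) ^ 4)
     \<le> real CARD('c) / (real N)\<^sup>2 * (\<Sum>k\<in>(UNIV::'c set). 3 * (real N)\<^sup>2)"
    using k by (intro mult_left_mono sum_mono) auto
  also have "\<dots> = 3 * (real CARD('c))\<^sup>2" using N by (simp add: power2_eq_square)
  finally show ?thesis .
qed

text \<open>The identity \<open>m * (1 - u / q) = (q - u) + (m - q) * (q - u) / q\<close> isolates a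
  term that sums to 0 as the masses agree. Changing the parameter thus costs a product of two
  distances, which survives multiplication by \<open>N\<close> if both are of order
  \<open>1 / sqrt N\<close>.\<close>

lemma sum_mult_ln_ratio_ge:
  fixes m q u :: "real^'k::finite"
  assumes m: "\<And>k. m $ k \<ge> 0" and q: "\<And>k. q $ k \<ge> a" "a > 0" and u: "\<And>k. u $ k > 0"
    and eq: "(\<Sum>k\<in>UNIV. q $ k) = (\<Sum>k\<in>UNIV. u $ k)"
  shows "(\<Sum>k\<in>UNIV. m $ k * ln (q $ k)) \<ge> (\<Sum>k\<in>UNIV. m $ k * ln (u $ k)) - norm (m - q) * norm (q - u) / a"
proof -
  have qp: "q $ k > 0" for k using q(1)[of k] q(2) by linarith
  have "m $ k * ln (q $ k) - m $ k * ln (u $ k) \<ge> (q $ k - u $ k) + (m $ k - q $ k) * (q $ k - u $ k) / q $ k" for k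
  proof -
    have "ln (u $ k / q $ k) \<le> u $ k / q $ k - 1"
      using qp u by (intro ln_le_minus_one) auto
    then have "m $ k * (1 - u $ k / q $ k) \<le> m $ k * (ln (q $ k) - ln (u $ k))"
      using qp[of k] u[of k] m[of k] by (intro mult_left_mono) (auto simp: ln_div)
    moreover have "m $ k * (1 - u $ k / q $ k) = (q $ k - u $ k) + (m $ k - q $ k) * (q $ k - u $ k) / q $ k"
      using qp[of k] by (simp add: field_simps)
    ultimately show ?thesis by (simp add: right_diff_distrib)
  qed
  then have "(\<Sum>k\<in>UNIV. (q $ k - u $ k) + (m $ k - q $ k) * (q $ k - u $ k) / q $ k)
    \<le> (\<Sum>k\<in>UNIV. m $ k * ln (q $ k) - m $ k * ln (u $ k))" by (rule sum_mono)
  then have 1: "(\<Sum>k\<in>UNIV. (m $ k - q $ k) * (q $ k - u $ k) / q $ k)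
    \<le> (\<Sum>k\<in>UNIV. m $ k * ln (q $ k)) - (\<Sum>k\<in>UNIV. m $ k * ln (u $ k))"
    using eq by (simp add: sum.distrib sum_subtractf)
  have "\<bar>\<Sum>k\<in>UNIV. (m $ k - q $ k) * (q $ k - u $ k) / q $ k\<bar> \<le> (\<Sum>k\<in>UNIV. \<bar>(m - q) $ k\<bar> * \<bar>(q - u) $ k\<bar> / a)"
  proof (rule order_trans[OF sum_abs sum_mono])
    fix k
    have "\<bar>(m $ k - q $ k) * (q $ k - u $ k) / q $ k\<bar> = \<bar>(m - q) $ k\<bar> * \<bar>(q - u) $ k\<bar> / q $ k"
      using qp[of k] by (simp add: abs_mult)
    also have "\<dots> \<le> \<bar>(m - q) $ k\<bar> * \<bar>(q - u) $ k\<bar> / a"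
      using q(1)[of k] q(2) qp[of k] by (intro divide_left_mono) auto
    finally show "\<bar>(m $ k - q $ k) * (q $ k - u $ k) / q $ k\<bar> \<le> \<bar>(m - q) $ k\<bar> * \<bar>(q - u) $ k\<bar> / a" .
  qed
  also have "\<dots> = (\<chi> k. \<bar>(m - q) $ k\<bar>) \<bullet> (\<chi> k. \<bar>(q - u) $ k\<bar>) / a"
    by (simp add: inner_vec_def sum_divide_distrib)
  also have "\<dots> \<le> norm (\<chi> k. \<bar>(m - q) $ k\<bar>) * norm (\<chi> k. \<bar>(q - u) $ k\<bar>) / a"
    using q(2) norm_cauchy_schwarz by (intro divide_right_mono) auto
  also have "\<dots> = norm (m - q) * norm (q - u) / a"
    by (simp add: norm_vec_def)
  finally show ?thesis using 1 unfolding abs_le_iff by linarith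
qed

section \<open>Gaussian integrals\<close>

lemma matrix_inv_eqI:
  fixes A B :: "real^'n::finite^'n"
  assumes "A ** B = mat 1"
  shows "matrix_inv A = B"
proof -
  have BA: "B ** A = mat 1" using assms by (simp add: matrix_left_right_inverse)
  have "A ** matrix_inv A = mat 1 \<and> matrix_inv A ** A = mat 1"
    unfolding matrix_inv_def by (rule someI[of _ B]) (use assms BA in auto)
  then show ?thesis
    by (metis BA matrix_mul_assoc matrix_mul_lid matrix_mul_rid)
qed

lemma matrix_inv_mult:
  fixes A :: "real^'n::finite^'n"
  assumes "invertible A"
  shows "A ** matrix_inv A = mat 1" "matrix_inv A ** A = mat 1"
proof -
  obtain B where B: "A ** B = mat 1" "B ** A = mat 1" using assms by (auto simp: invertible_def)
  show "A ** matrix_inv A = mat 1" "matrix_inv A ** A = mat 1"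
    using matrix_inv_eqI[OF B(1)] B by auto
qed

lemma pos_def_matrix_invertible:
  assumes "pos_def_matrix A"
  shows "invertible A"
  unfolding invertible_left_inverse matrix_left_invertible_ker
  using assms by (metis inner_zero_right less_irrefl pos_def_matrix_def)

lemma matrix_add_rdistrib: "(A + B) ** C = A ** C + B ** C"
  for A B :: "real^'n^'m" and C :: "real^'k^'n"
  by (simp add: matrix_matrix_mult_def vec_eq_iff distrib_right sum.distrib)

text \<open>The matrix determinant lemma. An orthogonal change of basis turns \<open>u\<close> into
  a multiple of a basis vector; then the matrix differs from the identity in one row only, and row
  operations clear that row off the diagonal.\<close>

lemma det_mat_plus_outer_product:
  fixes u v :: "real^'n::finite"
  shows "det (mat 1 + outer_product u v) = 1 + u \<bullet> v"
proof (cases "u = 0")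
  case True
  then have "outer_product u v = 0" by (simp add: outer_product_def vec_eq_iff)
  then show ?thesis using True by simp
next
  case False
  fix k :: 'n
  have row: "det (mat 1 + outer_product (axis k 1) w) = 1 + w $ k" for w :: "real^'n"
  proof -
    let ?D = "\<chi> i j. if i = j then (if i = k then 1 + w $ k else 1) else (0::real)"
    have "w - w $ k *\<^sub>R axis k 1 = (\<Sum>i\<in>UNIV - {k}. w $ i *\<^sub>R axis i 1)"
      by (subst basis_expansion[of w, symmetric]) (simp add: sum.remove[of UNIV k] scalar_mult_eq_scaleR)
    also have "\<dots> = (\<Sum>i\<in>UNIV - {k}. w $ i *s row i ?D)"
      by (intro sum.cong) (auto simp: row_def axis_def vec_eq_iff)
    also have "\<dots> \<in> vec.span {row j ?D |j. j \<noteq> k}"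
      by (intro vec.span_sum vec.span_scale vec.span_base) auto
    finally have "det (\<chi> i. if i = k then row k ?D + (w - w $ k *\<^sub>R axis k 1) else row i ?D) = det ?D"
      by (rule det_row_span)
    moreover have "(\<chi> i. if i = k then row k ?D + (w - w $ k *\<^sub>R axis k 1) else row i ?D)
       = mat 1 + outer_product (axis k 1) w"
      by (auto simp: vec_eq_iff outer_product_def row_def mat_def axis_def)
    moreover have "det ?D = (\<Prod>i\<in>UNIV. ?D $ i $ i)" by (rule det_diagonal) simp
    moreover have "\<dots> = 1 + w $ k" by (simp add: prod.remove[of UNIV k])
    ultimately show ?thesis by simp
  qed
  obtain Q where Q: "orthogonal_matrix Q" "Q *v (axis k 1) = u /\<^sub>R norm u"
    using orthogonal_matrix_exists_basis[of "u /\<^sub>R norm u" k] False by auto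
  have QQ: "transpose Q ** Q = mat 1" and QQ': "Q ** transpose Q = mat 1"
    using Q(1) by (auto simp: orthogonal_matrix_def)
  have uQ: "u = norm u *\<^sub>R (Q *v axis k 1)" using Q(2) False by simp
  let ?w = "norm u *\<^sub>R (transpose Q *v v)"
  have op: "outer_product (Q *v a) b = Q ** outer_product a b" for a b
    by (simp add: outer_product_def vec_eq_iff matrix_matrix_mult_def matrix_vector_mult_def
        sum_distrib_left sum_distrib_right mult_ac)
  have op': "outer_product a b ** R = outer_product a (transpose R *v b)" for a b and R :: "real^'n^'n"
    by (simp add: outer_product_def vec_eq_iff matrix_matrix_mult_def matrix_vector_mult_def
        transpose_def sum_distrib_left mult_ac)
  have "outer_product u v = Q ** outer_product (axis k 1) ?w ** transpose Q"
  proof -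
    have "Q ** outer_product (axis k 1) ?w ** transpose Q = outer_product (Q *v axis k 1) (Q *v ?w)"
      by (simp add: op op' flip: matrix_mul_assoc)
    also have "Q *v ?w = norm u *\<^sub>R v"
      unfolding matrix_vector_mult_scaleR matrix_vector_mul_assoc QQ' matrix_vector_mul_lid ..
    also have "outer_product (Q *v axis k 1) (norm u *\<^sub>R v) = outer_product (norm u *\<^sub>R (Q *v axis k 1)) v"
      by (simp add: outer_product_def vec_eq_iff)
    finally show ?thesis using uQ by simp
  qed
  then have "mat 1 + outer_product u v = Q ** (mat 1 + outer_product (axis k 1) ?w) ** transpose Q"
    by (simp add: matrix_add_ldistrib matrix_add_rdistrib QQ')
  then have "det (mat 1 + outer_product u v) = det (Q ** transpose Q) * det (mat 1 + outer_product (axis k 1) ?w)"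
    by (simp add: det_mul)
  also have "\<dots> = 1 + ?w $ k" by (simp only: QQ' row) simp
  also have "?w $ k = ?w \<bullet> axis k 1" by (simp add: inner_axis)
  also have "\<dots> = norm u * (v \<bullet> (Q *v axis k 1))"
    by (simp flip: dot_lmul_matrix)
  also have "\<dots> = v \<bullet> u" by (subst (2) uQ) simp
  finally show ?thesis by (simp add: inner_commute)
qed

text \<open>Integrating over coordinate \<open>i\<close> first, \<open>u \<bullet> x\<close> is
  constant in that variable because \<open>u $ i = 0\<close>, so translation invariance on the line
  suffices.\<close>

lemma nn_integral_lborel_shear:
  fixes f :: "real^'n::finite \<Rightarrow> ennreal"
  assumes [measurable]: "f \<in> borel_measurable borel" and u: "u $ i = 0"
  shows "(\<integral>\<^sup>+x. f (x + (u \<bullet> x) *\<^sub>R axis i 1) \<partial>lborel) = (\<integral>\<^sup>+x. f x \<partial>lborel)"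
proof -
  let ?B = "Basis :: (real^'n) set" and ?e = "axis i 1 :: real^'n"
  interpret P: product_sigma_finite "\<lambda>_::real^'n. lborel :: real measure" ..
  have e: "?e \<in> ?B" by (auto simp: Basis_vec_def)
  define I where "I = ?B - {?e}"
  have B: "?B = insert ?e I" "?e \<notin> I" "finite I" using e by (auto simp: I_def)
  let ?s = "\<lambda>x :: real^'n \<Rightarrow> real. \<Sum>b\<in>Basis. x b *\<^sub>R b"
  have s: "?s (x(?e := y)) = (\<Sum>b\<in>I. x b *\<^sub>R b) + y *\<^sub>R ?e" for x y
  proof -
    have "?s (x(?e := y)) = y *\<^sub>R ?e + (\<Sum>b\<in>I. (x(?e := y)) b *\<^sub>R b)"
      unfolding B(1) by (subst sum.insert) (use B in auto)
    also have "(\<Sum>b\<in>I. (x(?e := y)) b *\<^sub>R b) = (\<Sum>b\<in>I. x b *\<^sub>R b)"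
      using B(2) by (intro sum.cong) auto
    finally show ?thesis by simp
  qed
  have *: "(\<integral>\<^sup>+x. g x \<partial>lborel) = (\<integral>\<^sup>+x. (\<integral>\<^sup>+y. g ((\<Sum>b\<in>I. x b *\<^sub>R b) + y *\<^sub>R ?e) \<partial>lborel) \<partial>Pi\<^sub>M I (\<lambda>_. lborel))"
    if [measurable]: "g \<in> borel_measurable borel" for g :: "real^'n \<Rightarrow> ennreal"
  proof -
    have "(\<integral>\<^sup>+x. g x \<partial>lborel) = (\<integral>\<^sup>+x. g (?s x) \<partial>Pi\<^sub>M ?B (\<lambda>_. lborel))"
      by (subst lborel_eq) (simp add: nn_integral_distr)
    also have "\<dots> = (\<integral>\<^sup>+x. (\<integral>\<^sup>+y. g (?s (x(?e := y))) \<partial>lborel) \<partial>Pi\<^sub>M I (\<lambda>_. lborel))"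
      using B(2,3) by (subst (1) B(1), subst P.product_nn_integral_insert) (auto simp flip: B(1))
    finally show ?thesis by (simp only: s)
  qed
  have ue: "u \<bullet> ?e = 0" using u by (simp add: inner_axis)
  have "(\<integral>\<^sup>+y. f ((v + y *\<^sub>R ?e) + (u \<bullet> (v + y *\<^sub>R ?e)) *\<^sub>R ?e) \<partial>lborel) = (\<integral>\<^sup>+y. f (v + y *\<^sub>R ?e) \<partial>lborel)" for v
  proof -
    have "(\<integral>\<^sup>+y. f (v + y *\<^sub>R ?e) \<partial>lborel) = (\<integral>\<^sup>+y. f (v + (u \<bullet> v + 1 * y) *\<^sub>R ?e) \<partial>lborel)"
      by (subst nn_integral_real_affine[of _ 1 "u \<bullet> v"]) auto
    then show ?thesis by (simp add: inner_add_right ue scaleR_add_left add_ac)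
  qed
  then show ?thesis by (subst (1 2) *) simp_all
qed

lemma nn_integral_gaussian_real:
  assumes s: "s > 0"
  shows "(\<integral>\<^sup>+x. ennreal (exp (- (s * x\<^sup>2) / 2)) \<partial>lborel) = ennreal (sqrt (2 * pi / s))"
proof -
  have "exp (- (s * x\<^sup>2) / 2) = sqrt (2 * pi / s) * normal_density 0 (1 / sqrt s) x" for x
    using s by (simp add: normal_density_def real_sqrt_divide real_sqrt_mult power_divide field_simps)
  then have "(\<integral>\<^sup>+x. ennreal (exp (- (s * x\<^sup>2) / 2)) \<partial>lborel)
     = ennreal (sqrt (2 * pi / s)) * (\<integral>\<^sup>+x. ennreal (normal_density 0 (1 / sqrt s) x) \<partial>lborel)"
    using s by (simp add: ennreal_mult nn_integral_cmult)
  also have "(\<integral>\<^sup>+x. ennreal (normal_density 0 (1 / sqrt s) x) \<partial>lborel) = 1"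
    using s by (subst nn_integral_eq_integral) auto
  finally show ?thesis by simp
qed

lemma prod_Basis_vec:
  fixes f :: "real^'n::finite \<Rightarrow> 'b::comm_monoid_mult"
  shows "(\<Prod>b\<in>Basis. f b) = (\<Prod>i\<in>UNIV. f (axis i 1))"
proof -
  have B: "(Basis :: (real^'n) set) = (\<lambda>i. axis i 1) ` UNIV" by (auto simp: Basis_vec_def)
  show ?thesis unfolding B by (subst prod.reindex) (auto simp: inj_on_def axis_eq_axis)
qed

lemma borel_measurable_quadratic_form[measurable]:
  "(\<lambda>x. x \<bullet> (S *v x)) \<in> borel_measurable borel" for S :: "real^'n::finite^'n"
  by (intro borel_measurable_continuous_onI continuous_intros linear_continuous_on
      linear_linear[THEN iffD2] matrix_vector_mul_linear)

lemma gaussian_integral_diag: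
  fixes S :: "real^'n::finite^'n"
  assumes pd: "pos_def_matrix S" and diag: "\<And>i k. i \<noteq> k \<Longrightarrow> S $ i $ k = 0"
  shows "det S > 0" "(\<integral>\<^sup>+x. ennreal (exp (- (x \<bullet> (S *v x)) / 2)) \<partial>lborel) = ennreal (sqrt ((2 * pi) ^ CARD('n) / det S))"
proof -
  have det: "det S = (\<Prod>i\<in>UNIV. S $ i $ i)" by (rule det_diagonal[OF diag])
  have Sv: "(S *v x) $ i = S $ i $ i * x $ i" for x i
    using diag[of i] by (simp add: matrix_vector_mult_def sum.remove[of UNIV i])
  have pos: "S $ i $ i > 0" for i
  proof -
    have "axis i (1::real) \<noteq> (0 :: real^'n)" by (simp add: axis_eq_0_iff)
    then have "axis i 1 \<bullet> (S *v axis i 1) > 0" using pd unfolding pos_def_matrix_def by blast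
    then show ?thesis by (simp add: inner_axis' Sv)
  qed
  then show "det S > 0" unfolding det by (intro prod_pos) auto
  have "exp (- (x \<bullet> (S *v x)) / 2) = (\<Prod>b\<in>Basis. exp (- ((b \<bullet> (S *v b)) * (x \<bullet> b)\<^sup>2) / 2))" for x :: "real^'n"
    unfolding prod_Basis_vec
    by (simp add: inner_axis inner_axis' Sv exp_sum[symmetric] inner_vec_def[of x] sum_negf[symmetric]
        sum_divide_distrib power2_eq_square mult_ac)
  then have "(\<integral>\<^sup>+x. ennreal (exp (- (x \<bullet> (S *v x)) / 2)) \<partial>lborel)
     = (\<integral>\<^sup>+x. (\<Prod>b\<in>Basis. ennreal (exp (- ((b \<bullet> (S *v b)) * (x \<bullet> b)\<^sup>2) / 2))) \<partial>(lborel :: (real^'n) measure))"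
    by (simp add: prod_ennreal)
  also have "\<dots> = (\<Prod>b\<in>Basis. \<integral>\<^sup>+x. ennreal (exp (- ((b \<bullet> (S *v b)) * x\<^sup>2) / 2)) \<partial>lborel)"
    by (rule nn_integral_lborel_prod) auto
  also have "\<dots> = (\<Prod>i\<in>UNIV. ennreal (sqrt (2 * pi / S $ i $ i)))"
    unfolding prod_Basis_vec by (intro prod.cong refl) (simp add: inner_axis' Sv nn_integral_gaussian_real[OF pos, simplified])
  also have "\<dots> = ennreal (\<Prod>i\<in>UNIV. sqrt (2 * pi / S $ i $ i))"
    using pos by (intro prod_ennreal) (auto simp: less_imp_le)
  also have "(\<Prod>i\<in>UNIV. sqrt (2 * pi / S $ i $ i)) = sqrt ((2 * pi) ^ CARD('n) / det S)"
  proof -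
    have "(\<Prod>i\<in>I. sqrt (h i)) = sqrt (\<Prod>i\<in>I. h i)" for I :: "'n set" and h
      by (induction I rule: infinite_finite_induct) (simp_all add: real_sqrt_mult)
    then show ?thesis by (simp add: det prod_dividef)
  qed
  finally show "(\<integral>\<^sup>+x. ennreal (exp (- (x \<bullet> (S *v x)) / 2)) \<partial>lborel) = ennreal (sqrt ((2 * pi) ^ CARD('n) / det S))" .
qed

text \<open>
  Symmetric elimination: the shear \<open>x \<mapsto> x + (u \<bullet> x) e\<^sub>i\<close> preserves Lebesgue measure and, for
  suitable \<open>u\<close>, clears row and column \<open>i\<close> of the quadratic form.
\<close>

lemma gaussian_integral_aux:
  fixes S :: "real^'n::finite^'n"
  assumes "finite J" "pos_def_matrix S" "\<And>i k. i \<noteq> k \<Longrightarrow> S $ i $ k \<noteq> 0 \<Longrightarrow> i \<in> J \<and> k \<in> J"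
  shows "det S > 0 \<and>
    (\<integral>\<^sup>+x. ennreal (exp (- (x \<bullet> (S *v x)) / 2)) \<partial>lborel) = ennreal (sqrt ((2 * pi) ^ CARD('n) / det S))"
  using assms
proof (induction J arbitrary: S)
  case empty
  then show ?case using gaussian_integral_diag[of S] by blast
next
  case (insert i J)
  note pd = insert.prems(1)
  have sym: "S $ a $ b = S $ b $ a" for a b
  proof -
    have "transpose S = S" using pd by (simp add: pos_def_matrix_def)
    then have "S $ a $ b = transpose S $ a $ b" by simp
    then show ?thesis by (simp add: transpose_def)
  qed
  have Sii: "S $ i $ i > 0"
  proof -
    have "axis i (1::real) \<noteq> (0 :: real^'n)" by (simp add: axis_eq_0_iff)
    then have "axis i 1 \<bullet> (S *v axis i 1) > 0" using pd unfolding pos_def_matrix_def by blast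
    then show ?thesis by (simp add: inner_axis' matrix_vector_mult_basis column_def)
  qed
  \<comment> \<open>For \<open>k \<noteq> i\<close> the entries solve
    \<open>S $ i $ k + S $ i $ i * u $ k = 0\<close>; the entry at \<open>i\<close> is 0 so that the
    shear preserves volume.\<close>
  define u :: "real^'n" where "u = (\<chi> k. if k = i then 0 else - S $ i $ k / S $ i $ i)"
  define E where "E = mat 1 + outer_product (axis i 1) u"
  have ui: "u $ i = 0" by (simp add: u_def)
  have Ev: "E *v x = x + (u \<bullet> x) *\<^sub>R axis i 1" for x
    by (simp add: E_def matrix_vector_mult_add_rdistrib)
       (simp add: outer_product_def matrix_vector_mult_def vec_eq_iff inner_vec_def axis_def)
  have detE: "det E = 1" unfolding E_def det_mat_plus_outer_product using ui by (simp add: inner_axis')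
  define R where "R = transpose E ** S ** E"
  have R: "x \<bullet> (R *v x) = (E *v x) \<bullet> (S *v (E *v x))" for x
    unfolding R_def by (metis dot_lmul_matrix matrix_vector_mul_assoc vector_transpose_matrix transpose_transpose)
  have Re: "R $ a $ b = S $ a $ b + S $ a $ i * u $ b + u $ a * (S $ i $ b + S $ i $ i * u $ b)" for a b
  proof -
    have "(S ** E) $ c $ b = S $ c $ b + S $ c $ i * u $ b" for c
      unfolding E_def matrix_add_ldistrib matrix_mul_rid
      by (simp add: matrix_matrix_mult_def outer_product_def axis_def if_distrib[of "\<lambda>x. _ * x"]
          if_distrib[of "\<lambda>x. x * _"] sum.delta cong: if_cong)
    moreover have "(transpose E ** X) $ a $ b = X $ a $ b + u $ a * X $ i $ b" for X :: "real^'n^'n"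
    proof -
      have "transpose E = mat 1 + outer_product u (axis i 1)"
        by (auto simp: E_def transpose_def mat_def outer_product_def vec_eq_iff)
      then have "transpose E ** X = X + outer_product u (axis i 1) ** X"
        by (simp only: matrix_add_rdistrib matrix_mul_lid)
      then show ?thesis
        by (simp add: matrix_matrix_mult_def outer_product_def axis_def if_distrib[of "\<lambda>x. _ * x"]
          if_distrib[of "\<lambda>x. x * _"] sum.delta cong: if_cong)
    qed
    ultimately show ?thesis unfolding R_def matrix_mul_assoc[symmetric] by simp
  qed
  have row: "S $ i $ b + S $ i $ i * u $ b = 0" if "b \<noteq> i" for b
    using that Sii by (simp add: u_def)
  have "pos_def_matrix R"
    unfolding pos_def_matrix_def
  proof safe
    show "transpose R = R"
      using pd by (simp add: R_def matrix_transpose_mul matrix_mul_assoc pos_def_matrix_def)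
    fix x :: "real^'n" assume "x \<noteq> 0"
    moreover have "invertible E" using detE by (simp add: invertible_det_nz)
    ultimately have "E *v x \<noteq> 0"
      using matrix_left_invertible_ker[of E] by (auto simp: invertible_left_inverse)
    then show "0 < x \<bullet> (R *v x)" unfolding R using pd by (auto simp: pos_def_matrix_def)
  qed
  \<comment> \<open>Elimination may create new off-diagonal entries
    \<open>S $ a $ i * u $ b\<close>, but only between indices that were both coupled to
    \<open>i\<close>, and these lie in \<open>J\<close>.\<close>
  moreover have "a \<in> J \<and> b \<in> J" if ab: "a \<noteq> b" "R $ a $ b \<noteq> 0" for a b
  proof -
    have symR: "R $ a $ b = R $ b $ a" for a b
      unfolding Re using sym by (simp add: algebra_simps)
    have Ri: "R $ i $ c = 0" if "c \<noteq> i" for c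
      unfolding Re using ui row[OF that] by simp
    have ni: "a \<noteq> i" "b \<noteq> i" using ab Ri symR by metis+
    have Rab: "R $ a $ b = S $ a $ b + S $ a $ i * u $ b" unfolding Re using row[OF ni(2)] by simp
    have 1: "a \<in> J" if "S $ a $ b \<noteq> 0 \<or> S $ a $ i \<noteq> 0"
      using that insert.prems(2)[of a b] insert.prems(2)[of a i] ab(1) ni by auto
    have 2: "b \<in> J" if "S $ a $ b \<noteq> 0 \<or> u $ b \<noteq> 0"
      using that insert.prems(2)[of a b] insert.prems(2)[of i b] ab(1) ni by (auto simp: u_def)
    have "S $ a $ b \<noteq> 0 \<or> S $ a $ i \<noteq> 0 \<and> u $ b \<noteq> 0" using ab(2) Rab by auto
    then show ?thesis using 1 2 by blast
  qed
  ultimately have IH: "det R > 0"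
    "(\<integral>\<^sup>+x. ennreal (exp (- (x \<bullet> (R *v x)) / 2)) \<partial>lborel) = ennreal (sqrt ((2 * pi) ^ CARD('n) / det R))"
    using insert.IH[of R] by blast+
  have detR: "det R = det S" unfolding R_def by (simp add: det_mul detE det_transpose)
  have "(\<integral>\<^sup>+x. ennreal (exp (- (x \<bullet> (R *v x)) / 2)) \<partial>lborel)
     = (\<integral>\<^sup>+x. ennreal (exp (- (x \<bullet> (S *v x)) / 2)) \<partial>lborel)"
    unfolding R Ev by (rule nn_integral_lborel_shear[of "\<lambda>x. ennreal (exp (- (x \<bullet> (S *v x)) / 2))" u i]) (use ui in auto)
  then show ?case using IH detR by simp
qed

text \<open>A by-product of the elimination: shears have determinant 1 and the final diagonal form
  has positive entries.\<close>

lemma det_pos_def_matrix: "pos_def_matrix S \<Longrightarrow> det S > 0"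
  using gaussian_integral_aux[of UNIV S] by auto

lemma nn_integral_gaussian:
  fixes S :: "real^'n::finite^'n"
  assumes "pos_def_matrix S"
  shows "(\<integral>\<^sup>+x. ennreal (exp (- (x \<bullet> (S *v x)) / 2)) \<partial>lborel) = ennreal (sqrt ((2 * pi) ^ CARD('n) / det S))"
  using gaussian_integral_aux[of UNIV S] assms by auto

text \<open>\<open>c\<close> is the minimum of the form on the unit sphere, which is attained by
  compactness; homogeneity does the rest.\<close>

lemma pos_def_matrix_bound:
  fixes S :: "real^'n::finite^'n"
  assumes "pos_def_matrix S"
  obtains c where "c > 0" "\<And>x. x \<bullet> (S *v x) \<ge> c * (norm x)\<^sup>2"
proof -
  have cont: "continuous_on (sphere 0 1) (\<lambda>x. x \<bullet> (S *v x))"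
    by (intro continuous_intros linear_continuous_on linear_linear[THEN iffD2] matrix_vector_mul_linear)
  have "axis (undefined :: 'n) (1::real) \<in> sphere 0 1" by simp
  then obtain y where y: "y \<in> sphere 0 1" "\<And>x. x \<in> sphere 0 1 \<Longrightarrow> y \<bullet> (S *v y) \<le> x \<bullet> (S *v x)"
    using continuous_attains_inf[OF compact_sphere _ cont] by blast
  show thesis
  proof
    show "y \<bullet> (S *v y) > 0" using y(1) assms unfolding pos_def_matrix_def by (metis mem_sphere_0 norm_zero zero_neq_one)
    fix x :: "real^'n"
    show "x \<bullet> (S *v x) \<ge> y \<bullet> (S *v y) * (norm x)\<^sup>2"
    proof (cases "x = 0")
      case False
      have "y \<bullet> (S *v y) \<le> (x /\<^sub>R norm x) \<bullet> (S *v (x /\<^sub>R norm x))"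
        using False by (intro y(2)) simp
      also have "\<dots> = (x \<bullet> (S *v x)) / (norm x)\<^sup>2"
        by (simp add: matrix_vector_mult_scaleR power2_eq_square divide_inverse)
      finally show ?thesis using False by (simp add: field_simps)
    qed simp
  qed
qed

section \<open>Second-order expansions on the simplex\<close>

lemma matrix_vector_mult_linear_eq:
  fixes f :: "real^'n::finite \<Rightarrow> real^'m::finite"
  assumes "linear f"
  shows "matrix f *v v = f v"
  using matrix_vector_mul(2)[OF assms] by metis

text \<open>Peano's form of the remainder. The mean value theorem is applied once, to the difference
  \<open>\<phi>\<close> of \<open>f\<close> and its quadratic polynomial along the segment; the
  derivative of \<open>\<phi>\<close> is small by differentiability of the gradient at the single
  point \<open>x\<close>.\<close>

lemma taylor_second_order:
  fixes f :: "real^'n::finite \<Rightarrow> real" and g :: "real^'n \<Rightarrow> real^'n"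
  assumes S: "open S" "x \<in> S"
    and f: "\<And>y. y \<in> S \<Longrightarrow> (f has_derivative (\<lambda>v. g y \<bullet> v)) (at y)"
    and g: "(g has_derivative (\<lambda>v. B *v v)) (at x)"
    and e: "e > 0"
  shows "\<exists>r>0. ball x r \<subseteq> S \<and>
    (\<forall>z. norm z < r \<longrightarrow> \<bar>f (x + z) - f x - g x \<bullet> z - (z \<bullet> (B *v z)) / 2\<bar> \<le> e * (norm z)\<^sup>2)"
proof -
  obtain r1 where r1: "r1 > 0" "ball x r1 \<subseteq> S" using S by (meson openE)
  obtain r2 where r2: "r2 > 0" "\<And>y. norm (y - x) < r2 \<Longrightarrow> norm (g y - g x - B *v (y - x)) \<le> e * norm (y - x)"
    using g e unfolding has_derivative_at_alt by blast
  show ?thesis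
  proof (intro exI[of _ "min r1 r2"] conjI allI impI)
    show "min r1 r2 > 0" using r1 r2 by simp
    show "ball x (min r1 r2) \<subseteq> S" using r1 by auto
    fix z :: "real^'n" assume z: "norm z < min r1 r2"
    define \<phi> where "\<phi> t = f (x + t *\<^sub>R z) - t * (g x \<bullet> z) - t\<^sup>2 / 2 * (z \<bullet> (B *v z))" for t :: real
    define \<phi>' where "\<phi>' t = g (x + t *\<^sub>R z) \<bullet> z - g x \<bullet> z - t * (z \<bullet> (B *v z))" for t :: real
    have tz: "norm (t *\<^sub>R z) \<le> norm z" if "0 \<le> t" "t \<le> 1" for t
      using that by (simp add: mult_left_le_one_le)
    have der: "(\<phi> has_real_derivative \<phi>' t) (at t)" if t: "0 \<le> t" "t \<le> 1" for t
    proof -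
      have "x + t *\<^sub>R z \<in> S" using tz[OF t] z r1 by (auto simp: dist_norm)
      then have "((\<lambda>t. f (x + t *\<^sub>R z)) has_derivative (\<lambda>h. g (x + t *\<^sub>R z) \<bullet> (h *\<^sub>R z))) (at t)"
        by (intro has_derivative_compose[of "\<lambda>t. x + t *\<^sub>R z", OF _ f]) (auto intro!: derivative_eq_intros)
      then have "((\<lambda>t. f (x + t *\<^sub>R z)) has_real_derivative (g (x + t *\<^sub>R z) \<bullet> z)) (at t)"
        by (simp add: has_field_derivative_def mult_commute_abs)
      then show ?thesis unfolding \<phi>_def \<phi>'_def
        by (auto intro!: derivative_eq_intros)
    qed
    obtain t where t: "0 < t" "t < 1" "\<phi> 1 - \<phi> 0 = (1 - 0) * \<phi>' t"
      using MVT2[of 0 1 \<phi> \<phi>'] der by auto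
    have "\<phi>' t = (g (x + t *\<^sub>R z) - g x - B *v (t *\<^sub>R z)) \<bullet> z"
      by (simp add: \<phi>'_def inner_diff_left matrix_vector_mult_scaleR inner_commute[of z])
    then have "\<bar>\<phi>' t\<bar> \<le> norm (g (x + t *\<^sub>R z) - g x - B *v (t *\<^sub>R z)) * norm z"
      by (simp add: Cauchy_Schwarz_ineq2)
    also have "\<dots> \<le> e * norm (t *\<^sub>R z) * norm z"
      using r2(2)[of "x + t *\<^sub>R z"] tz[of t] t z by (intro mult_right_mono) auto
    also have "\<dots> \<le> e * norm z * norm z"
      using tz[of t] t e by (intro mult_right_mono mult_left_mono) auto
    finally show "\<bar>f (x + z) - f x - g x \<bullet> z - (z \<bullet> (B *v z)) / 2\<bar> \<le> e * (norm z)\<^sup>2"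
      using t(3) by (simp add: \<phi>_def power2_eq_square mult_ac algebra_simps)
  qed
qed

lemma partial_eq:
  assumes "(f has_derivative (\<lambda>v. g \<bullet> v)) (at y)"
  shows "partial k f y = g $ k"
proof -
  have "((\<lambda>t. f (y + t *\<^sub>R axis k 1)) has_derivative (\<lambda>h. g \<bullet> (h *\<^sub>R axis k 1))) (at 0)"
    by (rule has_derivative_compose[of "\<lambda>t. y + t *\<^sub>R axis k 1" "\<lambda>h. h *\<^sub>R axis k 1"])
      (use assms in \<open>auto intro!: derivative_eq_intros\<close>)
  then have "((\<lambda>t. f (y + t *\<^sub>R axis k 1)) has_real_derivative (g $ k)) (at 0)"
    by (simp add: has_field_derivative_def inner_axis mult_commute_abs)
  then show ?thesis unfolding partial_def by (rule DERIV_imp_deriv)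
qed

text \<open>The transpose reflects the order of the two partial derivatives. It does no harm in the
  expansions, as a quadratic form takes the same values for a matrix and its transpose.\<close>

lemma hessian_eq:
  fixes f :: "real^'n::finite \<Rightarrow> real"
  assumes S: "open S" "x \<in> S"
    and f: "\<And>y. y \<in> S \<Longrightarrow> (f has_derivative (\<lambda>v. g y \<bullet> v)) (at y)"
    and g: "(g has_derivative (\<lambda>v. B *v v)) (at x)"
  shows "hessian f x = transpose B"
proof -
  have "partial i (partial k f) x = B $ k $ i" for i k
  proof -
    have "((\<lambda>y. axis k 1 \<bullet> g y) has_derivative (\<lambda>v. axis k 1 \<bullet> (B *v v))) (at x)"
      using g by (rule has_derivative_inner_right)
    then have "((\<lambda>y. axis k 1 \<bullet> g y) has_derivative (\<lambda>v. row k B \<bullet> v)) (at x)"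
      by (simp add: inner_axis' matrix_mult_dot row_def)
    then have "(partial k f has_derivative (\<lambda>v. row k B \<bullet> v)) (at x)"
      by (rule has_derivative_transform_within_open[OF _ S]) (simp add: partial_eq[OF f] inner_axis')
    from partial_eq[OF this] show ?thesis by (simp add: row_def)
  qed
  then show ?thesis by (simp add: hessian_def transpose_def vec_eq_iff)
qed

lemma has_derivative_vec_lambda:
  fixes f :: "'a::real_normed_vector \<Rightarrow> real^'n::finite"
  assumes "\<And>i. ((\<lambda>x. f x $ i) has_derivative (\<lambda>v. f' v $ i)) (at x within S)"
  shows "(f has_derivative f') (at x within S)"
proof (rule has_derivative_componentwise_within[THEN iffD2], rule ballI)
  fix b :: "real^'n" assume "b \<in> Basis"
  then obtain i where b: "b = axis i 1" by (auto simp: Basis_vec_def)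
  show "((\<lambda>x. f x \<bullet> b) has_derivative (\<lambda>v. f' v \<bullet> b)) (at x within S)"
    unfolding b inner_axis inner_real_def mult_1_right by (rule assms)
qed

section \<open>Coordinates on the simplex\<close>

lemma full_point_simps [simp]:
  "full_point m $ None = 1 - (\<Sum>i\<in>UNIV. m $ i)" "full_point m $ Some i = m $ i"
  by (simp_all add: full_point_def)

lemma full_vec_simps [simp]:
  "full_vec m $ None = - (\<Sum>i\<in>UNIV. m $ i)" "full_vec m $ Some i = m $ i"
  by (simp_all add: full_vec_def)

lemma full_point_add: "full_point (x + v) = full_point x + full_vec v"
  unfolding vec_eq_iff by (rule allI, case_tac i) (simp_all add: sum.distrib)

lemma linear_full_vec: "linear full_vec"
proof (rule linearI)
  show "full_vec (x + y) = full_vec x + full_vec y" for x y :: "real^'a"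
    unfolding vec_eq_iff by (rule allI, case_tac i) (simp_all add: sum.distrib)
  show "full_vec (c *\<^sub>R x) = c *\<^sub>R full_vec x" for c and x :: "real^'a"
    unfolding vec_eq_iff by (rule allI, case_tac i) (simp_all add: sum_distrib_left)
qed

lemma sum_option_UNIV: "(\<Sum>k\<in>UNIV. f k) = f None + (\<Sum>i\<in>UNIV. f (Some i))"
  for f :: "'n::finite option \<Rightarrow> real"
  by (simp add: UNIV_option_conv sum.reindex)

lemma prod_option_UNIV: "(\<Prod>k\<in>UNIV. f k) = f None * (\<Prod>i\<in>UNIV. f (Some i))"
  for f :: "'n::finite option \<Rightarrow> real"
  by (simp add: UNIV_option_conv prod.reindex)

lemma sum_full_point: "(\<Sum>k\<in>UNIV. full_point m $ k) = 1"
  by (simp add: sum_option_UNIV)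

lemma sum_full_vec: "(\<Sum>k\<in>UNIV. full_vec m $ k) = 0"
  by (simp add: sum_option_UNIV)

lemma full_point_in_prob_simplex_iff: "full_point m \<in> prob_simplex \<longleftrightarrow> m \<in> hat_simplex"
proof -
  have "full_point m $ k \<le> 1 \<and> 0 \<le> full_point m $ k" if "m \<in> hat_simplex" for k
    using that by (cases k) (auto simp: hat_simplex_def intro: sum_nonneg)
  moreover have "m \<in> hat_simplex" if "\<And>k. 0 \<le> full_point m $ k" "\<And>k. full_point m $ k \<le> 1"
    using that[of "Some _"] that(1)[of None] by (auto simp: hat_simplex_def) 
  ultimately show ?thesis by (auto simp: prob_simplex_def sum_full_point)
qed

lemma interior_hat_simplexD:
  assumes "m \<in> interior hat_simplex"
  shows "full_point m $ k > 0"
proof -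
  obtain e where e: "e > 0" "cball m e \<subseteq> hat_simplex"
    using assms by (auto simp: mem_interior_cball)
  fix j :: 'a
  have "m - e *\<^sub>R axis i 1 \<in> hat_simplex" "m + e *\<^sub>R axis i 1 \<in> hat_simplex" for i
    using e by (auto simp: dist_norm subset_eq)
  then have 1: "full_point (m - e *\<^sub>R axis i 1) $ k \<ge> 0" "full_point (m + e *\<^sub>R axis i 1) $ k \<ge> 0" for i k
    by (metis (no_types, lifting) full_point_in_prob_simplex_iff mem_Collect_eq prob_simplex_def)+
  show ?thesis
  proof (cases k)
    case None
    have "(\<Sum>i\<in>UNIV. axis j (1::real) $ i) = 1" by (simp add: axis_def)
    then have "full_point (m + e *\<^sub>R axis j 1) $ None = full_point m $ None - e"
      by (simp add: sum.distrib sum_distrib_left[symmetric])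
    then show ?thesis using 1(2)[where i = j and k = None] e(1) None by (metis add_0 diff_ge_0_iff_ge order_less_le_trans)
  next
    case (Some i)
    have "full_point (m - e *\<^sub>R axis i 1) $ Some i = full_point m $ Some i - e" by simp
    then show ?thesis using 1(1)[where i = i and k = "Some i"] e(1) Some by (metis diff_ge_0_iff_ge order_less_le_trans)
  qed
qed

text \<open>The derivatives within the simplex are pulled back along an affine chart; at interior
  points of the chart they become ordinary derivatives. Gradient and Hessian are paired only with
  vectors \<open>full_vec v\<close>, whose coordinates sum to 0, so their ambiguity normal to the
  simplex disappears.\<close>

lemma C2_on_full_point:
  fixes F :: "real^('n::finite option) \<Rightarrow> real"
  assumes "C2_on prob_simplex F"
  obtains g :: "real^'n \<Rightarrow> real^'n" and B :: "real^'n \<Rightarrow> real^'n^'n" where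
    "\<And>y. y \<in> interior hat_simplex \<Longrightarrow> ((\<lambda>x. F (full_point x)) has_derivative (\<lambda>v. g y \<bullet> v)) (at y)"
    "\<And>y. y \<in> interior hat_simplex \<Longrightarrow> (g has_derivative (\<lambda>v. B y *v v)) (at y)"
proof -
  obtain G h where G: "\<And>x. x \<in> prob_simplex \<Longrightarrow> (F has_derivative (\<lambda>v. G x \<bullet> v)) (at x within prob_simplex)"
    and h: "\<And>x. x \<in> prob_simplex \<Longrightarrow> (G has_derivative (\<lambda>v. h x *v v)) (at x within prob_simplex)"
    using assms unfolding C2_on_def by blast
  let ?S = "hat_simplex :: (real^'n) set"
  have img: "full_point ` ?S \<subseteq> prob_simplex" using full_point_in_prob_simplex_iff by blast
  have fp: "(full_point has_derivative full_vec) (at y within ?S)" for y :: "real^'n"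
  proof -
    have eq: "full_point = (\<lambda>x. full_point 0 + full_vec x)"
      using full_point_add[of 0] by (auto simp: fun_eq_iff)
    have "(full_vec has_derivative full_vec) (at y within ?S)"
      using linear_full_vec linear_imp_has_derivative by blast
    then show ?thesis by (subst eq) (auto intro!: derivative_eq_intros)
  qed
  define g where "g y = (\<chi> k. G (full_point y) \<bullet> full_vec (axis k (1::real)))" for y :: "real^'n"
  define L where "L y = (\<lambda>v. \<chi> k. (h (full_point y) *v full_vec v) \<bullet> full_vec (axis k (1::real)))" for y :: "real^'n"
  have linL: "linear (L y)" for y
    unfolding L_def
    by (intro linearI) (auto simp: linear_add[OF linear_full_vec] linear_scale[OF linear_full_vec] vec_eq_iff matrix_vector_right_distrib inner_add_left matrix_vector_mult_scaleR)
  show thesis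
  proof
    fix y :: "real^'n" assume y: "y \<in> interior ?S"
    then have yS: "y \<in> ?S" using interior_subset by auto
    have pS: "full_point y \<in> prob_simplex" using yS by (simp add: full_point_in_prob_simplex_iff)
    have at: "at y within ?S = at y" using y by (rule at_within_interior)
    have dcomp: "((\<lambda>x. \<Phi> (full_point x)) has_derivative (\<lambda>v. \<Phi>' (full_vec v))) (at y)"
      if "(\<Phi> has_derivative \<Phi>') (at (full_point y) within prob_simplex)" for \<Phi> \<Phi>'
      using has_derivative_in_compose[OF fp has_derivative_subset[OF that img]] unfolding at by simp
    have "G (full_point y) \<bullet> full_vec v = g y \<bullet> v" for v
    proof -
      have "full_vec v = (\<Sum>k\<in>UNIV. v $ k *\<^sub>R full_vec (axis k 1))"
        by (subst basis_expansion[of v, symmetric])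
          (simp add: linear_sum[OF linear_full_vec] linear_scale[OF linear_full_vec] scalar_mult_eq_scaleR)
      then show ?thesis by (simp add: g_def inner_sum_right inner_vec_def[of "vec_lambda _"] mult_ac)
    qed
    then show "((\<lambda>x. F (full_point x)) has_derivative (\<lambda>v. g y \<bullet> v)) (at y)"
      using dcomp[OF G[OF pS]] by simp
    have "(g has_derivative L y) (at y)"
    proof (rule has_derivative_vec_lambda)
      show "((\<lambda>x. g x $ k) has_derivative (\<lambda>v. L y v $ k)) (at y)" for k
        unfolding g_def L_def using has_derivative_inner_left[OF dcomp[OF h[OF pS]]] by simp
    qed
    then show "(g has_derivative (\<lambda>v. matrix (L y) *v v)) (at y)"
      by (simp add: matrix_vector_mult_linear_eq[OF linL])
  qed
qed

text \<open>The negative Hessian of the entropy in the \<open>q - 1\<close> free coordinates, that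
  is, the Fisher information of a single spin.\<close>

definition ent_hess :: "real^'n::finite \<Rightarrow> real^'n^'n" where
  "ent_hess m = (\<chi> i k. (if i = k then 1 / m $ i else 0) + 1 / full_point m $ None)"

lemma ent_hess_mult: "(ent_hess m *v v) $ i = v $ i / m $ i + (\<Sum>k\<in>UNIV. v $ k) / full_point m $ None"
  by (simp add: ent_hess_def matrix_vector_mult_def distrib_right sum.distrib sum_divide_distrib
      if_distrib[of "\<lambda>x. x * _"] cong: if_cong)

text \<open>In all \<open>q\<close> coordinates the form is diagonal: the constant present in every
  matrix entry is the contribution of the dependent last coordinate.\<close>

lemma ent_hess_bilinear_form:
  "v \<bullet> (ent_hess m *v w) = (\<Sum>k\<in>UNIV. full_vec v $ k * full_vec w $ k / full_point m $ k)"
  by (simp add: inner_vec_def ent_hess_mult sum_option_UNIV distrib_left sum.distrib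
      sum_distrib_right[symmetric] sum_divide_distrib[symmetric])

lemma ent_hess_quadratic_form: "v \<bullet> (ent_hess m *v v) = (\<Sum>k\<in>UNIV. (full_vec v $ k)\<^sup>2 / full_point m $ k)"
  by (simp add: ent_hess_bilinear_form power2_eq_square del: full_vec_simps full_point_simps)

lemma has_derivative_ent_full_point:
  fixes y :: "real^'n::finite"
  assumes y: "y \<in> interior hat_simplex"
  shows "((\<lambda>x. ent (full_point x)) has_derivative
     (\<lambda>v. (\<chi> k. ln (full_point y $ None) - ln (y $ k)) \<bullet> v)) (at y)"
    and "((\<lambda>y. \<chi> k. ln (full_point y $ None) - ln (y $ k)) has_derivative (\<lambda>v. - ent_hess y *v v)) (at y)"
proof -
  have pos: "full_point y $ None > 0" "y $ i > 0" for i
    using interior_hat_simplexD[OF y, of None] interior_hat_simplexD[OF y, of "Some i"] by auto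
  have nth: "((\<lambda>x. x $ k) has_derivative (\<lambda>v. v $ k)) (at y)" for k
    by (rule bounded_linear_imp_has_derivative) (rule bounded_linear_vec_nth)
  let ?s = "\<lambda>x :: real^'n. 1 - (\<Sum>i\<in>UNIV. x $ i)"
  have s: "(?s has_derivative (\<lambda>v. - (\<Sum>i\<in>UNIV. v $ i))) (at y)"
    by (auto intro!: derivative_eq_intros nth)
  have 1: "((\<lambda>x. x $ k * ln (x $ k)) has_derivative (\<lambda>v. v $ k * ln (y $ k) + v $ k)) (at y)" for k
    using pos(2)[of k] by (intro has_derivative_eq_rhs[OF has_derivative_mult[OF nth has_derivative_ln[OF _ nth]]])
      (auto simp: fun_eq_iff)
  have 2: "((\<lambda>x. ?s x * ln (?s x)) has_derivative
      (\<lambda>v. - (\<Sum>i\<in>UNIV. v $ i) * ln (?s y) - (\<Sum>i\<in>UNIV. v $ i))) (at y)"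
  proof (rule has_derivative_eq_rhs)
    show "((\<lambda>x. ?s x * ln (?s x)) has_derivative
      (\<lambda>v. ?s y * (- (\<Sum>i\<in>UNIV. v $ i) * inverse (?s y)) + (- (\<Sum>i\<in>UNIV. v $ i)) * ln (?s y))) (at y)"
      using pos(1) by (intro has_derivative_mult[OF s has_derivative_ln[OF _ s]]) simp
  qed (use pos(1) in \<open>auto simp: fun_eq_iff field_simps\<close>)
  have "((\<lambda>x. - (?s x * ln (?s x) + (\<Sum>k\<in>UNIV. x $ k * ln (x $ k)))) has_derivative
      (\<lambda>v. - ((- (\<Sum>i\<in>UNIV. v $ i) * ln (?s y) - (\<Sum>i\<in>UNIV. v $ i)) + (\<Sum>k\<in>UNIV. v $ k * ln (y $ k) + v $ k)))) (at y)"
    by (intro has_derivative_minus has_derivative_add has_derivative_sum 1 2)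
  moreover have "- ((- (\<Sum>i\<in>UNIV. v $ i) * ln (?s y) - (\<Sum>i\<in>UNIV. v $ i)) + (\<Sum>k\<in>UNIV. v $ k * ln (y $ k) + v $ k))
      = (\<chi> k. ln (full_point y $ None) - ln (y $ k)) \<bullet> v" for v :: "real^'n"
    by (simp add: inner_vec_def left_diff_distrib right_diff_distrib sum_subtractf sum.distrib sum_distrib_left sum_distrib_right mult_ac)
  ultimately show "((\<lambda>x. ent (full_point x)) has_derivative
     (\<lambda>v. (\<chi> k. ln (full_point y $ None) - ln (y $ k)) \<bullet> v)) (at y)"
    by (simp add: ent_def sum_option_UNIV)
  show "((\<lambda>y. \<chi> k. ln (full_point y $ None) - ln (y $ k)) has_derivative (\<lambda>v. - ent_hess y *v v)) (at y)"
  proof (rule has_derivative_vec_lambda)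
    fix k
    have "((\<lambda>x. ln (?s x) - ln (x $ k)) has_derivative (\<lambda>v. (- (\<Sum>i\<in>UNIV. v $ i)) / ?s y - v $ k / y $ k)) (at y)"
      using pos by (intro has_derivative_eq_rhs[OF has_derivative_diff[OF has_derivative_ln[OF _ s] has_derivative_ln[OF _ nth]]])
        (auto simp: divide_inverse)
    moreover have "(- ent_hess y *v v) $ k = (- (\<Sum>i\<in>UNIV. v $ i)) / ?s y - v $ k / y $ k" for v
    proof -
      have "- ent_hess y *v v = - (ent_hess y *v v)"
        by (simp add: matrix_vector_mult_def vec_eq_iff sum_negf)
      then show ?thesis by (simp add: ent_hess_mult)
    qed
    ultimately show "((\<lambda>x. (\<chi> k. ln (full_point x $ None) - ln (x $ k)) $ k) has_derivative (\<lambda>v. (- ent_hess y *v v) $ k)) (at y)"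
      by simp
  qed
qed

section \<open>Continuity of the free energy up to the boundary\<close>

lemma continuous_on_mult_ln: "continuous_on {0..} (\<lambda>x::real. x * ln x)"
  unfolding continuous_on_eq_continuous_within
proof
  fix x :: real assume x: "x \<in> {0..}"
  show "continuous (at x within {0..}) (\<lambda>x. x * ln x)"
  proof (cases "x = 0")
    case True
    have "((\<lambda>x::real. x * ln x) \<longlongrightarrow> 0) (at_right 0)" by real_asymp
    moreover have "at (0::real) within {0..} = at_right 0"
      unfolding at_within_def by (intro arg_cong2[of _ _ _ _ inf] arg_cong[of _ _ principal]) auto
    ultimately show ?thesis using True by (simp add: continuous_within)
  next
    case False
    then show ?thesis using x by (intro continuous_intros) auto
  qed
qed

lemma continuous_on_ent: "continuous_on prob_simplex ent"
proof -
  have "continuous_on prob_simplex (\<lambda>m :: real^'c::finite. m $ k * ln (m $ k))" for k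
    by (rule continuous_on_compose2[OF continuous_on_mult_ln]) (auto simp: prob_simplex_def intro!: continuous_intros)
  then show ?thesis unfolding ent_def [abs_def] by (intro continuous_on_minus continuous_on_sum)
qed

lemma continuous_on_full_point: "continuous_on S full_point"
proof -
  have eq: "full_point = (\<lambda>x. full_point 0 + full_vec x)"
    using full_point_add[of 0] by (auto simp: fun_eq_iff)
  have "continuous_on S full_vec"
    using linear_full_vec linear_continuous_on linear_conv_bounded_linear by blast
  then show ?thesis by (subst eq) (intro continuous_on_add continuous_on_const)
qed

lemma C2_on_imp_continuous_on: "C2_on S F \<Longrightarrow> continuous_on S F"
  unfolding C2_on_def continuous_on_eq_continuous_within by (blast intro: has_derivative_continuous)

lemma continuous_on_free_energy:
  assumes "C2_on prob_simplex F"
  shows "continuous_on hat_simplex (free_energy F)"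
proof -
  have img: "full_point ` hat_simplex \<subseteq> prob_simplex" using full_point_in_prob_simplex_iff by blast
  show ?thesis unfolding free_energy_def [abs_def]
    using continuous_on_compose2[OF C2_on_imp_continuous_on[OF assms] continuous_on_full_point img]
      continuous_on_compose2[OF continuous_on_ent continuous_on_full_point img]
    by (rule continuous_on_add)
qed

lemma compact_hat_simplex: "compact (hat_simplex :: (real^'n::finite) set)"
proof -
  have "hat_simplex = cbox 0 1 \<inter> {m :: real^'n. (\<Sum>k\<in>UNIV. m $ k) \<le> 1}"
    by (auto simp: hat_simplex_def mem_box_cart)
  moreover have "closed {m :: real^'n. (\<Sum>k\<in>UNIV. m $ k) \<le> 1}"
    by (intro closed_Collect_le continuous_intros)
  ultimately show ?thesis by (metis compact_Int_closed compact_cbox)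
qed

definition hat_point :: "real^('n::finite option) \<Rightarrow> real^'n" where
  "hat_point m = (\<chi> i. m $ Some i)"

lemma hat_point_nth [simp]: "hat_point m $ i = m $ Some i"
  by (simp add: hat_point_def)

lemma hat_full_point [simp]: "hat_point (full_point x) = x"
  by (simp add: vec_eq_iff)

lemma full_hat_point: "m \<in> prob_simplex \<Longrightarrow> full_point (hat_point m) = m"
  unfolding vec_eq_iff
proof
  fix k assume "m \<in> prob_simplex"
  then show "full_point (hat_point m) $ k = m $ k"
    by (cases k) (auto simp: prob_simplex_def sum_option_UNIV)
qed

lemma hat_point_in_hat_simplex: "m \<in> prob_simplex \<Longrightarrow> hat_point m \<in> hat_simplex"
  by (metis full_hat_point full_point_in_prob_simplex_iff)

lemma hat_point_diff: "hat_point (x - y) = hat_point x - hat_point y"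
  by (simp add: vec_eq_iff)

lemma norm_hat_point_le: "norm (hat_point m) \<le> norm m"
proof -
  have "(norm (hat_point m))\<^sup>2 \<le> (norm m)\<^sup>2"
    by (simp only: power2_norm_eq_inner inner_vec_def sum_option_UNIV) simp
  then show ?thesis by (simp add: power2_le_iff_abs_le)
qed

lemma norm_full_vec_le: "norm (full_vec v) \<le> 2 * real CARD('n) * norm v" for v :: "real^'n::finite"
proof -
  have v: "(\<Sum>i\<in>UNIV. \<bar>v $ i\<bar>) \<le> real CARD('n) * norm v"
    using sum_bounded_above[of UNIV "\<lambda>i. \<bar>v $ i\<bar>" "norm v"] by (simp add: component_le_norm_cart)
  have "norm (full_vec v) \<le> (\<Sum>k\<in>UNIV. \<bar>full_vec v $ k\<bar>)" by (rule norm_le_l1_cart)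
  also have "\<dots> \<le> 2 * (\<Sum>i\<in>UNIV. \<bar>v $ i\<bar>)"
    using sum_abs[of "\<lambda>i. v $ i" UNIV] by (simp add: sum_option_UNIV)
  finally show ?thesis using v by simp
qed

lemma full_vec_diff: "full_point x - full_point y = full_vec (x - y)"
  using full_point_add[of y "x - y"] by simp

text \<open>
  The fluctuation covariance of the product measure and its inverse, the Hessian of the relative
  entropy to that measure.
\<close>

lemma ent_hess_inverse:
  fixes m :: "real^'n::finite"
  assumes "\<And>k. full_point m $ k > 0"
  shows "(diag_matrix m - outer_product m m) ** ent_hess m = mat 1"
    and "ent_hess m ** (diag_matrix m - outer_product m m) = mat 1"
proof -
  have pos: "1 - (\<Sum>i\<in>UNIV. m $ i) > 0" "m $ i > 0" for i
    using assms[of None] assms[of "Some i"] by auto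
  show *: "(diag_matrix m - outer_product m m) ** ent_hess m = mat 1"
    unfolding matrix_eq
  proof
    fix v :: "real^'n"
    let ?S = "\<Sum>i\<in>UNIV. v $ i" and ?q = "1 - (\<Sum>i\<in>UNIV. m $ i)"
    have "((diag_matrix m - outer_product m m) *v w) $ i = m $ i * (w $ i - (\<Sum>k\<in>UNIV. m $ k * w $ k))"
      for w :: "real^'n" and i
      by (simp add: matrix_vector_mult_diff_rdistrib)
        (simp add: matrix_vector_mult_def diag_matrix_def outer_product_def sum_distrib_left mult_ac
          right_diff_distrib if_distrib[of "\<lambda>x. _ * x"] cong: if_cong)
    moreover have "(\<Sum>k\<in>UNIV. m $ k * (ent_hess m *v v) $ k) = ?S / ?q"
    proof -
      have "(\<Sum>k\<in>UNIV. m $ k * (ent_hess m *v v) $ k) = (\<Sum>k\<in>UNIV. v $ k + m $ k * (?S / ?q))"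
        using pos(2) by (intro sum.cong) (auto simp: ent_hess_mult distrib_left less_imp_neq[symmetric])
      also have "\<dots> = ?S + (\<Sum>k\<in>UNIV. m $ k) * (?S / ?q)"
        by (simp only: sum.distrib sum_distrib_right)
      also have "\<dots> = ?S / ?q" using pos(1) by (simp add: field_simps)
      finally show ?thesis .
    qed
    ultimately show "((diag_matrix m - outer_product m m) ** ent_hess m) *v v = mat 1 *v v"
      using pos(2) by (simp add: vec_eq_iff matrix_vector_mul_assoc[symmetric] ent_hess_mult less_imp_neq[symmetric])
  qed
  show "ent_hess m ** (diag_matrix m - outer_product m m) = mat 1"
    using * by (simp add: matrix_left_right_inverse)
qed

text \<open>Factoring out \<open>diag_matrix m\<close> leaves a rank-one perturbation of the
  identity, whose determinant \<open>1 - \<Sum> m\<close> is the last colour's probability.\<close>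

lemma det_covariance:
  fixes m :: "real^'n::finite"
  assumes "\<And>k. full_point m $ k > 0"
  shows "det (diag_matrix m - outer_product m m) = (\<Prod>k\<in>UNIV. full_point m $ k)"
proof -
  have "diag_matrix m - outer_product m m = diag_matrix m ** (mat 1 + outer_product (\<chi> i. -1) m)"
    unfolding matrix_add_ldistrib matrix_mul_rid
    by (simp add: vec_eq_iff matrix_matrix_mult_def diag_matrix_def outer_product_def
        if_distrib[of "\<lambda>x. x * _"] sum_negf cong: if_cong)
  moreover have "det (diag_matrix m) = (\<Prod>i\<in>UNIV. m $ i)"
    by (subst det_diagonal) (auto simp: diag_matrix_def)
  moreover have "(\<chi> i. -1) \<bullet> m = - (\<Sum>i\<in>UNIV. m $ i)"
    by (simp add: inner_vec_def sum_negf)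
  ultimately show ?thesis
    by (simp add: det_mul det_mat_plus_outer_product prod_option_UNIV)
qed

text \<open>
  Completing the square: with \<open>A\<close> the inverse of the covariance \<open>V\<close> and \<open>T = S\<^sup>-\<^sup>1 + A\<close>, the
  relation \<open>S = H\<^sup>-\<^sup>1 - V\<close> gives \<open>T S H = A\<close>, so the exponent is maximal at \<open>S H y\<close>.
\<close>

lemma gaussian_tilt:
  fixes H A V S :: "real^'n::finite^'n"
  assumes H: "pos_def_matrix H" and S: "pos_def_matrix S" and SV: "S = matrix_inv H - V"
    and AV: "A ** V = mat 1" and A: "pos_def_matrix A"
  shows "(\<integral>\<^sup>+x. ennreal (multi_normal_density 0 S x * exp (- (x \<bullet> (A *v x)) / 2 + x \<bullet> (A *v y))) \<partial>lborel)
    = ennreal (sqrt (det H * det V) * exp ((y \<bullet> (A *v y) - y \<bullet> (H *v y)) / 2))"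
proof -
  have symA: "transpose A = A" and symH: "transpose H = H" and symS: "transpose S = S"
    using A H S by (auto simp: pos_def_matrix_def)
  have VA: "V ** A = mat 1" using AV by (simp add: matrix_left_right_inverse)
  define R where "R = matrix_inv S"
  note Hinv = matrix_inv_mult[OF pos_def_matrix_invertible[OF H]]
  have RS: "R ** S = mat 1" and SR: "S ** R = mat 1"
    unfolding R_def using matrix_inv_mult[OF pos_def_matrix_invertible[OF S]] by auto
  have symR: "transpose R = R"
    by (metis RS SR matrix_mul_assoc matrix_mul_lid matrix_mul_rid matrix_transpose_mul symS transpose_mat)
  have R: "pos_def_matrix R"
    unfolding pos_def_matrix_def
  proof safe
    fix x :: "real^'n" assume x: "x \<noteq> 0"
    have SRx: "S *v (R *v x) = x" by (simp add: matrix_vector_mul_assoc SR)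
    then have "R *v x \<noteq> 0" using x by auto
    then have "(R *v x) \<bullet> (S *v (R *v x)) > 0" using S by (simp add: pos_def_matrix_def)
    then show "x \<bullet> (R *v x) > 0" by (simp add: SRx inner_commute)
  qed (rule symR)
  define T where "T = R + A"
  have T: "pos_def_matrix T"
    unfolding pos_def_matrix_def T_def using R A
    by (auto simp: pos_def_matrix_def transpose_def vec_eq_iff matrix_vector_mult_add_rdistrib inner_add_right add_pos_pos)
  have SH: "S ** H = mat 1 - V ** H"
  proof -
    have "S ** H + V ** H = (S + V) ** H" by (simp only: matrix_add_rdistrib)
    also have "S + V = matrix_inv H" by (simp add: SV)
    finally show ?thesis by (simp add: Hinv eq_diff_eq)
  qed
  have TSH: "T ** (S ** H) = A"
  proof -
    have "T ** (S ** H) = (R ** S) ** H + A ** (S ** H)"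
      by (simp only: T_def matrix_add_rdistrib matrix_mul_assoc)
    also have "A ** (S ** H) + A ** (V ** H) = A"
      unfolding matrix_add_ldistrib[symmetric] SH by simp
    then have "A ** (S ** H) = A - (A ** V) ** H" by (simp add: eq_diff_eq matrix_mul_assoc)
    finally show ?thesis by (simp add: RS AV)
  qed
  have detpos: "det H > 0" "det S > 0" "det T > 0" "det A > 0"
    using H S T A by (auto intro: det_pos_def_matrix)
  have detV: "det A * det V = 1" using AV by (metis det_I det_mul)
  \<comment> \<open>The determinants of the identity \<open>T ** (S ** H) = A\<close> also give the
    Gaussian prefactor, since \<open>det A\<close> is the inverse of \<open>det V\<close>.\<close>
  have "det T * (det S * det H) = det A" using TSH by (metis det_mul)
  then have dets: "1 / (det T * det S) = det H * det V"
    using detpos detV by (simp add: field_simps) (metis (no_types, opaque_lifting) mult.assoc mult.commute mult.right_neutral)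
  define b where "b = S *v (H *v y)"
  have Tb: "T *v b = A *v y" unfolding b_def using TSH by (simp add: matrix_vector_mul_assoc)
  \<comment> \<open>The vertex is \<open>b\<close>, as \<open>T *v b = A *v y\<close>. The value
    there is half of \<open>b \<bullet> (A *v y)\<close>, and \<open>S ** H = mat 1 - V ** H\<close>
    with \<open>A ** V = mat 1\<close> gives \<open>A *v b = A *v y - H *v y\<close>.\<close>
  have sq: "- (x \<bullet> (R *v x)) / 2 + (- (x \<bullet> (A *v x)) / 2 + x \<bullet> (A *v y))
     = (y \<bullet> (A *v y) - y \<bullet> (H *v y)) / 2 + - ((x - b) \<bullet> (T *v (x - b))) / 2" for x
  proof -
    have bTx: "b \<bullet> (T *v x) = x \<bullet> (A *v y)"
      using T Tb by (metis dot_lmul_matrix inner_commute pos_def_matrix_def vector_transpose_matrix)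
    have "b \<bullet> (A *v y) = y \<bullet> (A *v b)"
      by (metis dot_lmul_matrix inner_commute symA vector_transpose_matrix)
    also have "A *v b = A *v y - H *v y"
    proof -
      have "b = y - V *v (H *v y)"
        unfolding b_def by (simp add: matrix_vector_mul_assoc SH matrix_vector_mult_diff_rdistrib)
      then show ?thesis
        by (simp add: matrix_vector_mult_diff_distrib matrix_vector_mul_assoc AV matrix_mul_assoc)
    qed
    finally have bAy: "b \<bullet> (A *v y) = y \<bullet> (A *v y) - y \<bullet> (H *v y)"
      by (simp add: inner_diff_right)
    have Txx: "x \<bullet> (T *v x) = x \<bullet> (R *v x) + x \<bullet> (A *v x)"
      by (simp add: T_def matrix_vector_mult_add_rdistrib inner_add_right)
    have "(x - b) \<bullet> (T *v (x - b)) = x \<bullet> (T *v x) - b \<bullet> (T *v x) - x \<bullet> (T *v b) + b \<bullet> (T *v b)"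
      by (simp add: matrix_vector_mult_diff_distrib inner_diff_left inner_diff_right)
    then show ?thesis unfolding bTx Tb Txx bAy by (simp add: field_simps)
  qed
  let ?c = "exp ((y \<bullet> (A *v y) - y \<bullet> (H *v y)) / 2)" and ?d = "sqrt ((2 * pi) ^ CARD('n) * det S)"
  have eq: "multi_normal_density 0 S x * exp (- (x \<bullet> (A *v x)) / 2 + x \<bullet> (A *v y))
      = ?c / ?d * exp (- ((x - b) \<bullet> (T *v (x - b))) / 2)" for x
  proof -
    have "multi_normal_density 0 S x * exp (- (x \<bullet> (A *v x)) / 2 + x \<bullet> (A *v y))
      = exp (- (x \<bullet> (R *v x)) / 2 + (- (x \<bullet> (A *v x)) / 2 + x \<bullet> (A *v y))) / ?d"
      unfolding multi_normal_density_def R_def by (simp only: exp_add) simp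
    then show ?thesis unfolding sq exp_add by simp
  qed
  have "(\<integral>\<^sup>+x. ennreal (multi_normal_density 0 S x * exp (- (x \<bullet> (A *v x)) / 2 + x \<bullet> (A *v y))) \<partial>lborel)
    = (\<integral>\<^sup>+x. ennreal (?c / ?d) * ennreal (exp (- ((x - b) \<bullet> (T *v (x - b))) / 2)) \<partial>lborel)"
    unfolding eq using detpos by (intro nn_integral_cong ennreal_mult) auto
  also have "\<dots> = ennreal (?c / ?d) * (\<integral>\<^sup>+x. ennreal (exp (- ((x - b) \<bullet> (T *v (x - b))) / 2)) \<partial>lborel)"
  proof (rule nn_integral_cmult)
    have "(\<lambda>x. (x - b) \<bullet> (T *v (x - b))) \<in> borel_measurable borel"
      by (rule measurable_compose[OF _ borel_measurable_quadratic_form, of "\<lambda>x. x - b"]) simp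
    then show "(\<lambda>x. ennreal (exp (- ((x - b) \<bullet> (T *v (x - b))) / 2))) \<in> borel_measurable lborel"
      by simp
  qed
  also have "(\<integral>\<^sup>+x. ennreal (exp (- ((x - b) \<bullet> (T *v (x - b))) / 2)) \<partial>lborel)
     = (\<integral>\<^sup>+x. ennreal (exp (- (x \<bullet> (T *v x)) / 2)) \<partial>lborel)"
  proof -
    have "(\<integral>\<^sup>+x. ennreal (exp (- (x \<bullet> (T *v x)) / 2)) \<partial>distr lborel borel (\<lambda>x. - b + x))
      = (\<integral>\<^sup>+x. ennreal (exp (- ((- b + x) \<bullet> (T *v (- b + x))) / 2)) \<partial>lborel)"
      by (rule nn_integral_distr) auto
    then show ?thesis by (simp only: lborel_distr_plus) (simp add: add.commute)
  qed
  also have "\<dots> = ennreal (sqrt ((2 * pi) ^ CARD('n) / det T))"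
    by (rule nn_integral_gaussian[OF T])
  also have "ennreal (?c / ?d) * ennreal (sqrt ((2 * pi) ^ CARD('n) / det T))
      = ennreal (?c / ?d * sqrt ((2 * pi) ^ CARD('n) / det T))"
    using detpos by (intro ennreal_mult[symmetric]) auto
  also have "?c / ?d * sqrt ((2 * pi) ^ CARD('n) / det T) = sqrt (1 / (det T * det S)) * ?c"
    using detpos by (simp add: real_sqrt_divide real_sqrt_mult field_simps)
  finally show ?thesis unfolding dets .
qed

lemma pos_def_ent_hess:
  fixes m :: "real^'n::finite"
  assumes "\<And>k. full_point m $ k > 0"
  shows "pos_def_matrix (ent_hess m)"
  unfolding pos_def_matrix_def
proof safe
  show "transpose (ent_hess m) = ent_hess m"
    by (auto simp: transpose_def ent_hess_def vec_eq_iff)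
  fix x :: "real^'n" assume "x \<noteq> 0"
  then obtain i where i: "x $ i \<noteq> 0" by (auto simp: vec_eq_iff)
  have "0 < (full_vec x $ Some i)\<^sup>2 / full_point m $ Some i" using i assms[of "Some i"] by auto
  also have "\<dots> \<le> (\<Sum>k\<in>UNIV. (full_vec x $ k)\<^sup>2 / full_point m $ k)"
    using assms by (intro member_le_sum) (auto simp: less_imp_le simp del: full_vec_simps full_point_simps)
  finally show "x \<bullet> (ent_hess m *v x) > 0" unfolding ent_hess_quadratic_form .
qed

section \<open>Gaussian moments and elementary estimates\<close>

lemma integrable_gaussian_moment:
  fixes c :: real
  assumes c: "c > 0"
  shows "(\<integral>\<^sup>+(x::real^'n::finite). ennreal (exp (- c * (norm x)\<^sup>2) * (1 + norm x ^ 4)) \<partial>lborel) < \<infinity>"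
proof -
  let ?S = "c *\<^sub>R mat 1 :: real^'n^'n"
  have S: "x \<bullet> (?S *v x) = c * (norm x)\<^sup>2" for x :: "real^'n"
    by (simp add: scaleR_matrix_vector_assoc[symmetric] power2_norm_eq_inner)
  have pd: "pos_def_matrix ?S"
    using c by (auto simp: pos_def_matrix_def S) (auto simp: transpose_def mat_def vec_eq_iff)
  have bound: "exp (- c * (norm x)\<^sup>2) * (1 + norm x ^ 4) \<le> (1 + 8 / c\<^sup>2) * exp (- (x \<bullet> (?S *v x)) / 2)" for x :: "real^'n"
  proof -
    let ?t = "c * (norm x)\<^sup>2 / 2"
    have t: "?t \<ge> 0" using c by simp
    \<comment> \<open>Half of the exponent absorbs the polynomial: the fourth power of the norm is
      \<open>8 / c\<^sup>2\<close> times this left side, so what remains is a plain Gaussian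
      integral.\<close>
    have "?t\<^sup>2 / 2 \<le> exp ?t" using exp_lower_Taylor_quadratic[OF t] t by linarith
    then have "8 / c\<^sup>2 * (?t\<^sup>2 / 2) \<le> 8 / c\<^sup>2 * exp ?t" by (intro mult_left_mono) auto
    then have "norm x ^ 4 \<le> 8 / c\<^sup>2 * exp ?t"
      using c by (simp add: power_divide power_mult_distrib field_simps flip: power_mult)
    then have "1 + norm x ^ 4 \<le> exp ?t + 8 / c\<^sup>2 * exp ?t" using t by (intro add_mono) simp_all
    then have "1 + norm x ^ 4 \<le> (1 + 8 / c\<^sup>2) * exp ?t" by (simp add: distrib_right)
    then have "exp (- c * (norm x)\<^sup>2) * (1 + norm x ^ 4) \<le> exp (- c * (norm x)\<^sup>2) * ((1 + 8 / c\<^sup>2) * exp ?t)"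
      by (rule mult_left_mono) simp
    also have "\<dots> = (1 + 8 / c\<^sup>2) * (exp (- c * (norm x)\<^sup>2) * exp ?t)" by simp
    also have "exp (- c * (norm x)\<^sup>2) * exp ?t = exp (- (x \<bullet> (?S *v x)) / 2)"
      unfolding exp_add[symmetric] S by (simp add: field_simps)
    finally show ?thesis .
  qed
  have "(\<integral>\<^sup>+(x::real^'n). ennreal (exp (- c * (norm x)\<^sup>2) * (1 + norm x ^ 4)) \<partial>lborel)
    \<le> (\<integral>\<^sup>+(x::real^'n). ennreal (1 + 8 / c\<^sup>2) * ennreal (exp (- (x \<bullet> (?S *v x)) / 2)) \<partial>lborel)"
  proof (rule nn_integral_mono)
    fix x :: "real^'n"
    have "ennreal (exp (- c * (norm x)\<^sup>2) * (1 + norm x ^ 4)) \<le> ennreal ((1 + 8 / c\<^sup>2) * exp (- (x \<bullet> (?S *v x)) / 2))"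
      by (intro ennreal_leI bound)
    also have "\<dots> = ennreal (1 + 8 / c\<^sup>2) * ennreal (exp (- (x \<bullet> (?S *v x)) / 2))"
      by (rule ennreal_mult) auto
    finally show "ennreal (exp (- c * (norm x)\<^sup>2) * (1 + norm x ^ 4))
      \<le> ennreal (1 + 8 / c\<^sup>2) * ennreal (exp (- (x \<bullet> (?S *v x)) / 2))" .
  qed
  also have "\<dots> = ennreal (1 + 8 / c\<^sup>2) * (\<integral>\<^sup>+(x::real^'n). ennreal (exp (- (x \<bullet> (?S *v x)) / 2)) \<partial>lborel)"
    by (rule nn_integral_cmult) auto
  also have "\<dots> < \<infinity>" unfolding nn_integral_gaussian[OF pd] by (simp add: ennreal_mult_less_top)
  finally show ?thesis .
qed

lemma multi_normal_density_le:
  fixes S :: "real^'n::finite^'n"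
  assumes S: "pos_def_matrix S"
  shows "\<exists>c>0. \<exists>D>0. \<forall>x. multi_normal_density 0 S x \<le> D * exp (- c * (norm x)\<^sup>2)"
proof -
  note inv = matrix_inv_mult[OF pos_def_matrix_invertible[OF S]]
  have pos: "x \<bullet> (matrix_inv S *v x) > 0" if "x \<noteq> 0" for x
  proof -
    have Sx: "S *v (matrix_inv S *v x) = x" by (simp add: matrix_vector_mul_assoc inv)
    then have "matrix_inv S *v x \<noteq> 0" using that by auto
    then have "(matrix_inv S *v x) \<bullet> (S *v (matrix_inv S *v x)) > 0" using S by (simp add: pos_def_matrix_def)
    then show ?thesis by (simp add: Sx inner_commute)
  qed
  have "transpose (matrix_inv S) = matrix_inv S"
    using S inv by (metis matrix_inv_eqI matrix_transpose_mul pos_def_matrix_def transpose_mat)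
  then have "pos_def_matrix (matrix_inv S)" using pos by (simp add: pos_def_matrix_def)
  from pos_def_matrix_bound[OF this]
  obtain c where c: "c > 0" "\<And>x. x \<bullet> (matrix_inv S *v x) \<ge> c * (norm x)\<^sup>2" by metis
  let ?D = "1 / sqrt ((2 * pi) ^ CARD('n) * det S)"
  have "multi_normal_density 0 S x \<le> ?D * exp (- (c / 2) * (norm x)\<^sup>2)" for x
    unfolding multi_normal_density_def using c(2)[of x] det_pos_def_matrix[OF S]
    by (simp add: divide_right_mono)
  moreover have "c / 2 > 0" "?D > 0" using c det_pos_def_matrix[OF S] by simp_all
  ultimately show ?thesis by blast
qed

lemma multi_normal_density_nonneg: "pos_def_matrix S \<Longrightarrow> multi_normal_density 0 S x \<ge> 0"
  using det_pos_def_matrix[of S] by (simp add: multi_normal_density_def less_imp_le)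

lemma norm_add_power4_le: "norm (a + b) ^ 4 \<le> 8 * (norm a ^ 4 + norm b ^ 4)"
  for a b :: "'b::real_normed_vector"
proof -
  have sq: "(x + y)\<^sup>2 \<le> 2 * (x\<^sup>2 + y\<^sup>2)" for x y :: real
    using sum_squares_bound[of x y] by (simp add: power2_sum)
  have "norm (a + b) ^ 4 \<le> (norm a + norm b) ^ 4" by (intro power_mono norm_triangle_ineq) auto
  also have "\<dots> = ((norm a + norm b)\<^sup>2)\<^sup>2" by simp
  also have "\<dots> \<le> (2 * ((norm a)\<^sup>2 + (norm b)\<^sup>2))\<^sup>2" by (intro power_mono sq) auto
  also have "\<dots> = 4 * ((norm a)\<^sup>2 + (norm b)\<^sup>2)\<^sup>2" by (simp add: power2_eq_square algebra_simps)
  also have "\<dots> \<le> 4 * (2 * (((norm a)\<^sup>2)\<^sup>2 + ((norm b)\<^sup>2)\<^sup>2))" by (intro mult_left_mono sq) auto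
  finally show ?thesis by simp
qed

lemma abs_exp_diff_le:
  fixes a b :: real
  assumes "a \<le> C" "b \<le> C"
  shows "\<bar>exp a - exp b\<bar> \<le> exp C * \<bar>a - b\<bar>"
proof -
  have *: "exp u - exp v \<le> exp C * (u - v)" if "v \<le> u" "u \<le> C" for u v :: real
  proof -
    have "1 - exp (v - u) \<le> u - v" using exp_ge_add_one_self[of "v - u"] by linarith
    then have "exp u * (1 - exp (v - u)) \<le> exp u * (u - v)" by (intro mult_left_mono) auto
    also have "\<dots> \<le> exp C * (u - v)" using that by (intro mult_right_mono) auto
    finally show ?thesis by (simp add: right_diff_distrib flip: exp_add)
  qed
  show ?thesis using *[of a b] *[of b a] assms by (cases "a \<le> b") auto
qed

lemma ln_one_plus_expansion:
  fixes \<tau> :: real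
  shows "(\<lambda>N. sqrt (real N) * ln (1 + \<tau> / sqrt (real N))) \<longlonglongrightarrow> \<tau>"
    and "(\<lambda>N. real N * ln (1 + \<tau> / sqrt (real N)) - sqrt (real N) * \<tau>) \<longlonglongrightarrow> - \<tau>\<^sup>2 / 2"
proof -
  consider "\<tau> = 0" | "\<tau> > 0" | "\<tau> < 0" by linarith
  then show "(\<lambda>N. sqrt (real N) * ln (1 + \<tau> / sqrt (real N))) \<longlonglongrightarrow> \<tau>"
  proof cases
    case 1 then show ?thesis by simp
  next
    case 2 then show ?thesis by real_asymp
  next
    case 3 then show ?thesis by real_asymp
  qed
  consider "\<tau> = 0" | "\<tau> > 0" | "\<tau> < 0" by linarith
  then show "(\<lambda>N. real N * ln (1 + \<tau> / sqrt (real N)) - sqrt (real N) * \<tau>) \<longlonglongrightarrow> - \<tau>\<^sup>2 / 2"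
  proof cases
    case 1 then show ?thesis by simp
  next
    case 2 then show ?thesis by (real_asymp simp: power2_eq_square)
  next
    case 3 then show ?thesis by (real_asymp simp: power2_eq_square)
  qed
qed

lemma tendsto_bounded_mult_zero:
  fixes f g :: "nat \<Rightarrow> real"
  assumes "f \<longlonglongrightarrow> 0" "\<And>n. \<bar>g n\<bar> \<le> C"
  shows "(\<lambda>n. g n * f n) \<longlonglongrightarrow> 0"
proof (rule Lim_null_comparison)
  show "\<forall>\<^sub>F n in sequentially. norm (g n * f n) \<le> C * \<bar>f n\<bar>"
    using assms(2) by (auto simp: abs_mult intro!: always_eventually mult_right_mono)
  show "(\<lambda>n. C * \<bar>f n\<bar>) \<longlonglongrightarrow> 0" using tendsto_mult_right_zero[OF tendsto_rabs_zero[OF assms(1)], of C] .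
qed

text \<open>
  Local expansion of the log-likelihood ratio of a product measure under a shift of order
  \<open>1 / sqrt N\<close>, along a bounded sequence \<open>y\<close> of rescaled magnetizations.
\<close>

lemma log_likelihood_expansion:
  fixes m v :: "real^'n::finite" and y :: "nat \<Rightarrow> real^'n"
  assumes m: "\<And>k. full_point m $ k > 0" and y: "\<And>N. norm (y N) \<le> C"
  shows "(\<lambda>N. real N * (\<Sum>k\<in>UNIV. full_point (m + y N /\<^sub>R sqrt (real N)) $ k *
        (ln (full_point (m + v /\<^sub>R sqrt (real N)) $ k) - ln (full_point m $ k)))
      - (- (v \<bullet> (ent_hess m *v v)) / 2 + v \<bullet> (ent_hess m *v y N))) \<longlonglongrightarrow> 0"
proof -
  let ?c = full_point and ?u = "full_vec v"
  define \<tau> where "\<tau> k = ?u $ k / ?c m $ k" for k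
  define L where "L N k = ln (1 + \<tau> k / sqrt (real N))" for N :: nat and k
  define Y where "Y N = full_vec (y N)" for N
  have Yb: "\<bar>Y N $ k\<bar> \<le> 2 * real CARD('n) * C" for N k
  proof -
    have "\<bar>Y N $ k\<bar> \<le> norm (Y N)" by (rule component_le_norm_cart)
    also have "\<dots> \<le> 2 * real CARD('n) * norm (y N)" unfolding Y_def by (rule norm_full_vec_le)
    also have "\<dots> \<le> 2 * real CARD('n) * C" using y by (intro mult_left_mono) auto
    finally show ?thesis .
  qed
  \<comment> \<open>The two remainders of the logarithm, one with a fixed factor and one with a
    bounded factor. Summed over \<open>k\<close> they give the claimed difference: the divergent
    terms \<open>sqrt N * \<tau> k\<close> carry the factors \<open>full_point m $ k\<close>, and
    these products are the coordinates of \<open>full_vec v\<close>, which sum to 0.\<close>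
  define R where "R N k = ?c m $ k * (real N * L N k - sqrt (real N) * \<tau> k + (\<tau> k)\<^sup>2 / 2)
      + Y N $ k * (sqrt (real N) * L N k - \<tau> k)" for N k
  have "(\<lambda>N. \<Sum>k\<in>UNIV. R N k) \<longlonglongrightarrow> (\<Sum>k\<in>(UNIV :: 'n option set). 0)"
  proof (rule tendsto_sum)
    fix k
    have "(\<lambda>N. sqrt (real N) * L N k - \<tau> k) \<longlonglongrightarrow> 0"
      using tendsto_diff[OF ln_one_plus_expansion(1)[of "\<tau> k"] tendsto_const, of "\<tau> k"] by (simp add: L_def)
    from tendsto_bounded_mult_zero[OF this Yb]
    have 1: "(\<lambda>N. Y N $ k * (sqrt (real N) * L N k - \<tau> k)) \<longlonglongrightarrow> 0" .
    have "(\<lambda>N. real N * L N k - sqrt (real N) * \<tau> k + (\<tau> k)\<^sup>2 / 2) \<longlonglongrightarrow> 0"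
      using tendsto_add[OF ln_one_plus_expansion(2)[of "\<tau> k"] tendsto_const, of "(\<tau> k)\<^sup>2 / 2"] by (simp add: L_def)
    from tendsto_mult_right_zero[OF this, of "?c m $ k"] 1
    show "(\<lambda>N. R N k) \<longlonglongrightarrow> 0" unfolding R_def using tendsto_add by fastforce
  qed
  then have "(\<lambda>N. \<Sum>k\<in>UNIV. R N k) \<longlonglongrightarrow> 0" by simp
  moreover have "\<forall>\<^sub>F N in sequentially. (\<Sum>k\<in>UNIV. R N k) = real N * (\<Sum>k\<in>UNIV. ?c (m + y N /\<^sub>R sqrt (real N)) $ k *
        (ln (?c (m + v /\<^sub>R sqrt (real N)) $ k) - ln (?c m $ k)))
      - (- (v \<bullet> (ent_hess m *v v)) / 2 + v \<bullet> (ent_hess m *v y N))"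
  proof -
    have "\<forall>\<^sub>F N in sequentially. \<forall>k. 1 + \<tau> k / sqrt (real N) > 0"
    proof (rule eventually_all_finite)
      fix k
      have "(\<lambda>N. 1 + \<tau> k / sqrt (real N)) \<longlonglongrightarrow> 1" by real_asymp
      then show "\<forall>\<^sub>F N in sequentially. 1 + \<tau> k / sqrt (real N) > 0" by (rule order_tendstoD) simp
    qed
    then show ?thesis using eventually_gt_at_top[of 0]
    proof eventually_elim
      case (elim N)
      have sq: "real N = sqrt (real N) * sqrt (real N)" by simp
      have ln: "ln (?c (m + v /\<^sub>R sqrt (real N)) $ k) - ln (?c m $ k) = L N k" for k
      proof -
        have "?c (m + v /\<^sub>R sqrt (real N)) $ k = ?c m $ k * (1 + \<tau> k / sqrt (real N))"
          using m[of k] unfolding full_point_add linear_scale[OF linear_full_vec]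
          by (simp add: \<tau>_def field_simps del: full_point_simps full_vec_simps)
        then show ?thesis using m[of k] elim(1)[rule_format, of k] by (simp add: L_def ln_mult del: full_point_simps)
      qed
      have my: "real N * ?c (m + y N /\<^sub>R sqrt (real N)) $ k = real N * ?c m $ k + sqrt (real N) * Y N $ k" for k
        using elim(2) unfolding full_point_add linear_scale[OF linear_full_vec] Y_def
        by (simp add: field_simps del: full_point_simps full_vec_simps)
      have m\<tau>: "?c m $ k * \<tau> k = ?u $ k" for k
        using m[of k] by (simp add: \<tau>_def del: full_point_simps full_vec_simps)
      have "R N k = real N * ?c (m + y N /\<^sub>R sqrt (real N)) $ k * L N k - sqrt (real N) * ?u $ k
         + (?u $ k)\<^sup>2 / ?c m $ k / 2 - ?u $ k * Y N $ k / ?c m $ k" for k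
      proof -
        have "?c m $ k * (\<tau> k)\<^sup>2 = (?u $ k)\<^sup>2 / ?c m $ k" "Y N $ k * \<tau> k = ?u $ k * Y N $ k / ?c m $ k"
          using m[of k] by (simp_all add: \<tau>_def power2_eq_square field_simps del: full_point_simps full_vec_simps)
        moreover have "R N k = (real N * ?c m $ k + sqrt (real N) * Y N $ k) * L N k - sqrt (real N) * (?c m $ k * \<tau> k)
          + ?c m $ k * (\<tau> k)\<^sup>2 / 2 - Y N $ k * \<tau> k"
          unfolding R_def by (simp add: algebra_simps del: full_point_simps full_vec_simps)
        ultimately show ?thesis unfolding my m\<tau> by simp
      qed
      then have "(\<Sum>k\<in>UNIV. R N k) = (\<Sum>k\<in>UNIV. real N * ?c (m + y N /\<^sub>R sqrt (real N)) $ k * L N k)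
          - sqrt (real N) * (\<Sum>k\<in>UNIV. ?u $ k) + (\<Sum>k\<in>UNIV. (?u $ k)\<^sup>2 / ?c m $ k) / 2
          - (\<Sum>k\<in>UNIV. ?u $ k * Y N $ k / ?c m $ k)"
        by (simp only: sum.distrib sum_subtractf sum_distrib_left sum_divide_distrib)
      then show ?case
        unfolding ln sum_full_vec ent_hess_quadratic_form ent_hess_bilinear_form[of v m "y N"] Y_def
        by (simp only: sum_distrib_left mult.assoc mult_zero_right)
    qed
  qed
  ultimately show ?thesis by (rule Lim_transform_eventually)
qed

lemma quadratic_form_bound: "\<bar>z \<bullet> (A *v z)\<bar> \<le> (\<Sum>i\<in>UNIV. \<Sum>k\<in>UNIV. \<bar>A $ i $ k\<bar>) * (norm z)\<^sup>2" for A :: "real^'n::finite^'n"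
proof -
  have "z \<bullet> (A *v z) = (\<Sum>i\<in>UNIV. \<Sum>k\<in>UNIV. z $ i * (A $ i $ k * z $ k))"
    by (simp add: inner_vec_def matrix_vector_mult_def sum_distrib_left)
  also have "\<bar>\<dots>\<bar> \<le> (\<Sum>i\<in>UNIV. \<Sum>k\<in>UNIV. \<bar>A $ i $ k\<bar> * (norm z)\<^sup>2)"
  proof (rule order_trans[OF sum_abs sum_mono], rule order_trans[OF sum_abs sum_mono])
    fix i k
    have "\<bar>z $ i\<bar> * \<bar>z $ k\<bar> \<le> norm z * norm z" by (intro mult_mono component_le_norm_cart) auto
    then have "\<bar>A $ i $ k\<bar> * (\<bar>z $ i\<bar> * \<bar>z $ k\<bar>) \<le> \<bar>A $ i $ k\<bar> * (norm z)\<^sup>2"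
      by (intro mult_left_mono) (auto simp: power2_eq_square)
    then show "\<bar>z $ i * (A $ i $ k * z $ k)\<bar> \<le> \<bar>A $ i $ k\<bar> * (norm z)\<^sup>2" by (simp add: abs_mult mult_ac)
  qed
  finally show ?thesis by (simp add: sum_distrib_right)
qed

section \<open>The free energy near and away from its maximizers\<close>

locale gibbs_mixture =
  fixes F :: "real^('n::finite option) \<Rightarrow> real"
    and p :: nat
    and M :: "nat \<Rightarrow> real^'n"
    and P :: "'w measure"
    and \<xi> :: "nat \<Rightarrow> 'w \<Rightarrow> real^'n"
    and \<delta> :: real
  assumes F_C2: "C2_on prob_simplex F"
    and A_enum: "bij_betw M {1..p} (global_maximizers (free_energy F) hat_simplex)"
    and A_interior: "\<forall>j\<in>{1..p}. M j \<in> interior hat_simplex"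
    and B: "\<forall>j\<in>{1..p}. pos_def_matrix (H_matrix F (M j))"
    and Sigma_pos_def: "\<forall>j\<in>{1..p}. pos_def_matrix (Sigma_matrix F (M j))"
    and prob: "prob_space P"
    and xi_normal: "\<forall>j\<in>{1..p}. distributed P lborel (\<xi> j)
          (\<lambda>x. ennreal (multi_normal_density 0 (Sigma_matrix F (M j)) x))"
    and delta: "0 < \<delta>" "\<delta> < 1 / 2"
begin

definition Gmax :: real where "Gmax = free_energy F (M 1)"

text \<open>A continuous function on a compact set has a maximizer, so the index 1 in
  \<open>Gmax\<close> is legitimate.\<close>

lemma p_pos: "p \<ge> 1"
proof -
  have "(0 :: real^'n) \<in> hat_simplex" by (simp add: hat_simplex_def)
  then have "hat_simplex \<noteq> ({} :: (real^'n) set)" by blast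
  from continuous_attains_sup[OF compact_hat_simplex this continuous_on_free_energy[OF F_C2]]
  obtain x where "x \<in> global_maximizers (free_energy F) hat_simplex"
    unfolding global_maximizers_def by blast
  then have "{1..p} \<noteq> {}" using A_enum by (auto simp: bij_betw_def)
  then show ?thesis by simp
qed

lemma M_maximizer:
  assumes "j \<in> {1..p}"
  shows "M j \<in> hat_simplex" "free_energy F (M j) = Gmax" "x \<in> hat_simplex \<Longrightarrow> free_energy F x \<le> Gmax"
proof -
  have mx: "M i \<in> hat_simplex" "\<And>y. y \<in> hat_simplex \<Longrightarrow> free_energy F y \<le> free_energy F (M i)"
    if "i \<in> {1..p}" for i
    using that A_enum unfolding bij_betw_def global_maximizers_def by blast+
  have 1: "1 \<in> {1..p}" using p_pos by simp
  show "M j \<in> hat_simplex" using mx(1)[OF assms] .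
  show "free_energy F (M j) = Gmax"
    unfolding Gmax_def using mx[OF assms] mx[OF 1] by (intro antisym) auto
  show "x \<in> hat_simplex \<Longrightarrow> free_energy F x \<le> Gmax" unfolding Gmax_def by (rule mx(2)[OF 1])
qed

lemma maximizer_in_range:
  assumes "x \<in> hat_simplex" "free_energy F x = Gmax"
  shows "\<exists>j\<in>{1..p}. x = M j"
proof -
  have "1 \<in> {1..p}" using p_pos by simp
  then have "x \<in> global_maximizers (free_energy F) hat_simplex"
    using assms M_maximizer(3) unfolding global_maximizers_def by auto
  then show ?thesis using A_enum by (auto simp: bij_betw_def)
qed

lemma full_point_M_pos: "j \<in> {1..p} \<Longrightarrow> full_point (M j) $ k > 0"
  using A_interior interior_hat_simplexD by blast

text \<open>\<open>exp (N * phi j)\<close> is the Gibbs density relative to the likelihood of the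
  product measure at \<open>M j\<close>. Subtracting this log-likelihood removes exactly the linear
  part of \<open>F\<close> at \<open>M j\<close>.\<close>

definition phi :: "nat \<Rightarrow> real^'n \<Rightarrow> real" where
  "phi j x = F (full_point x) - Gmax - (\<Sum>k\<in>UNIV. full_point x $ k * ln (full_point (M j) $ k))"

text \<open>Criticality of \<open>M j\<close> for the free energy identifies the gradient of
  \<open>F\<close> with that of the log-likelihood at \<open>M j\<close>, so \<open>phi j\<close> is
  \<open>F\<close> minus its linear Taylor polynomial. As \<open>H\<close> is the entropy Hessian
  form \<open>A\<close> minus the Hessian of \<open>F\<close>, the quadratic part of
  \<open>phi j\<close> is governed by \<open>A - H\<close>.\<close>

lemma local_expansion:
  assumes j: "j \<in> {1..p}" and e: "e > 0"
  obtains r where "r > 0" "ball (M j) r \<subseteq> hat_simplex"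
    "\<And>z. norm z < r \<Longrightarrow>
       \<bar>phi j (M j + z) - (z \<bullet> (ent_hess (M j) *v z) - z \<bullet> (H_matrix F (M j) *v z)) / 2\<bar> \<le> e * (norm z)\<^sup>2"
    "\<And>z. norm z < r \<Longrightarrow>
       \<bar>free_energy F (M j + z) - Gmax + z \<bullet> (H_matrix F (M j) *v z) / 2\<bar> \<le> e * (norm z)\<^sup>2"
proof -
  let ?I = "interior hat_simplex :: (real^'n) set" and ?A = "ent_hess (M j)" and ?H = "H_matrix F (M j)"
  have MI: "M j \<in> ?I" using A_interior j by blast
  obtain g B where g: "\<And>y. y \<in> ?I \<Longrightarrow> ((\<lambda>x. F (full_point x)) has_derivative (\<lambda>v. g y \<bullet> v)) (at y)"
    and B: "\<And>y. y \<in> ?I \<Longrightarrow> (g has_derivative (\<lambda>v. B y *v v)) (at y)"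
    using C2_on_full_point[OF F_C2] by metis
  let ?e = "\<lambda>y :: real^'n. \<chi> k. ln (full_point y $ None) - ln (y $ k)"
  have fe: "(free_energy F has_derivative (\<lambda>v. (g y + ?e y) \<bullet> v)) (at y)" if "y \<in> ?I" for y
    unfolding free_energy_def [abs_def]
    using has_derivative_add[OF g[OF that] has_derivative_ent_full_point(1)[OF that]]
    by (simp only: inner_add_left)
  have fe': "((\<lambda>y. g y + ?e y) has_derivative (\<lambda>v. (B (M j) + - ?A) *v v)) (at (M j))"
    using has_derivative_add[OF B[OF MI] has_derivative_ent_full_point(2)[OF MI]]
    by (simp only: matrix_vector_mult_add_rdistrib)
  have hess: "?H = - transpose (B (M j) + - ?A)"
    unfolding H_matrix_def by (simp add: hessian_eq[OF open_interior MI fe fe'])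
  have neg: "(- X) *v z = - (X *v z)" for X :: "real^'n^'n" and z
    by (simp add: matrix_vector_mult_def vec_eq_iff sum_negf)
  have zH: "z \<bullet> (?H *v z) = z \<bullet> (?A *v z) - z \<bullet> (B (M j) *v z)" for z
  proof -
    have "z \<bullet> (transpose X *v z) = z \<bullet> (X *v z)" for X :: "real^'n^'n"
      by (metis dot_lmul_matrix inner_commute vector_transpose_matrix transpose_transpose)
    then have "z \<bullet> (?H *v z) = - (z \<bullet> ((B (M j) + - ?A) *v z))" unfolding hess neg by simp
    then show ?thesis by (simp add: matrix_vector_mult_diff_rdistrib inner_diff_right)
  qed
  have "(\<lambda>v. (g (M j) + ?e (M j)) \<bullet> v) = (\<lambda>v. 0)"
  proof (rule differential_zero_maxmin[OF MI open_interior fe[OF MI]])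
    show "(\<forall>y\<in>?I. free_energy F y \<le> free_energy F (M j)) \<or> (\<forall>y\<in>?I. free_energy F (M j) \<le> free_energy F y)"
      using M_maximizer[OF j] interior_subset by (metis (no_types) subset_iff)
  qed
  then have crit: "g (M j) + ?e (M j) = 0" by (metis inner_eq_zero_iff)
  then have gk: "g (M j) $ k = ln (M j $ k) - ln (full_point (M j) $ None)" for k
    by (simp add: vec_eq_iff algebra_simps eq_neg_iff_add_eq_0 add_eq_0_iff)
  have gz: "g (M j) \<bullet> z = (\<Sum>k\<in>UNIV. full_vec z $ k * ln (full_point (M j) $ k))" for z
    by (simp add: inner_vec_def gk sum_option_UNIV left_diff_distrib right_diff_distrib sum_subtractf sum_distrib_left sum_distrib_right mult_ac
      del: full_point_simps(1))
  obtain r1 where r1: "r1 > 0" "ball (M j) r1 \<subseteq> ?I" "\<And>z. norm z < r1 \<Longrightarrow>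
      \<bar>F (full_point (M j + z)) - F (full_point (M j)) - g (M j) \<bullet> z - (z \<bullet> (B (M j) *v z)) / 2\<bar> \<le> e * (norm z)\<^sup>2"
    using taylor_second_order[OF open_interior MI g B[OF MI] e] by blast
  obtain r2 where r2: "r2 > 0" "ball (M j) r2 \<subseteq> ?I" "\<And>z. norm z < r2 \<Longrightarrow>
      \<bar>free_energy F (M j + z) - free_energy F (M j) - (g (M j) + ?e (M j)) \<bullet> z
         - (z \<bullet> ((B (M j) + - ?A) *v z)) / 2\<bar> \<le> e * (norm z)\<^sup>2"
    using taylor_second_order[OF open_interior MI fe fe' e] by blast
  show thesis
  proof
    show "min r1 r2 > 0" using r1 r2 by simp
    show "ball (M j) (min r1 r2) \<subseteq> hat_simplex" using r1(2) interior_subset by fastforce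
    fix z :: "real^'n" assume z: "norm z < min r1 r2"
    have FM: "F (full_point (M j)) = Gmax + (\<Sum>k\<in>UNIV. full_point (M j) $ k * ln (full_point (M j) $ k))"
      using M_maximizer(2)[OF j] by (simp add: free_energy_def ent_def)
    have "phi j (M j + z) = F (full_point (M j + z)) - F (full_point (M j)) - g (M j) \<bullet> z"
      unfolding phi_def gz FM full_point_add by (simp add: distrib_right sum.distrib)
    then show "\<bar>phi j (M j + z) - (z \<bullet> (?A *v z) - z \<bullet> (?H *v z)) / 2\<bar> \<le> e * (norm z)\<^sup>2"
      using r1(3)[of z] z by (simp add: zH)
    have "z \<bullet> ((B (M j) + - ?A) *v z) = - (z \<bullet> (?H *v z))"
      unfolding zH by (simp add: matrix_vector_mult_diff_rdistrib inner_diff_right)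
    then show "\<bar>free_energy F (M j + z) - Gmax + z \<bullet> (?H *v z) / 2\<bar> \<le> e * (norm z)\<^sup>2"
      using r2(3)[of z] z unfolding crit M_maximizer(2)[OF j] by simp
  qed
qed

definition amin :: real where
  "amin = Min ((\<lambda>(j, k). full_point (M j) $ k) ` ({1..p} \<times> UNIV))"

lemma amin_pos: "amin > 0"
  and amin_le: "j \<in> {1..p} \<Longrightarrow> amin \<le> full_point (M j) $ k"
proof -
  let ?S = "(\<lambda>(j, k). full_point (M j) $ k) ` ({1..p} \<times> UNIV)"
  have S: "finite ?S" "?S \<noteq> {}" using p_pos by auto
  then show "amin > 0" unfolding amin_def using full_point_M_pos by auto
  show "j \<in> {1..p} \<Longrightarrow> amin \<le> full_point (M j) $ k"
    unfolding amin_def using S by (intro Min_le) auto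
qed

lemma free_energy_near:
  obtains c r where "c > 0" "r > 0"
    "\<And>j x. j \<in> {1..p} \<Longrightarrow> norm (x - M j) < r \<Longrightarrow> x \<in> hat_simplex \<and> free_energy F x \<le> Gmax - c * (norm (x - M j))\<^sup>2"
proof -
  have "\<exists>c r. c > 0 \<and> r > 0 \<and> (\<forall>x. norm (x - M j) < r \<longrightarrow>
      x \<in> hat_simplex \<and> free_energy F x \<le> Gmax - c * (norm (x - M j))\<^sup>2)" if j: "j \<in> {1..p}" for j
  proof -
    obtain c where c: "c > 0" "\<And>x. x \<bullet> (H_matrix F (M j) *v x) \<ge> c * (norm x)\<^sup>2"
      using pos_def_matrix_bound B j by blast
    \<comment> \<open>Positive definiteness supplies \<open>c / 2\<close>; the Taylor error may use
      up half of it.\<close>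
    have "c / 4 > 0" using c by simp
    from local_expansion[OF j this] obtain r where r: "r > 0" "ball (M j) r \<subseteq> hat_simplex"
      "\<And>z. norm z < r \<Longrightarrow> \<bar>free_energy F (M j + z) - Gmax + z \<bullet> (H_matrix F (M j) *v z) / 2\<bar> \<le> c / 4 * (norm z)\<^sup>2"
      by metis
    have "x \<in> hat_simplex \<and> free_energy F x \<le> Gmax - c / 4 * (norm (x - M j))\<^sup>2" if x: "norm (x - M j) < r" for x
    proof
      show "x \<in> hat_simplex" using x r(2) by (auto simp: dist_norm norm_minus_commute subset_iff)
      have "\<bar>free_energy F x - Gmax + (x - M j) \<bullet> (H_matrix F (M j) *v (x - M j)) / 2\<bar> \<le> c / 4 * (norm (x - M j))\<^sup>2"
        using r(3)[OF x] by simp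
      then show "free_energy F x \<le> Gmax - c / 4 * (norm (x - M j))\<^sup>2"
        using c(2)[of "x - M j"] unfolding abs_le_iff by linarith
    qed
    then show ?thesis using c(1) r(1) by (intro exI[of _ "c / 4"] exI[of _ r]) auto
  qed
  then obtain c r where cr: "\<And>j. j \<in> {1..p} \<Longrightarrow> c j > 0 \<and> r j > 0 \<and> (\<forall>x. norm (x - M j) < r j \<longrightarrow>
      x \<in> hat_simplex \<and> free_energy F x \<le> Gmax - c j * (norm (x - M j))\<^sup>2)"
    by metis
  have fin: "finite {1..p}" "{1..p} \<noteq> {}" using p_pos by auto
  show thesis
  proof
    show "Min (c ` {1..p}) > 0" "Min (r ` {1..p}) > 0" using cr fin by auto
    fix j and x assume j: "j \<in> {1..p}" and x: "norm (x - M j) < Min (r ` {1..p})"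
    have "norm (x - M j) < r j" using x j by (auto intro: order_less_le_trans)
    then have 1: "x \<in> hat_simplex" "free_energy F x \<le> Gmax - c j * (norm (x - M j))\<^sup>2" using cr[OF j] by auto
    have "Min (c ` {1..p}) * (norm (x - M j))\<^sup>2 \<le> c j * (norm (x - M j))\<^sup>2"
      using j by (intro mult_right_mono) auto
    then show "x \<in> hat_simplex \<and> free_energy F x \<le> Gmax - Min (c ` {1..p}) * (norm (x - M j))\<^sup>2"
      using 1 by auto
  qed
qed

text \<open>Outside the balls the supremum is attained on a compact set, at a point that is no
  maximizer because \<open>M\<close> enumerates all of them. The gap is therefore strict.\<close>

lemma free_energy_far:
  assumes r: "r > 0"
  obtains c where "c > 0"
    "\<And>x. x \<in> hat_simplex \<Longrightarrow> (\<forall>j\<in>{1..p}. norm (x - M j) \<ge> r) \<Longrightarrow> free_energy F x \<le> Gmax - c"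
proof -
  define S where "S = hat_simplex - (\<Union>j\<in>{1..p}. ball (M j) r)"
  have S: "compact S" unfolding S_def by (intro compact_diff compact_hat_simplex) auto
  have SI: "x \<in> S" if "x \<in> hat_simplex" "\<forall>j\<in>{1..p}. norm (x - M j) \<ge> r" for x
    using that by (fastforce simp: S_def dist_norm norm_minus_commute not_less)
  show thesis
  proof (cases "S = {}")
    case True
    then show thesis using SI by (intro that[of 1]) auto
  next
    case False
    have "continuous_on S (free_energy F)"
      using continuous_on_free_energy[OF F_C2] by (rule continuous_on_subset) (auto simp: S_def)
    from continuous_attains_sup[OF S False this]
    obtain y where y: "y \<in> S" "\<And>x. x \<in> S \<Longrightarrow> free_energy F x \<le> free_energy F y" by blast
    have "1 \<in> {1..p}" using p_pos by simp
    then have "free_energy F y \<le> Gmax" using y(1) M_maximizer(3) by (auto simp: S_def)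
    moreover have "free_energy F y \<noteq> Gmax"
    proof
      assume "free_energy F y = Gmax"
      then obtain j where "j \<in> {1..p}" "y = M j" using maximizer_in_range y(1) unfolding S_def by blast
      moreover have "M j \<in> ball (M j) r" using r by simp
      ultimately show False using y(1) unfolding S_def by blast
    qed
    ultimately show thesis using y(2) SI by (intro that[of "Gmax - free_energy F y"]) auto
  qed
qed

text \<open>Close to \<open>M j\<close> by the second-order expansion, and elsewhere because a
  bounded function is at most a constant times the squared distance. This is the source of linear
  growth in \<open>d\<close> on the Gibbs side.\<close>

lemma phi_bound:
  obtains C where "C \<ge> 0" "\<And>j x. j \<in> {1..p} \<Longrightarrow> x \<in> hat_simplex \<Longrightarrow> \<bar>phi j x\<bar> \<le> C * (norm (x - M j))\<^sup>2"
proof -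
  have "\<exists>C\<ge>0. \<forall>x\<in>hat_simplex. \<bar>phi j x\<bar> \<le> C * (norm (x - M j))\<^sup>2" if j: "j \<in> {1..p}" for j
  proof -
    obtain r where r: "r > 0" "\<And>z. norm z < r \<Longrightarrow>
       \<bar>phi j (M j + z) - (z \<bullet> (ent_hess (M j) *v z) - z \<bullet> (H_matrix F (M j) *v z)) / 2\<bar> \<le> 1 * (norm z)\<^sup>2"
      using local_expansion[OF j zero_less_one] by metis
    obtain K where K: "\<And>z. \<bar>z \<bullet> ((ent_hess (M j) - H_matrix F (M j)) *v z)\<bar> \<le> K * (norm z)\<^sup>2" "K > 0"
    proof -
      obtain K where K: "K > 0" "\<And>z. norm ((ent_hess (M j) - H_matrix F (M j)) *v z) \<le> K * norm z"
        using linear_bounded_pos[OF matrix_vector_mul_linear] by blast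
      have "\<bar>z \<bullet> ((ent_hess (M j) - H_matrix F (M j)) *v z)\<bar> \<le> K * (norm z)\<^sup>2" for z
      proof -
        have "\<bar>z \<bullet> ((ent_hess (M j) - H_matrix F (M j)) *v z)\<bar> \<le> norm z * norm ((ent_hess (M j) - H_matrix F (M j)) *v z)"
          by (rule Cauchy_Schwarz_ineq2)
        also have "\<dots> \<le> norm z * (K * norm z)" by (intro mult_left_mono K) auto
        finally show ?thesis by (simp add: power2_eq_square mult_ac)
      qed
      with K(1) show thesis using that by blast
    qed
    have near: "\<bar>phi j x\<bar> \<le> (1 + K) * (norm (x - M j))\<^sup>2" if "norm (x - M j) < r" for x
    proof -
      let ?t = "(norm (x - M j))\<^sup>2" and ?q = "(x - M j) \<bullet> ((ent_hess (M j) - H_matrix F (M j)) *v (x - M j))"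
      have "\<bar>phi j x - ?q / 2\<bar> \<le> ?t"
        using r(2)[OF that] by (simp add: matrix_vector_mult_diff_rdistrib inner_diff_right)
      moreover have "0 \<le> K * ?t" using K(2) by simp
      ultimately show ?thesis using K(1)[of "x - M j"] unfolding distrib_right abs_le_iff mult_1 by linarith
    qed
    have img: "full_point ` hat_simplex \<subseteq> prob_simplex" using full_point_in_prob_simplex_iff by blast
    have "continuous_on hat_simplex (phi j)"
      unfolding phi_def [abs_def]
      by (intro continuous_intros continuous_on_compose2[OF C2_on_imp_continuous_on[OF F_C2] continuous_on_full_point img]
        continuous_on_full_point)
    then obtain K' where K': "\<And>x. x \<in> hat_simplex \<Longrightarrow> \<bar>phi j x\<bar> \<le> K'"
      using compact_continuous_image[OF _ compact_hat_simplex, of "phi j"]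
      by (meson bounded_real compact_imp_bounded imageI)
    have K'0: "K' \<ge> 0" using K'[OF M_maximizer(1)[OF j]] by linarith
    have "\<bar>phi j x\<bar> \<le> (1 + K + K' / r\<^sup>2) * (norm (x - M j))\<^sup>2" if x: "x \<in> hat_simplex" for x
    proof (cases "norm (x - M j) < r")
      case True
      have "K' / r\<^sup>2 * (norm (x - M j))\<^sup>2 \<ge> 0" using K'0 by simp
      then show ?thesis using near[OF True] by (simp add: distrib_right)
    next
      case False
      then have "r\<^sup>2 \<le> (norm (x - M j))\<^sup>2" using r(1) by (intro power_mono) auto
      then have "K' \<le> K' / r\<^sup>2 * (norm (x - M j))\<^sup>2"
        using r(1) K'0 by (simp add: field_simps mult_left_mono)
      moreover have "(1 + K) * (norm (x - M j))\<^sup>2 \<ge> 0" using K(2) by simp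
      ultimately show ?thesis using K'[OF x] unfolding distrib_right[of "1 + K"] by linarith
    qed
    then show ?thesis using K(2) K'0 by (intro exI[of _ "1 + K + K' / r\<^sup>2"]) auto
  qed
  then obtain C where C: "\<And>j. j \<in> {1..p} \<Longrightarrow> C j \<ge> 0 \<and> (\<forall>x\<in>hat_simplex. \<bar>phi j x\<bar> \<le> C j * (norm (x - M j))\<^sup>2)"
    by metis
  show thesis
  proof
    show "sum C {1..p} \<ge> 0" using C by (auto intro: sum_nonneg)
    fix j x assume j: "j \<in> {1..p}" and x: "x \<in> (hat_simplex :: (real^'n) set)"
    have "C j \<le> sum C {1..p}" using j C by (intro member_le_sum) auto
    then have "C j * (norm (x - M j))\<^sup>2 \<le> sum C {1..p} * (norm (x - M j))\<^sup>2" by (rule mult_right_mono) simp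
    then show "\<bar>phi j x\<bar> \<le> sum C {1..p} * (norm (x - M j))\<^sup>2" using C[OF j] x by fastforce
  qed
qed

section \<open>The density of the mixture\<close>

lemma norm_truncate_vec: "norm (truncate_vec \<delta> N v) \<le> norm v" "norm (truncate_vec \<delta> N v) \<le> real N powr \<delta>"
  by (auto simp: truncate_vec_def)

definition random_point :: "nat \<Rightarrow> nat \<Rightarrow> 'w \<Rightarrow> real^('n option)" where
  "random_point j N \<omega> = full_point (M j + truncate_vec \<delta> N (\<xi> j \<omega>) /\<^sub>R sqrt (real N))"

text \<open>Truncation bounds every realisation of the shift, so positivity of the random parameters
  holds for all \<open>\<omega>\<close>. The margin \<open>amin / 2\<close> keeps later constants
  independent of \<open>N\<close>.\<close>

definition good :: "nat \<Rightarrow> bool" where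
  "good N \<longleftrightarrow> N \<ge> 1 \<and> (\<forall>j\<in>{1..p}. \<forall>v k. norm v \<le> real N powr \<delta> \<longrightarrow>
     full_point (M j + v /\<^sub>R sqrt (real N)) $ k \<ge> amin / 2)"

text \<open>Even the largest truncated shift is negligible on the scale of the simplex.\<close>

lemma powr_delta_over_sqrt_tendsto: "(\<lambda>N. real N powr \<delta> / sqrt (real N)) \<longlonglongrightarrow> 0"
proof -
  have "(\<lambda>N. real N powr (\<delta> - 1 / 2)) \<longlonglongrightarrow> 0"
    using delta by (intro tendsto_neg_powr filterlim_real_sequentially) auto
  moreover have "\<forall>\<^sub>F N in sequentially. real N powr (\<delta> - 1 / 2) = real N powr \<delta> / sqrt (real N)"
    using eventually_gt_at_top[of 0] by eventually_elim (simp add: powr_diff powr_half_sqrt)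
  ultimately show ?thesis by (simp add: tendsto_cong)
qed

lemma eventually_good: "eventually good sequentially"
proof -
  let ?d = "2 * real CARD('n)"
  have "(\<lambda>N. ?d * (real N powr \<delta> / sqrt (real N))) \<longlonglongrightarrow> 0"
    by (rule tendsto_mult_right_zero[OF powr_delta_over_sqrt_tendsto])
  then have "\<forall>\<^sub>F N in sequentially. ?d * (real N powr \<delta> / sqrt (real N)) < amin / 2"
    using amin_pos by (intro order_tendstoD(2)) auto
  then show ?thesis using eventually_ge_at_top[of 1]
  proof eventually_elim
    case (elim N)
    show ?case unfolding good_def
    proof (intro conjI ballI allI impI)
      fix j k and v :: "real^'n" assume j: "j \<in> {1..p}" and v: "norm v \<le> real N powr \<delta>"
      have "\<bar>full_vec (v /\<^sub>R sqrt (real N)) $ k\<bar> \<le> norm (full_vec (v /\<^sub>R sqrt (real N)))"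
        by (rule component_le_norm_cart)
      also have "\<dots> \<le> ?d * norm (v /\<^sub>R sqrt (real N))" by (rule norm_full_vec_le)
      also have "\<dots> \<le> ?d * (real N powr \<delta> / sqrt (real N))"
        using v elim(2) by (intro mult_left_mono) (auto simp: divide_inverse mult.commute mult_right_mono)
      finally show "amin / 2 \<le> full_point (M j + v /\<^sub>R sqrt (real N)) $ k"
        using elim(1) amin_le[OF j, of k] unfolding full_point_add vector_add_component by linarith
    qed (use elim in simp)
  qed
qed

lemma sum_random_point: "(\<Sum>k\<in>UNIV. random_point j N \<omega> $ k) = 1"
  unfolding random_point_def by (rule sum_full_point)

lemma random_point_ge: "good N \<Longrightarrow> j \<in> {1..p} \<Longrightarrow> random_point j N \<omega> $ k \<ge> amin / 2"
  using norm_truncate_vec(2) unfolding random_point_def good_def by blast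

lemma random_point_pos: "good N \<Longrightarrow> j \<in> {1..p} \<Longrightarrow> random_point j N \<omega> $ k > 0"
  using random_point_ge[of N j \<omega> k] amin_pos by linarith

lemma random_point_in_prob_simplex: "good N \<Longrightarrow> j \<in> {1..p} \<Longrightarrow> random_point j N \<omega> \<in> prob_simplex"
proof -
  assume *: "good N" "j \<in> {1..p}"
  have "random_point j N \<omega> $ k \<le> (\<Sum>k\<in>UNIV. random_point j N \<omega> $ k)" for k
    by (rule member_le_sum) (use random_point_pos[OF *] in \<open>auto simp: less_imp_le\<close>)
  then show ?thesis using random_point_pos[OF *] sum_random_point by (auto simp: prob_simplex_def less_imp_le)
qed

lemma xi_measurable [measurable]: "j \<in> {1..p} \<Longrightarrow> \<xi> j \<in> borel_measurable P"
  using xi_normal by (auto dest!: distributed_measurable simp: measurable_lborel1)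

lemma borel_measurable_full_vec [measurable]: "full_vec \<in> borel_measurable borel"
  by (intro borel_measurable_continuous_onI linear_continuous_on)
    (use linear_full_vec linear_conv_bounded_linear in blast)

lemma truncate_vec_measurable [measurable]: "truncate_vec \<delta> N \<in> borel_measurable borel"
  unfolding truncate_vec_def [abs_def] by measurable

lemma random_point_measurable [measurable]: "j \<in> {1..p} \<Longrightarrow> (\<lambda>\<omega>. random_point j N \<omega> $ k) \<in> borel_measurable P"
proof -
  assume [measurable]: "j \<in> {1..p}"
  have "(\<lambda>v :: real^('n option). v $ k) \<in> borel_measurable borel"
    by (intro borel_measurable_continuous_onI continuous_intros)
  then have "(\<lambda>\<omega>. full_vec (truncate_vec \<delta> N (\<xi> j \<omega>) /\<^sub>R sqrt (real N)) $ k) \<in> borel_measurable P"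
    by (rule measurable_compose[rotated]) measurable
  then show ?thesis unfolding random_point_def full_point_add by simp
qed

text \<open>The exponential form of a product over spins makes sense at every point of the simplex,
  not only at attainable magnetizations; limits along arbitrary sequences of points rely on
  this.\<close>

definition Qint :: "nat \<Rightarrow> nat \<Rightarrow> real^'n \<Rightarrow> 'w \<Rightarrow> real" where
  "Qint j N x \<omega> = exp (real N * (\<Sum>k\<in>UNIV. full_point x $ k * ln (random_point j N \<omega> $ k)))"

definition Q :: "nat \<Rightarrow> nat \<Rightarrow> real^'n \<Rightarrow> real" where
  "Q j N x = (\<integral>\<omega>. Qint j N x \<omega> \<partial>P)"

definition gibbs_density :: "nat \<Rightarrow> real^'n \<Rightarrow> real" where
  "gibbs_density N x = exp (real N * (F (full_point x) - Gmax))"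

definition mixture_density :: "nat \<Rightarrow> real^'n \<Rightarrow> real" where
  "mixture_density N x = (\<Sum>j=1..p. weight F (M j) * Q j N x)"

definition total_weight :: real where
  "total_weight = (\<Sum>j=1..p. weight F (M j))"

lemma weight_pos: "j \<in> {1..p} \<Longrightarrow> weight F (M j) > 0"
  unfolding weight_def
  using det_pos_def_matrix[of "H_matrix F (M j)"] B full_point_M_pos
  by (metis less_irrefl mult_pos_pos powr_gt_zero prod_pos)

lemma total_weight_pos: "total_weight > 0"
  unfolding total_weight_def using weight_pos p_pos by (intro sum_pos) auto

lemma Qint_le: 
  assumes "good N" "j \<in> {1..p}" "x \<in> hat_simplex"
  shows "Qint j N x \<omega> \<le> exp (- real N * ent (full_point x) - real N * (norm (full_point x - random_point j N \<omega>))\<^sup>2 / 4)"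
proof -
  have "(\<Sum>k\<in>UNIV. full_point x $ k * ln (random_point j N \<omega> $ k))
    \<le> - ent (full_point x) - (norm (full_point x - random_point j N \<omega>))\<^sup>2 / 4"
    using assms by (intro sum_mult_ln_le_neg_ent random_point_pos sum_random_point) (simp add: full_point_in_prob_simplex_iff)
  then have "real N * (\<Sum>k\<in>UNIV. full_point x $ k * ln (random_point j N \<omega> $ k))
    \<le> real N * (- ent (full_point x) - (norm (full_point x - random_point j N \<omega>))\<^sup>2 / 4)"
    by (rule mult_left_mono) simp
  then show ?thesis unfolding Qint_def by (simp add: right_diff_distrib)
qed

lemma Qint_le_ent:
  assumes "good N" "j \<in> {1..p}" "x \<in> hat_simplex"
  shows "Qint j N x \<omega> \<le> exp (- real N * ent (full_point x))"
  by (rule order_trans[OF Qint_le[OF assms]]) simp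

lemma Qint_measurable [measurable]: "j \<in> {1..p} \<Longrightarrow> Qint j N x \<in> borel_measurable P"
  unfolding Qint_def [abs_def] by measurable

lemma Qint_integrable: 
  assumes "good N" "j \<in> {1..p}" "x \<in> hat_simplex"
  shows "integrable P (Qint j N x)"
proof -
  interpret prob_space P by (rule prob)
  show ?thesis
    using assms Qint_le_ent[OF assms]
    by (intro integrable_const_bound[where B = "exp (- real N * ent (full_point x))"])
      (auto simp: Qint_def)
qed

lemma Q_le: 
  assumes "good N" "j \<in> {1..p}" "x \<in> hat_simplex"
  shows "Q j N x \<le> exp (- real N * ent (full_point x))"
proof -
  interpret prob_space P by (rule prob)
  show ?thesis unfolding Q_def
    using integral_mono[OF Qint_integrable[OF assms] integrable_const Qint_le_ent[OF assms]] by (simp add: prob_space)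
qed

abbreviation hat_mag :: "nat \<Rightarrow> (nat \<Rightarrow> 'n option) \<Rightarrow> real^'n" where
  "hat_mag N \<sigma> \<equiv> hat_point (magnetization N \<sigma>)"

lemma full_hat_mag: "N \<ge> 1 \<Longrightarrow> full_point (hat_mag N \<sigma>) = magnetization N \<sigma>"
  by (intro full_hat_point magnetization_in_prob_simplex)

lemma hat_mag_in_hat_simplex: "N \<ge> 1 \<Longrightarrow> hat_mag N \<sigma> \<in> hat_simplex"
  by (intro hat_point_in_hat_simplex magnetization_in_prob_simplex)

lemma Qint_eq_prod:
  assumes "good N" "j \<in> {1..p}"
  shows "Qint j N (hat_mag N \<sigma>) \<omega> = (\<Prod>i=1..N. random_point j N \<omega> $ \<sigma> i)"
proof -
  have N: "N \<ge> 1" using assms(1) by (simp add: good_def)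
  show ?thesis
    unfolding Qint_def full_hat_mag[OF N]
    by (rule prod_eq_exp_magnetization[OF N, where c = "\<lambda>k. random_point j N \<omega> $ k" and \<sigma> = \<sigma>, symmetric]) (rule random_point_pos[OF assms])
qed

lemma mixture_weight_eq:
  assumes "good N"
  shows "mixture_weight F p M P \<xi> \<delta> N \<sigma> = mixture_density N (hat_mag N \<sigma>) / total_weight"
proof -
  have "(\<integral>\<omega>. (\<Prod>i=1..N. \<Sum>k\<in>UNIV.
            (full_point (M j) $ k + full_vec (truncate_vec \<delta> N (\<xi> j \<omega>)) $ k / sqrt (real N))
            * of_bool (\<sigma> i = k)) \<partial>P) = Q j N (hat_mag N \<sigma>)" if j: "j \<in> {1..p}" for j
  proof -
    have "full_point (M j) $ k + full_vec (truncate_vec \<delta> N (\<xi> j \<omega>)) $ k / sqrt (real N) = random_point j N \<omega> $ k" for k \<omega>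
      unfolding random_point_def full_point_add linear_scale[OF linear_full_vec] by (simp add: divide_inverse mult.commute)
    moreover have "(\<Sum>k\<in>UNIV. random_point j N \<omega> $ k * of_bool (\<sigma> i = k)) = random_point j N \<omega> $ \<sigma> i" for \<omega> i
      by (simp add: of_bool_def if_distrib[of "\<lambda>x. _ * x"] cong: if_cong)
    ultimately show ?thesis unfolding Q_def Qint_eq_prod[OF assms j] by simp
  qed
  then show ?thesis
    unfolding mixture_weight_def mixture_density_def total_weight_def by simp
qed

lemma sum_Q_moment:
  assumes N: "good N" and j: "j \<in> {1..p}"
  shows "(\<Sum>\<sigma>\<in>configs N. Q j N (hat_mag N \<sigma>) * h \<sigma>) = (\<integral>\<omega>. (\<Sum>\<sigma>\<in>configs N. (\<Prod>i=1..N. random_point j N \<omega> $ \<sigma> i) * h \<sigma>) \<partial>P)"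
proof -
  have N1: "N \<ge> 1" using N by (simp add: good_def)
  have "(\<Sum>\<sigma>\<in>configs N. Q j N (hat_mag N \<sigma>) * h \<sigma>) = (\<Sum>\<sigma>\<in>configs N. \<integral>\<omega>. Qint j N (hat_mag N \<sigma>) \<omega> * h \<sigma> \<partial>P)"
    by (simp add: Q_def)
  also have "\<dots> = (\<integral>\<omega>. (\<Sum>\<sigma>\<in>configs N. Qint j N (hat_mag N \<sigma>) \<omega> * h \<sigma>) \<partial>P)"
    by (rule Bochner_Integration.integral_sum[symmetric])
      (intro integrable_mult_left Qint_integrable[OF N j] hat_mag_in_hat_simplex[OF N1])
  finally show ?thesis by (simp add: Qint_eq_prod[OF N j])
qed

lemma sum_mixture_density:
  assumes N: "good N"
  shows "(\<Sum>\<sigma>\<in>configs N. mixture_density N (hat_mag N \<sigma>)) = total_weight"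
proof -
  interpret prob_space P by (rule prob)
  have "(\<Sum>\<sigma>\<in>configs N. Q j N (hat_mag N \<sigma>)) = 1" if j: "j \<in> {1..p}" for j
  proof -
    have "(\<Sum>\<sigma>\<in>configs N. \<Prod>i=1..N. random_point j N \<omega> $ \<sigma> i) = 1" for \<omega>
      unfolding configs_def by (intro sum_PiE_prod_one sum_random_point) simp
    then show ?thesis using sum_Q_moment[OF N j, of "\<lambda>_. 1"] by (simp add: prob_space)
  qed
  then show ?thesis
    unfolding mixture_density_def total_weight_def
    by (subst sum.swap) (simp flip: sum_distrib_left)
qed

lemma xi_fourth_moment:
  assumes j: "j \<in> {1..p}"
  shows "integrable P (\<lambda>\<omega>. norm (\<xi> j \<omega>) ^ 4)"
proof -
  let ?S = "Sigma_matrix F (M j)"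
  have S: "pos_def_matrix ?S" using Sigma_pos_def j by blast
  obtain c D where cD: "c > 0" "D > 0" "\<And>x. multi_normal_density 0 ?S x \<le> D * exp (- c * (norm x)\<^sup>2)"
    using multi_normal_density_le[OF S] by blast
  have "(\<integral>\<^sup>+\<omega>. ennreal (norm (\<xi> j \<omega>) ^ 4) \<partial>P)
     = (\<integral>\<^sup>+x. ennreal (multi_normal_density 0 ?S x) * ennreal (norm x ^ 4) \<partial>lborel)"
    using xi_normal j by (intro distributed_nn_integral[symmetric, of P lborel "\<xi> j" _ "\<lambda>x. ennreal (norm x ^ 4)"]) auto
  also have "\<dots> \<le> (\<integral>\<^sup>+(x::real^'n). ennreal D * ennreal (exp (- c * (norm x)\<^sup>2) * (1 + norm x ^ 4)) \<partial>lborel)"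
  proof (rule nn_integral_mono)
    fix x :: "real^'n"
    have "multi_normal_density 0 ?S x * norm x ^ 4 \<le> (D * exp (- c * (norm x)\<^sup>2)) * (1 + norm x ^ 4)"
      using cD by (intro mult_mono) auto
    then show "ennreal (multi_normal_density 0 ?S x) * ennreal (norm x ^ 4)
      \<le> ennreal D * ennreal (exp (- c * (norm x)\<^sup>2) * (1 + norm x ^ 4))"
      using cD by (subst (1 2) ennreal_mult[symmetric]) (auto intro!: ennreal_leI multi_normal_density_nonneg[OF S] simp: mult.assoc)
  qed
  also have "\<dots> = ennreal D * (\<integral>\<^sup>+(x::real^'n). ennreal (exp (- c * (norm x)\<^sup>2) * (1 + norm x ^ 4)) \<partial>lborel)"
    by (rule nn_integral_cmult) simp
  also have "\<dots> < \<infinity>"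
    using integrable_gaussian_moment[where 'n = 'n, OF cD(1)] by (simp add: ennreal_mult_less_top)
  finally show ?thesis using j by (intro integrableI_nonneg) auto
qed

text \<open>The reference point \<open>m\<close> misses the mean by the shift
  \<open>\<eta> / sqrt N\<close>. With \<open>(a + b) ^ 4 \<le> 8 * (a ^ 4 + b ^ 4)\<close> the
  centred part contributes \<open>8 * 3\<close> and the shift contributes
  \<open>8 * norm \<eta> ^ 4\<close>, free of \<open>N\<close>.\<close>

lemma fourth_moment_shifted:
  assumes N: "N \<ge> 1" and x: "full_point (m + \<eta> /\<^sub>R sqrt (real N)) \<in> prob_simplex"
  shows "(\<Sum>\<sigma>\<in>configs N. (\<Prod>i=1..N. full_point (m + \<eta> /\<^sub>R sqrt (real N)) $ \<sigma> i) * ((real N)\<^sup>2 * norm (hat_mag N \<sigma> - m) ^ 4))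
    \<le> 24 * (real CARD('n option))\<^sup>2 + 8 * norm \<eta> ^ 4"
proof -
  let ?\<pi> = "full_point (m + \<eta> /\<^sub>R sqrt (real N))"
  let ?P = "\<lambda>\<sigma>. \<Prod>i=1..N. ?\<pi> $ \<sigma> i"
  have P0: "?P \<sigma> \<ge> 0" for \<sigma> using x unfolding prob_simplex_def by (intro prod_nonneg) blast
  have P1: "(\<Sum>\<sigma>\<in>configs N. ?P \<sigma>) = 1" unfolding configs_def by (intro sum_PiE_prod_one sum_full_point) simp
  have "(real N)\<^sup>2 * norm (hat_mag N \<sigma> - m) ^ 4 \<le> 8 * ((real N)\<^sup>2 * norm (magnetization N \<sigma> - ?\<pi>) ^ 4) + 8 * norm \<eta> ^ 4" for \<sigma>
  proof -
    have "hat_mag N \<sigma> - m = hat_point (magnetization N \<sigma> - ?\<pi>) + \<eta> /\<^sub>R sqrt (real N)"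
      unfolding hat_point_diff hat_full_point by simp
    then have "norm (hat_mag N \<sigma> - m) ^ 4 \<le> 8 * (norm (hat_point (magnetization N \<sigma> - ?\<pi>)) ^ 4 + norm (\<eta> /\<^sub>R sqrt (real N)) ^ 4)"
      using norm_add_power4_le by metis
    also have "\<dots> \<le> 8 * (norm (magnetization N \<sigma> - ?\<pi>) ^ 4 + norm (\<eta> /\<^sub>R sqrt (real N)) ^ 4)"
      by (intro mult_left_mono add_right_mono power_mono norm_hat_point_le) auto
    finally have "(real N)\<^sup>2 * norm (hat_mag N \<sigma> - m) ^ 4
      \<le> (real N)\<^sup>2 * (8 * (norm (magnetization N \<sigma> - ?\<pi>) ^ 4 + norm (\<eta> /\<^sub>R sqrt (real N)) ^ 4))"
      by (rule mult_left_mono) simp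
    moreover have "(real N)\<^sup>2 * norm (\<eta> /\<^sub>R sqrt (real N)) ^ 4 = norm \<eta> ^ 4"
    proof -
      have "sqrt (real N) ^ 4 = (real N)\<^sup>2" using power_mult[of "sqrt (real N)" 2 2] by simp
      then show ?thesis using N by (simp add: power_mult_distrib power_inverse field_simps)
    qed
    moreover have "u * (8 * (v + w)) = 8 * (u * v) + 8 * (u * w)" for u v w :: real
      by (simp add: algebra_simps)
    ultimately show ?thesis by simp
  qed
  then have "(\<Sum>\<sigma>\<in>configs N. ?P \<sigma> * ((real N)\<^sup>2 * norm (hat_mag N \<sigma> - m) ^ 4))
    \<le> (\<Sum>\<sigma>\<in>configs N. ?P \<sigma> * (8 * ((real N)\<^sup>2 * norm (magnetization N \<sigma> - ?\<pi>) ^ 4) + 8 * norm \<eta> ^ 4))"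
    using P0 by (intro sum_mono mult_left_mono)
  also have "\<dots> = 8 * (\<Sum>\<sigma>\<in>configs N. ?P \<sigma> * ((real N)\<^sup>2 * norm (magnetization N \<sigma> - ?\<pi>) ^ 4))
      + 8 * norm \<eta> ^ 4 * (\<Sum>\<sigma>\<in>configs N. ?P \<sigma>)"
    unfolding distrib_left sum.distrib sum_distrib_left by (intro arg_cong2[of _ _ _ _ "(+)"] sum.cong refl) (simp_all add: mult_ac)
  also have "\<dots> \<le> 8 * (3 * (real CARD('n option))\<^sup>2) + 8 * norm \<eta> ^ 4 * 1"
    unfolding P1 using fourth_moment_magnetization[OF N x] by simp
  finally show ?thesis by simp
qed

lemma Q_fourth_moment:
  obtains C where "\<And>N j. good N \<Longrightarrow> j \<in> {1..p} \<Longrightarrow>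
    (\<Sum>\<sigma>\<in>configs N. Q j N (hat_mag N \<sigma>) * ((real N)\<^sup>2 * norm (hat_mag N \<sigma> - M j) ^ 4)) \<le> C"
proof -
  interpret prob_space P by (rule prob)
  define C where "C = (\<Sum>j=1..p. \<integral>\<omega>. (24 * (real CARD('n option))\<^sup>2 + 8 * norm (\<xi> j \<omega>) ^ 4) \<partial>P)"
  have int: "integrable P (\<lambda>\<omega>. 24 * (real CARD('n option))\<^sup>2 + 8 * norm (\<xi> j \<omega>) ^ 4)" if "j \<in> {1..p}" for j
    using xi_fourth_moment[OF that] by (intro Bochner_Integration.integrable_add integrable_mult_right) auto
  show thesis
  proof (rule that[of C])
    fix N j assume N: "good N" and j: "j \<in> {1..p}"
    have N1: "N \<ge> 1" using N by (simp add: good_def)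
    let ?h = "\<lambda>\<sigma>. (real N)\<^sup>2 * norm (hat_mag N \<sigma> - M j) ^ 4"
    have "(\<Sum>\<sigma>\<in>configs N. Q j N (hat_mag N \<sigma>) * ?h \<sigma>) = (\<integral>\<omega>. (\<Sum>\<sigma>\<in>configs N. (\<Prod>i=1..N. random_point j N \<omega> $ \<sigma> i) * ?h \<sigma>) \<partial>P)"
      by (rule sum_Q_moment[OF N j])
    also have "\<dots> \<le> (\<integral>\<omega>. (24 * (real CARD('n option))\<^sup>2 + 8 * norm (\<xi> j \<omega>) ^ 4) \<partial>P)"
    proof (rule integral_mono[OF _ int[OF j]])
      have "integrable P (\<lambda>\<omega>. \<Sum>\<sigma>\<in>configs N. Qint j N (hat_mag N \<sigma>) \<omega> * ?h \<sigma>)"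
        by (intro Bochner_Integration.integrable_sum integrable_mult_left Qint_integrable[OF N j] hat_mag_in_hat_simplex[OF N1])
      then show "integrable P (\<lambda>\<omega>. \<Sum>\<sigma>\<in>configs N. (\<Prod>i=1..N. random_point j N \<omega> $ \<sigma> i) * ?h \<sigma>)"
        by (simp only: Qint_eq_prod[OF N j])
      fix \<omega>
      have "(\<Sum>\<sigma>\<in>configs N. (\<Prod>i=1..N. random_point j N \<omega> $ \<sigma> i) * ?h \<sigma>)
        \<le> 24 * (real CARD('n option))\<^sup>2 + 8 * norm (truncate_vec \<delta> N (\<xi> j \<omega>)) ^ 4"
        unfolding random_point_def by (rule fourth_moment_shifted[OF N1 random_point_in_prob_simplex[OF N j, unfolded random_point_def]])
      also have "\<dots> \<le> 24 * (real CARD('n option))\<^sup>2 + 8 * norm (\<xi> j \<omega>) ^ 4"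
        by (intro add_left_mono mult_left_mono power_mono norm_truncate_vec) auto
      finally show "(\<Sum>\<sigma>\<in>configs N. (\<Prod>i=1..N. random_point j N \<omega> $ \<sigma> i) * ?h \<sigma>)
        \<le> 24 * (real CARD('n option))\<^sup>2 + 8 * norm (\<xi> j \<omega>) ^ 4" .
    qed
    also have "\<dots> \<le> C"
      unfolding C_def using j
      by (intro member_le_sum[of j "{1..p}" "\<lambda>j. \<integral>\<omega>. (24 * (real CARD('n option))\<^sup>2 + 8 * norm (\<xi> j \<omega>) ^ 4) \<partial>P"] integral_nonneg_AE) auto
    finally show "(\<Sum>\<sigma>\<in>configs N. Q j N (hat_mag N \<sigma>) * ?h \<sigma>) \<le> C" .
  qed
qed

section \<open>Comparison with the product measure at a maximizer\<close>

definition logPM :: "nat \<Rightarrow> real^'n \<Rightarrow> real" where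
  "logPM j x = (\<Sum>k\<in>UNIV. full_point x $ k * ln (full_point (M j) $ k))"

definition dim_const :: real where "dim_const = 2 * real CARD('n)"

lemma dim_const_pos: "dim_const > 0"
  by (simp add: dim_const_def)

lemma norm_full_point_diff: "norm (full_point x - full_point y) \<le> dim_const * norm (x - y)" for x y :: "real^'n"
  unfolding full_vec_diff dim_const_def by (rule norm_full_vec_le)

lemma gibbs_density_eq: "gibbs_density N x = exp (real N * phi j x + real N * logPM j x)"
  by (simp add: gibbs_density_def phi_def logPM_def algebra_simps)

lemma neg_ent_le_logPM:
  assumes "j \<in> {1..p}" "x \<in> hat_simplex"
  shows "- ent (full_point x) \<le> logPM j x + dim_const\<^sup>2 / amin * (norm (x - M j))\<^sup>2"
proof -
  have "- ent (full_point x) \<le> logPM j x + (norm (full_point x - full_point (M j)))\<^sup>2 / amin"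
    unfolding logPM_def using assms amin_pos
    by (intro neg_ent_le_sum_mult_ln amin_le sum_full_point) (simp_all add: full_point_in_prob_simplex_iff)
  also have "(norm (full_point x - full_point (M j)))\<^sup>2 / amin \<le> (dim_const * norm (x - M j))\<^sup>2 / amin"
    using amin_pos by (intro divide_right_mono power_mono norm_full_point_diff) auto
  finally show ?thesis by (simp add: power_mult_distrib)
qed

text \<open>Every component \<open>i\<close> is bounded by the entropy factor
  \<open>exp (- N * ent)\<close>, and that factor is comparable to the likelihood at whichever
  maximizer \<open>j\<close> serves as the reference.\<close>

lemma Q_le_logPM:
  assumes "good N" "i \<in> {1..p}" "j \<in> {1..p}" "x \<in> hat_simplex"
  shows "Q i N x \<le> exp (real N * logPM j x + dim_const\<^sup>2 / amin * (real N * (norm (x - M j))\<^sup>2))"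
proof -
  have "real N * (- ent (full_point x)) \<le> real N * (logPM j x + dim_const\<^sup>2 / amin * (norm (x - M j))\<^sup>2)"
    using assms by (intro mult_left_mono neg_ent_le_logPM) auto
  then have "exp (- real N * ent (full_point x)) \<le> exp (real N * logPM j x + dim_const\<^sup>2 / amin * (real N * (norm (x - M j))\<^sup>2))"
    by (simp add: algebra_simps)
  then show ?thesis using Q_le[OF assms(1,2,4)] by linarith
qed

text \<open>
  By convexity \<open>E exp Y \<ge> exp (E Y)\<close>; the tangent line at \<open>E Y\<close> is integrated here in place of
  Jensen's inequality.
\<close>

lemma Q_ge_logPM:
  obtains C where "C \<ge> 0" "\<And>N j x. good N \<Longrightarrow> j \<in> {1..p} \<Longrightarrow> x \<in> hat_simplex \<Longrightarrow>
    Q j N x \<ge> exp (real N * logPM j x - C * (1 + real N * (norm (x - M j))\<^sup>2))"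
proof -
  interpret prob_space P by (rule prob)
  define m4 where "m4 j = (\<integral>\<omega>. norm (\<xi> j \<omega>) ^ 4 \<partial>P)" for j
  \<comment> \<open>The random parameters are bounded below by \<open>amin / 2\<close>, hence the
    factor 2; each of the two distances brings one \<open>dim_const\<close>.\<close>
  define a where "a = 2 * dim_const\<^sup>2 / amin"
  have a: "a \<ge> 0" using amin_pos by (simp add: a_def)
  have m4: "m4 j \<ge> 0" for j by (simp add: m4_def)
  define C where "C = a * (2 + 2 * (\<Sum>j=1..p. m4 j))"
  have C: "C \<ge> a" "C \<ge> 0"
  proof -
    have "a * 1 \<le> C" unfolding C_def using a sum_nonneg[of "{1..p}" m4] m4 by (intro mult_left_mono) auto
    then show "C \<ge> a" "C \<ge> 0" using a by auto
  qed
  show thesis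
  proof (rule that[OF C(2)])
    fix N j x assume N: "good N" and j: "j \<in> {1..p}" and x: "x \<in> (hat_simplex :: (real^'n) set)"
    have N1: "N \<ge> 1" using N by (simp add: good_def)
    let ?t = "real N * (norm (x - M j))\<^sup>2"
    \<comment> \<open>The lower bound for the exponent with the fourth power of the norm replaced by
      its mean; this is where the tangent line touches.\<close>
    define c where "c = - a * (?t + 2 + 2 * m4 j)"
    have low: "Qint j N x \<omega> \<ge> exp (real N * logPM j x + c) * (1 - 2 * a * (norm (\<xi> j \<omega>) ^ 4 - m4 j))" for \<omega>
    proof -
      define v where "v = truncate_vec \<delta> N (\<xi> j \<omega>)"
      have ptv: "random_point j N \<omega> = full_point (M j + v /\<^sub>R sqrt (real N))" by (simp add: random_point_def v_def)
      have nv: "norm (v /\<^sub>R sqrt (real N)) = norm v / sqrt (real N)" by (simp add: divide_inverse mult.commute)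
      have 1: "norm (random_point j N \<omega> - full_point (M j)) \<le> dim_const * (norm v / sqrt (real N))"
        using norm_full_point_diff[of "M j + v /\<^sub>R sqrt (real N)" "M j"] unfolding ptv by (simp only: add_diff_cancel_left' nv)
      have 2: "norm (full_point x - random_point j N \<omega>) \<le> dim_const * (norm (x - M j) + norm v / sqrt (real N))"
      proof -
        have "norm (full_point x - random_point j N \<omega>) \<le> dim_const * norm (x - M j - v /\<^sub>R sqrt (real N))"
          using norm_full_point_diff[of x "M j + v /\<^sub>R sqrt (real N)"] unfolding ptv by (simp add: algebra_simps)
        also have "\<dots> \<le> dim_const * (norm (x - M j) + norm (v /\<^sub>R sqrt (real N)))"
          using dim_const_pos by (intro mult_left_mono norm_triangle_ineq4) auto
        finally show ?thesis unfolding nv .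
      qed
      have lo: "(\<Sum>k\<in>UNIV. full_point x $ k * ln (random_point j N \<omega> $ k))
        \<ge> logPM j x - norm (full_point x - random_point j N \<omega>) * norm (random_point j N \<omega> - full_point (M j)) / (amin / 2)"
        unfolding logPM_def
        using x amin_pos full_point_M_pos[OF j] random_point_ge[OF N j]
        by (intro sum_mult_ln_ratio_ge) (auto simp: sum_random_point sum_full_point full_point_in_prob_simplex_iff[symmetric] prob_simplex_def simp del: full_point_simps)
      have "norm (full_point x - random_point j N \<omega>) * norm (random_point j N \<omega> - full_point (M j)) / (amin / 2)
        \<le> (dim_const * (norm (x - M j) + norm v / sqrt (real N))) * (dim_const * (norm v / sqrt (real N))) / (amin / 2)"
        using 1 2 amin_pos dim_const_pos by (intro divide_right_mono mult_mono) auto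
      also have "\<dots> = a * ((norm (x - M j) + norm v / sqrt (real N)) * (norm v / sqrt (real N)))"
        by (simp add: a_def power2_eq_square field_simps)
      finally have "logPM j x - a * ((norm (x - M j) + norm v / sqrt (real N)) * (norm v / sqrt (real N)))
        \<le> (\<Sum>k\<in>UNIV. full_point x $ k * ln (random_point j N \<omega> $ k))" using lo by linarith
      then have "real N * (logPM j x - a * ((norm (x - M j) + norm v / sqrt (real N)) * (norm v / sqrt (real N))))
        \<le> real N * (\<Sum>k\<in>UNIV. full_point x $ k * ln (random_point j N \<omega> $ k))" by (rule mult_left_mono) simp
      moreover have "real N * (logPM j x - a * ((norm (x - M j) + norm v / sqrt (real N)) * (norm v / sqrt (real N))))
        \<ge> real N * logPM j x - a * (?t + 2 + 2 * norm (\<xi> j \<omega>) ^ 4)"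
      proof -
        let ?s = "sqrt (real N)" and ?z = "norm (x - M j)"
        have "real N * ((?z + norm v / ?s) * (norm v / ?s)) = (?s * ?z) * norm v + (norm v)\<^sup>2"
          using N1 by (simp add: field_simps power2_eq_square)
        also have "\<dots> \<le> (?s * ?z)\<^sup>2 + 2 * (norm v)\<^sup>2"
          using sum_squares_bound[of "?s * ?z" "norm v"] zero_le_power2[of "?s * ?z"] zero_le_power2[of "norm v"] by linarith
        also have "(?s * ?z)\<^sup>2 = ?t" by (simp add: power_mult_distrib)
        \<comment> \<open>Truncation only shortens the vector, and
          \<open>s \<le> 1 + s\<^sup>2\<close> passes to the fourth moment, whose integrability is
          already available.\<close>
        also have "(norm v)\<^sup>2 \<le> 1 + norm (\<xi> j \<omega>) ^ 4"
        proof -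
          have "(norm v)\<^sup>2 \<le> (norm (\<xi> j \<omega>))\<^sup>2" unfolding v_def by (intro power_mono norm_truncate_vec) auto
          also have "\<dots> \<le> 1 + ((norm (\<xi> j \<omega>))\<^sup>2)\<^sup>2"
            using sum_squares_bound[of 1 "(norm (\<xi> j \<omega>))\<^sup>2"] zero_le_power2[of "norm (\<xi> j \<omega>)"]
            unfolding power_one by linarith
          finally show ?thesis by simp
        qed
        finally have "a * (real N * ((?z + norm v / ?s) * (norm v / ?s))) \<le> a * (?t + 2 + 2 * norm (\<xi> j \<omega>) ^ 4)"
          using a by (intro mult_left_mono) simp_all
        then show ?thesis by (simp add: right_diff_distrib mult.left_commute)
      qed
      ultimately have "exp (real N * logPM j x - a * (?t + 2 + 2 * norm (\<xi> j \<omega>) ^ 4)) \<le> Qint j N x \<omega>"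
        unfolding Qint_def by simp
      moreover have "real N * logPM j x - a * (?t + 2 + 2 * norm (\<xi> j \<omega>) ^ 4)
        = (real N * logPM j x + c) + (- 2 * a * (norm (\<xi> j \<omega>) ^ 4 - m4 j))"
        by (simp add: c_def algebra_simps)
      ultimately have h1: "exp (real N * logPM j x + c) * exp (- 2 * a * (norm (\<xi> j \<omega>) ^ 4 - m4 j)) \<le> Qint j N x \<omega>"
        by (simp only: exp_add)
      have h2: "exp (real N * logPM j x + c) * (1 + (- 2 * a * (norm (\<xi> j \<omega>) ^ 4 - m4 j)))
        \<le> exp (real N * logPM j x + c) * exp (- 2 * a * (norm (\<xi> j \<omega>) ^ 4 - m4 j))"
        by (intro mult_left_mono exp_ge_add_one_self) simp
      have h3: "1 - 2 * a * (norm (\<xi> j \<omega>) ^ 4 - m4 j) = 1 + (- 2 * a * (norm (\<xi> j \<omega>) ^ 4 - m4 j))" by simp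
      show ?thesis unfolding h3 by (rule order_trans[OF h2 h1])
    qed
    have int: "integrable P (\<lambda>\<omega>. exp (real N * logPM j x + c) * (1 - 2 * a * (norm (\<xi> j \<omega>) ^ 4 - m4 j)))"
      using xi_fourth_moment[OF j] by simp
    have "(\<integral>\<omega>. exp (real N * logPM j x + c) * (1 - 2 * a * (norm (\<xi> j \<omega>) ^ 4 - m4 j)) \<partial>P) \<le> Q j N x"
      unfolding Q_def by (rule integral_mono[OF int Qint_integrable[OF N j x] low])
    moreover have "(\<integral>\<omega>. exp (real N * logPM j x + c) * (1 - 2 * a * (norm (\<xi> j \<omega>) ^ 4 - m4 j)) \<partial>P)
      = exp (real N * logPM j x + c)"
      using xi_fourth_moment[OF j] by (simp add: prob_space m4_def)
    moreover have "exp (real N * logPM j x - C * (1 + ?t)) \<le> exp (real N * logPM j x + c)"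
    proof -
      have "m4 j \<le> (\<Sum>j=1..p. m4 j)" using j m4 by (intro member_le_sum) auto
      then have "a * (2 + 2 * m4 j) \<le> C" unfolding C_def using a by (intro mult_left_mono) auto
      moreover have "a * ?t \<le> C * ?t" using C(1) by (intro mult_right_mono) auto
      ultimately show ?thesis by (simp add: c_def algebra_simps)
    qed
    ultimately show "exp (real N * logPM j x - C * (1 + ?t)) \<le> Q j N x" by linarith
  qed
qed

lemma mixture_density_pos: "good N \<Longrightarrow> x \<in> hat_simplex \<Longrightarrow> mixture_density N x > 0"
proof -
  assume *: "good N" "x \<in> hat_simplex"
  obtain C where C: "\<And>j. j \<in> {1..p} \<Longrightarrow> Q j N x \<ge> exp (real N * logPM j x - C * (1 + real N * (norm (x - M j))\<^sup>2))"
    using Q_ge_logPM * by metis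
  have "Q j N x > 0" if "j \<in> {1..p}" for j
    using C[OF that] by (rule order_less_le_trans[OF exp_gt_zero])
  then show ?thesis
    unfolding mixture_density_def using weight_pos p_pos by (intro sum_pos mult_pos_pos) auto
qed

lemma Q_nonneg: "Q j N x \<ge> 0"
  unfolding Q_def Qint_def by (intro integral_nonneg_AE) auto

definition log_ratio :: "nat \<Rightarrow> real^'n \<Rightarrow> real" where
  "log_ratio N x = ln (gibbs_density N x / mixture_density N x)"

text \<open>Both densities are measured against the likelihood at \<open>M j\<close>. The Gibbs side
  is \<open>phi_bound\<close>; the mixture is bounded above through all its components and below by
  component \<open>j\<close> alone.\<close>

lemma log_ratio_bound:
  obtains C where "C \<ge> 0" "\<And>N j x. good N \<Longrightarrow> j \<in> {1..p} \<Longrightarrow> x \<in> hat_simplex \<Longrightarrow>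
    \<bar>log_ratio N x\<bar> \<le> C * (1 + real N * (norm (x - M j))\<^sup>2)"
proof -
  obtain C1 where C1: "C1 \<ge> 0" "\<And>j x. j \<in> {1..p} \<Longrightarrow> x \<in> hat_simplex \<Longrightarrow> \<bar>phi j x\<bar> \<le> C1 * (norm (x - M j))\<^sup>2"
    by (rule phi_bound) blast
  obtain C2 where C2: "C2 \<ge> 0" "\<And>N j x. good N \<Longrightarrow> j \<in> {1..p} \<Longrightarrow> x \<in> hat_simplex \<Longrightarrow>
    Q j N x \<ge> exp (real N * logPM j x - C2 * (1 + real N * (norm (x - M j))\<^sup>2))"
    by (rule Q_ge_logPM) blast
  define C3 where "C3 = dim_const\<^sup>2 / amin"
  have C3: "C3 \<ge> 0" using amin_pos by (simp add: C3_def)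
  define w where "w = (\<Sum>j=1..p. \<bar>ln (weight F (M j))\<bar>) + \<bar>ln total_weight\<bar>"
  have w: "\<bar>ln (weight F (M j))\<bar> \<le> w" "\<bar>ln total_weight\<bar> \<le> w" if "j \<in> {1..p}" for j
    using member_le_sum[OF that, of "\<lambda>j. \<bar>ln (weight F (M j))\<bar>"] sum_nonneg[of "{1..p}" "\<lambda>j. \<bar>ln (weight F (M j))\<bar>"]
    by (auto simp: w_def)
  have w0: "w \<ge> 0" by (auto simp: w_def intro: add_nonneg_nonneg sum_nonneg)
  show thesis
  proof (rule that[of "C1 + C2 + C3 + w"])
    show "0 \<le> C1 + C2 + C3 + w" using C1 C2 C3 w0 by simp
    fix N j x assume N: "good N" and j: "j \<in> {1..p}" and x: "x \<in> (hat_simplex :: (real^'n) set)"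
    let ?t = "real N * (norm (x - M j))\<^sup>2" and ?g = "mixture_density N x"
    have t: "?t \<ge> 0" by simp
    have g: "?g > 0" using N x by (rule mixture_density_pos)
    have up: "ln ?g \<le> real N * logPM j x + C3 * ?t + ln total_weight"
    proof -
      have "?g \<le> (\<Sum>i=1..p. weight F (M i) * exp (real N * logPM j x + C3 * ?t))"
        unfolding mixture_density_def C3_def using N j x weight_pos
        by (intro sum_mono mult_left_mono Q_le_logPM) (auto simp: less_imp_le)
      also have "\<dots> = total_weight * exp (real N * logPM j x + C3 * ?t)"
        by (simp add: total_weight_def sum_distrib_right)
      finally have "ln ?g \<le> ln (total_weight * exp (real N * logPM j x + C3 * ?t))"
        using g total_weight_pos by (subst ln_le_cancel_iff) auto
      then show ?thesis using total_weight_pos by (simp add: ln_mult)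
    qed
    have low: "ln ?g \<ge> real N * logPM j x - C2 * (1 + ?t) + ln (weight F (M j))"
    proof -
      have "weight F (M j) * exp (real N * logPM j x - C2 * (1 + ?t)) \<le> weight F (M j) * Q j N x"
        using C2(2)[OF N j x] weight_pos[OF j] by (intro mult_left_mono) auto
      also have "\<dots> \<le> ?g"
        unfolding mixture_density_def using j weight_pos Q_nonneg
        by (intro member_le_sum[of j "{1..p}" "\<lambda>j. weight F (M j) * Q j N x"]) (auto simp: less_imp_le)
      finally have "ln (weight F (M j) * exp (real N * logPM j x - C2 * (1 + ?t))) \<le> ln ?g"
        using weight_pos[OF j] by (intro ln_mono) auto
      then show ?thesis using weight_pos[OF j] by (simp add: ln_mult)
    qed
    have "log_ratio N x = real N * phi j x + real N * logPM j x - ln ?g"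
      unfolding log_ratio_def gibbs_density_eq[of N x j] using g by (simp add: ln_div)
    moreover have "\<bar>real N * phi j x\<bar> \<le> C1 * ?t"
      using mult_left_mono[OF C1(2)[OF j x], of "real N"] by (simp add: abs_mult mult_ac)
    moreover have "C1 * ?t \<ge> 0" "C2 * ?t \<ge> 0" "C3 * ?t \<ge> 0" "w * ?t \<ge> 0"
      using t C1(1) C2(1) C3 w0 by (simp_all only: mult_nonneg_nonneg)
    moreover have "(C1 + C2 + C3 + w) * (1 + ?t) = C1 + C2 + C3 + w + C1 * ?t + C2 * ?t + C3 * ?t + w * ?t"
      "C2 * (1 + ?t) = C2 + C2 * ?t"
      by (simp_all only: distrib_left distrib_right mult_1 mult_1_right) 
    ultimately show "\<bar>log_ratio N x\<bar> \<le> (C1 + C2 + C3 + w) * (1 + ?t)"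
      using up low w[OF j] C1(1) C2(1) C3 unfolding abs_le_iff by linarith
  qed
qed

section \<open>Local limit of the density ratio\<close>

lemma integral_gaussian_tilt:
  assumes j: "j \<in> {1..p}"
  shows "integrable P (\<lambda>\<omega>. exp (- (\<xi> j \<omega> \<bullet> (ent_hess (M j) *v \<xi> j \<omega>)) / 2 + \<xi> j \<omega> \<bullet> (ent_hess (M j) *v y)))"
    and "weight F (M j) * (\<integral>\<omega>. exp (- (\<xi> j \<omega> \<bullet> (ent_hess (M j) *v \<xi> j \<omega>)) / 2 + \<xi> j \<omega> \<bullet> (ent_hess (M j) *v y)) \<partial>P)
      = exp ((y \<bullet> (ent_hess (M j) *v y) - y \<bullet> (H_matrix F (M j) *v y)) / 2)"
proof -
  let ?A = "ent_hess (M j)" and ?H = "H_matrix F (M j)" and ?S = "Sigma_matrix F (M j)"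
  let ?V = "diag_matrix (M j) - outer_product (M j) (M j)"
  let ?g = "\<lambda>x. exp (- (x \<bullet> (?A *v x)) / 2 + x \<bullet> (?A *v y))"
  let ?c = "exp ((y \<bullet> (?A *v y) - y \<bullet> (?H *v y)) / 2)"
  have S: "pos_def_matrix ?S" and H: "pos_def_matrix ?H" using Sigma_pos_def B j by auto
  note pos = full_point_M_pos[OF j]
  have [measurable]: "(\<lambda>x. x \<bullet> (?A *v y)) \<in> borel_measurable borel"
    by (intro borel_measurable_continuous_onI continuous_intros)
  have "(\<integral>\<^sup>+\<omega>. ennreal (?g (\<xi> j \<omega>)) \<partial>P) = (\<integral>\<^sup>+x. ennreal (multi_normal_density 0 ?S x) * ennreal (?g x) \<partial>lborel)"
    using xi_normal j by (intro distributed_nn_integral[symmetric, of P lborel "\<xi> j" _ "\<lambda>x. ennreal (?g x)"]) auto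
  also have "\<dots> = (\<integral>\<^sup>+x. ennreal (multi_normal_density 0 ?S x * ?g x) \<partial>lborel)"
    by (intro nn_integral_cong ennreal_mult[symmetric] multi_normal_density_nonneg[OF S]) simp
  also have "\<dots> = ennreal (sqrt (det ?H * det ?V) * ?c)"
    by (rule gaussian_tilt[OF H S _ ent_hess_inverse(2)[OF pos] pos_def_ent_hess[OF pos]])
      (simp add: Sigma_matrix_def algebra_simps)
  finally have nn: "(\<integral>\<^sup>+\<omega>. ennreal (?g (\<xi> j \<omega>)) \<partial>P) = ennreal (sqrt (det ?H * det ?V) * ?c)" .
  have meas: "(\<lambda>\<omega>. ?g (\<xi> j \<omega>)) \<in> borel_measurable P" using j by measurable
  show "integrable P (\<lambda>\<omega>. ?g (\<xi> j \<omega>))"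
    by (rule integrableI_nonneg[OF meas]) (use nn in auto)
  have detV: "det ?V = (\<Prod>k\<in>UNIV. full_point (M j) $ k)" by (rule det_covariance[OF pos])
  have d: "det ?H * det ?V > 0" unfolding detV using det_pos_def_matrix[OF H] pos by (intro mult_pos_pos prod_pos) auto
  have "(\<integral>\<omega>. ?g (\<xi> j \<omega>) \<partial>P) = sqrt (det ?H * det ?V) * ?c"
  proof -
    have "(\<integral>\<omega>. ?g (\<xi> j \<omega>) \<partial>P) = enn2real (\<integral>\<^sup>+\<omega>. ennreal (?g (\<xi> j \<omega>)) \<partial>P)"
      by (rule integral_eq_nn_integral[OF meas]) simp
    then show ?thesis unfolding nn using d by simp
  qed
  moreover have "weight F (M j) * sqrt (det ?H * det ?V) = 1"
  proof -
    have "weight F (M j) = inverse (sqrt (det ?H * det ?V))"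
      unfolding weight_def detV[symmetric] using d by (simp add: powr_minus powr_half_sqrt)
    then show ?thesis using real_sqrt_gt_zero[OF d] by (simp only: left_inverse less_imp_neq[symmetric] not_False_eq_True)
  qed
  ultimately show "weight F (M j) * (\<integral>\<omega>. ?g (\<xi> j \<omega>) \<partial>P) = ?c" by (simp add: mult.assoc[symmetric])
qed

text \<open>The log-likelihood ratio \<open>q\<close> is compared with the Gaussian exponent
  \<open>s\<close> at the same \<open>N\<close>, as \<open>y N\<close> need not converge. Both are
  bounded above uniformly in \<open>\<omega>\<close>: \<open>q\<close> because the likelihood never
  exceeds the entropy factor, \<open>s\<close> by completing the square. This makes a constant an
  admissible dominating function.\<close>

lemma local_mixture_limit:
  fixes x :: "nat \<Rightarrow> real^'n"
  assumes j: "j \<in> {1..p}" and x: "\<And>N. x N \<in> hat_simplex" "\<And>N. sqrt (real N) * norm (x N - M j) \<le> K"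
  defines "y \<equiv> \<lambda>N. sqrt (real N) *\<^sub>R (x N - M j)"
  shows "(\<lambda>N. weight F (M j) * (Q j N (x N) / exp (real N * logPM j (x N)))
    - exp ((y N \<bullet> (ent_hess (M j) *v y N) - y N \<bullet> (H_matrix F (M j) *v y N)) / 2)) \<longlonglongrightarrow> 0"
proof -
  interpret prob_space P by (rule prob)
  let ?A = "ent_hess (M j)"
  define q where "q N \<omega> = real N * (\<Sum>k\<in>UNIV. full_point (x N) $ k * (ln (random_point j N \<omega> $ k) - ln (full_point (M j) $ k)))" for N \<omega>
  define s where "s N \<omega> = - (\<xi> j \<omega> \<bullet> (?A *v \<xi> j \<omega>)) / 2 + \<xi> j \<omega> \<bullet> (?A *v y N)" for N \<omega>
  define C where "C = max (dim_const\<^sup>2 / amin * K\<^sup>2) ((\<Sum>i\<in>UNIV. \<Sum>k\<in>UNIV. \<bar>?A $ i $ k\<bar>) * K\<^sup>2 / 2)"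
  have yK: "norm (y N) \<le> K" for N using x(2)[of N] by (simp add: y_def)
  have yK2: "(norm (y N))\<^sup>2 \<le> K\<^sup>2" for N using yK[of N] by (intro power_mono) auto
  have q_eq: "exp (q N \<omega>) = Qint j N (x N) \<omega> / exp (real N * logPM j (x N))" for N \<omega>
    unfolding q_def Qint_def logPM_def exp_diff[symmetric] by (simp add: right_diff_distrib sum_subtractf)
  have qC: "q N \<omega> \<le> C" if N: "good N" for N \<omega>
  proof -
    have "(\<Sum>k\<in>UNIV. full_point (x N) $ k * ln (random_point j N \<omega> $ k)) \<le> - ent (full_point (x N)) - (norm (full_point (x N) - random_point j N \<omega>))\<^sup>2 / 4"
      using x(1) N j by (intro sum_mult_ln_le_neg_ent random_point_pos sum_random_point) (simp_all add: full_point_in_prob_simplex_iff)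
    also have "\<dots> \<le> - ent (full_point (x N))" by simp
    also have "\<dots> \<le> logPM j (x N) + dim_const\<^sup>2 / amin * (norm (x N - M j))\<^sup>2" by (rule neg_ent_le_logPM[OF j x(1)])
    finally have "(\<Sum>k\<in>UNIV. full_point (x N) $ k * (ln (random_point j N \<omega> $ k) - ln (full_point (M j) $ k)))
      \<le> dim_const\<^sup>2 / amin * (norm (x N - M j))\<^sup>2"
      unfolding logPM_def by (simp add: right_diff_distrib sum_subtractf)
    then have "q N \<omega> \<le> real N * (dim_const\<^sup>2 / amin * (norm (x N - M j))\<^sup>2)"
      unfolding q_def by (rule mult_left_mono) simp
    also have "\<dots> = dim_const\<^sup>2 / amin * (norm (y N))\<^sup>2"
      by (simp add: y_def power_mult_distrib)
    also have "\<dots> \<le> dim_const\<^sup>2 / amin * K\<^sup>2" using yK2 amin_pos by (intro mult_left_mono) auto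
    finally show ?thesis by (simp add: C_def)
  qed
  have sC: "s N \<omega> \<le> C" for N \<omega>
  proof -
    have A: "pos_def_matrix ?A" by (rule pos_def_ent_hess[OF full_point_M_pos[OF j]])
    let ?w = "\<xi> j \<omega>"
    have "(?w - y N) \<bullet> (?A *v (?w - y N)) \<ge> 0"
      using A unfolding pos_def_matrix_def by (cases "?w - y N = 0") (auto simp: less_imp_le)
    moreover have "(?w - y N) \<bullet> (?A *v (?w - y N)) = ?w \<bullet> (?A *v ?w) - 2 * (?w \<bullet> (?A *v y N)) + y N \<bullet> (?A *v y N)"
    proof -
      have "y N \<bullet> (?A *v ?w) = ?w \<bullet> (?A *v y N)" by (simp add: ent_hess_bilinear_form mult.commute)
      then show ?thesis by (simp add: matrix_vector_mult_diff_distrib inner_diff_left inner_diff_right)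
    qed
    ultimately have "s N \<omega> \<le> y N \<bullet> (?A *v y N) / 2" unfolding s_def by simp
    also have "\<dots> \<le> (\<Sum>i\<in>UNIV. \<Sum>k\<in>UNIV. \<bar>?A $ i $ k\<bar>) * (norm (y N))\<^sup>2 / 2"
      using quadratic_form_bound[of "y N" ?A] by simp
    also have "\<dots> \<le> (\<Sum>i\<in>UNIV. \<Sum>k\<in>UNIV. \<bar>?A $ i $ k\<bar>) * K\<^sup>2 / 2"
      using yK2 by (intro divide_right_mono mult_left_mono sum_nonneg) auto
    finally show ?thesis by (simp add: C_def)
  qed
  have pw: "(\<lambda>N. exp (q N \<omega>) - exp (s N \<omega>)) \<longlonglongrightarrow> 0" for \<omega>
  proof -
    let ?v = "\<xi> j \<omega>"
    \<comment> \<open>For a fixed \<open>\<omega>\<close> the truncation is eventually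
      inactive.\<close>
    have "filterlim (\<lambda>N. real N powr \<delta>) at_top sequentially" using delta by real_asymp
    then have ev: "\<forall>\<^sub>F N in sequentially. norm ?v \<le> real N powr \<delta>" by (simp add: filterlim_at_top)
    have "(\<lambda>N. real N * (\<Sum>k\<in>UNIV. full_point (M j + y N /\<^sub>R sqrt (real N)) $ k *
        (ln (full_point (M j + ?v /\<^sub>R sqrt (real N)) $ k) - ln (full_point (M j) $ k)))
      - (- (?v \<bullet> (?A *v ?v)) / 2 + ?v \<bullet> (?A *v y N))) \<longlonglongrightarrow> 0"
      by (rule log_likelihood_expansion[OF full_point_M_pos[OF j] yK])
    moreover have "\<forall>\<^sub>F N in sequentially. real N * (\<Sum>k\<in>UNIV. full_point (M j + y N /\<^sub>R sqrt (real N)) $ k *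
        (ln (full_point (M j + ?v /\<^sub>R sqrt (real N)) $ k) - ln (full_point (M j) $ k)))
      - (- (?v \<bullet> (?A *v ?v)) / 2 + ?v \<bullet> (?A *v y N)) = q N \<omega> - s N \<omega>"
      using ev eventually_gt_at_top[of 0]
    proof eventually_elim
      case (elim N)
      have "M j + y N /\<^sub>R sqrt (real N) = x N" using elim(2) by (simp add: y_def)
      moreover have "random_point j N \<omega> = full_point (M j + ?v /\<^sub>R sqrt (real N))" using elim(1) by (simp add: random_point_def truncate_vec_def)
      ultimately show ?case by (simp only: q_def s_def)
    qed
    ultimately have "(\<lambda>N. q N \<omega> - s N \<omega>) \<longlonglongrightarrow> 0" by (rule Lim_transform_eventually)
    then have "(\<lambda>N. exp C * \<bar>q N \<omega> - s N \<omega>\<bar>) \<longlonglongrightarrow> 0"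
      by (intro tendsto_mult_right_zero tendsto_rabs_zero)
    then show ?thesis
    proof (rule Lim_null_comparison[rotated])
      show "\<forall>\<^sub>F N in sequentially. norm (exp (q N \<omega>) - exp (s N \<omega>)) \<le> exp C * \<bar>q N \<omega> - s N \<omega>\<bar>"
        using eventually_good by eventually_elim (simp add: abs_exp_diff_le qC sC)
    qed
  qed
  have smeas: "(\<lambda>\<omega>. exp (s N \<omega>)) \<in> borel_measurable P" for N
    using borel_measurable_integrable[OF integral_gaussian_tilt(1)[OF j, of "y N"]] unfolding s_def .
  have qmeas: "(\<lambda>\<omega>. exp (q N \<omega>)) \<in> borel_measurable P" for N
    unfolding q_eq using j by measurable
  \<comment> \<open>Set to 0 for the finitely many remaining \<open>N\<close>, since domination is
    required at every index.\<close>
  define D where "D N \<omega> = (if good N then exp (q N \<omega>) - exp (s N \<omega>) else 0)" for N \<omega>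
  have "(\<lambda>N. \<integral>\<omega>. D N \<omega> \<partial>P) \<longlonglongrightarrow> (\<integral>\<omega>. 0 \<partial>P)"
  proof (rule integral_dominated_convergence[where w = "\<lambda>_. 2 * exp C"])
    show "D N \<in> borel_measurable P" for N
      unfolding D_def [abs_def] using qmeas smeas by (cases "good N") auto
    show "AE \<omega> in P. (\<lambda>N. D N \<omega>) \<longlonglongrightarrow> 0"
    proof (rule AE_I2)
      fix \<omega>
      have "\<forall>\<^sub>F N in sequentially. exp (q N \<omega>) - exp (s N \<omega>) = D N \<omega>"
        using eventually_good by eventually_elim (simp add: D_def)
      with pw show "(\<lambda>N. D N \<omega>) \<longlonglongrightarrow> 0" by (rule Lim_transform_eventually)
    qed
    show "AE \<omega> in P. norm (D N \<omega>) \<le> 2 * exp C" for N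
    proof (rule AE_I2)
      fix \<omega>
      show "norm (D N \<omega>) \<le> 2 * exp C"
      proof (cases "good N")
        case True
        have "exp (q N \<omega>) \<le> exp C" "exp (s N \<omega>) \<le> exp C" using qC[OF True] sC by auto
        moreover have "exp (q N \<omega>) > 0" "exp (s N \<omega>) > 0" by auto
        ultimately show ?thesis using True unfolding D_def real_norm_def by (simp add: abs_le_iff; linarith)
      qed (simp add: D_def)
    qed
  qed auto
  then have "(\<lambda>N. weight F (M j) * (\<integral>\<omega>. D N \<omega> \<partial>P)) \<longlonglongrightarrow> 0"
    by (intro tendsto_mult_right_zero) simp
  moreover have "\<forall>\<^sub>F N in sequentially. weight F (M j) * (\<integral>\<omega>. D N \<omega> \<partial>P) = weight F (M j) * (Q j N (x N) / exp (real N * logPM j (x N)))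
    - exp ((y N \<bullet> (?A *v y N) - y N \<bullet> (H_matrix F (M j) *v y N)) / 2)"
    using eventually_good
  proof eventually_elim
    case (elim N)
    have "(\<integral>\<omega>. D N \<omega> \<partial>P) = (\<integral>\<omega>. exp (q N \<omega>) - exp (s N \<omega>) \<partial>P)" using elim by (simp add: D_def)
    also have "\<dots> = (\<integral>\<omega>. exp (q N \<omega>) \<partial>P) - (\<integral>\<omega>. exp (s N \<omega>) \<partial>P)"
    proof (rule Bochner_Integration.integral_diff)
      show "integrable P (\<lambda>\<omega>. exp (q N \<omega>))"
        unfolding q_eq by (intro integrable_divide Qint_integrable[OF elim j x(1)])
      show "integrable P (\<lambda>\<omega>. exp (s N \<omega>))" unfolding s_def by (rule integral_gaussian_tilt(1)[OF j])
    qed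
    also have "(\<integral>\<omega>. exp (q N \<omega>) \<partial>P) = Q j N (x N) / exp (real N * logPM j (x N))"
      unfolding q_eq Q_def by simp
    finally show ?case
      using integral_gaussian_tilt(2)[OF j, of "y N"] unfolding s_def by (simp add: right_diff_distrib)
  qed
  ultimately show ?thesis by (rule Lim_transform_eventually)
qed

text \<open>The parameters of component \<open>i\<close> concentrate at \<open>M i\<close>, so they
  stay at distance at least \<open>\<rho>\<close> from \<open>x N\<close>. The quadratic term of the
  Pinsker-type bound then gives decay like \<open>exp (- N * \<rho>\<^sup>2 / 4)\<close>.\<close>

lemma mixture_other_component:
  fixes x :: "nat \<Rightarrow> real^'n"
  assumes j: "j \<in> {1..p}" and i: "i \<in> {1..p}" "i \<noteq> j"
    and x: "\<And>N. x N \<in> hat_simplex" "\<And>N. sqrt (real N) * norm (x N - M j) \<le> K"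
  shows "(\<lambda>N. Q i N (x N) / exp (real N * logPM j (x N))) \<longlonglongrightarrow> 0"
proof -
  interpret prob_space P by (rule prob)
  define \<rho> where "\<rho> = norm (M j - M i) / 2"
  have "M j \<noteq> M i" using A_enum i j unfolding bij_betw_def inj_on_def by blast
  then have \<rho>: "\<rho> > 0" by (simp add: \<rho>_def)
  define C where "C = dim_const\<^sup>2 / amin * K\<^sup>2"
  have "(\<lambda>N. K / sqrt (real N) + real N powr \<delta> / sqrt (real N)) \<longlonglongrightarrow> 0 + 0"
    by (rule tendsto_add[OF _ powr_delta_over_sqrt_tendsto]) real_asymp
  then have "\<forall>\<^sub>F N in sequentially. K / sqrt (real N) + real N powr \<delta> / sqrt (real N) < \<rho>"
    using \<rho> by (intro order_tendstoD) auto
  then have ev: "\<forall>\<^sub>F N in sequentially. Q i N (x N) / exp (real N * logPM j (x N)) \<le> exp (C - real N * \<rho>\<^sup>2 / 4)"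
    using eventually_good eventually_gt_at_top[of 0]
  proof eventually_elim
    case (elim N)
    have N: "real N > 0" using elim(3) by simp
    have xK: "norm (x N - M j) \<le> K / sqrt (real N)" using x(2)[of N] N by (simp add: field_simps)
    have "Qint i N (x N) \<omega> \<le> exp (real N * logPM j (x N)) * exp (C - real N * \<rho>\<^sup>2 / 4)" for \<omega>
    proof -
      define v where "v = truncate_vec \<delta> N (\<xi> i \<omega>)"
      have "norm (v /\<^sub>R sqrt (real N)) \<le> real N powr \<delta> / sqrt (real N)"
        unfolding v_def using norm_truncate_vec(2)[of N "\<xi> i \<omega>"] N by (simp add: field_simps)
      moreover have "norm (hat_point (full_point (x N) - random_point i N \<omega>)) = norm ((x N - M j) + (M j - M i) - v /\<^sub>R sqrt (real N))"
        unfolding hat_point_diff random_point_def hat_full_point v_def by (simp add: algebra_simps)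
      moreover have "norm ((x N - M j) + (M j - M i) - v /\<^sub>R sqrt (real N))
         \<ge> norm (M j - M i) - norm (x N - M j) - norm (v /\<^sub>R sqrt (real N))"
      proof -
        have tri: "norm b \<le> norm (a + b - w) + norm a + norm w" for a b w :: "real^'n"
          using norm_triangle_ineq4[of "a + b - w + w" a] norm_triangle_ineq[of "a + b - w" w] by simp
        show ?thesis using tri[of "M j - M i" "x N - M j" "v /\<^sub>R sqrt (real N)"] by linarith
      qed
      ultimately have "\<rho> \<le> norm (hat_point (full_point (x N) - random_point i N \<omega>))"
        using xK elim(1) unfolding \<rho>_def by linarith
      also have "\<dots> \<le> norm (full_point (x N) - random_point i N \<omega>)" by (rule norm_hat_point_le)
      finally have "\<rho>\<^sup>2 \<le> (norm (full_point (x N) - random_point i N \<omega>))\<^sup>2" using \<rho> by (intro power_mono) auto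
      then have "real N * \<rho>\<^sup>2 / 4 \<le> real N * (norm (full_point (x N) - random_point i N \<omega>))\<^sup>2 / 4"
        by (intro divide_right_mono mult_left_mono) auto
      moreover have "- real N * ent (full_point (x N)) \<le> real N * logPM j (x N) + C"
      proof -
        have "real N * (- ent (full_point (x N))) \<le> real N * (logPM j (x N) + dim_const\<^sup>2 / amin * (norm (x N - M j))\<^sup>2)"
          by (intro mult_left_mono neg_ent_le_logPM j x) simp
        also have "\<dots> = real N * logPM j (x N) + dim_const\<^sup>2 / amin * (sqrt (real N) * norm (x N - M j))\<^sup>2"
          by (simp add: power_mult_distrib distrib_left mult_ac)
        also have "\<dots> \<le> real N * logPM j (x N) + C"
          unfolding C_def using x(2)[of N] amin_pos by (intro add_left_mono mult_left_mono power_mono) auto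
        finally show ?thesis by simp
      qed
      ultimately have "- real N * ent (full_point (x N)) - real N * (norm (full_point (x N) - random_point i N \<omega>))\<^sup>2 / 4
        \<le> real N * logPM j (x N) + (C - real N * \<rho>\<^sup>2 / 4)" by linarith
      then have "exp (- real N * ent (full_point (x N)) - real N * (norm (full_point (x N) - random_point i N \<omega>))\<^sup>2 / 4)
        \<le> exp (real N * logPM j (x N)) * exp (C - real N * \<rho>\<^sup>2 / 4)"
        unfolding exp_add[symmetric] by simp
      with Qint_le[OF elim(2) i(1) x(1)] show ?thesis by (rule order_trans)
    qed
    from integral_mono[OF Qint_integrable[OF elim(2) i(1) x(1)] integrable_const this]
    have "Q i N (x N) \<le> exp (real N * logPM j (x N)) * exp (C - real N * \<rho>\<^sup>2 / 4)"
      unfolding Q_def by (simp add: prob_space)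
    then show ?case by (simp add: divide_le_eq mult.commute)
  qed
  have "(\<lambda>N. exp (C - real N * \<rho>\<^sup>2 / 4)) \<longlonglongrightarrow> 0"
  proof -
    have "\<rho>\<^sup>2 > 0" using \<rho> by simp
    then show ?thesis by real_asymp
  qed
  then show ?thesis
    by (rule tendsto_sandwich[OF always_eventually ev tendsto_const, rotated]) (auto intro: divide_nonneg_pos Q_nonneg)
qed

text \<open>Relative to the likelihood at \<open>M j\<close>, both densities have the same
  asymptotic exponent \<open>h N\<close>: the Gibbs side by Taylor expansion, the mixture by
  component \<open>j\<close>, with the other components negligible.\<close>

lemma log_ratio_tendsto_zero:
  fixes x :: "nat \<Rightarrow> real^'n"
  assumes j: "j \<in> {1..p}"
    and x: "\<And>N. x N \<in> hat_simplex" "\<And>N. sqrt (real N) * norm (x N - M j) \<le> K"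
  shows "(\<lambda>N. log_ratio N (x N)) \<longlonglongrightarrow> 0"
proof -
  let ?A = "ent_hess (M j)" and ?H = "H_matrix F (M j)"
  define y where "y N = sqrt (real N) *\<^sub>R (x N - M j)" for N
  define h where "h N = (y N \<bullet> (?A *v y N) - y N \<bullet> (?H *v y N)) / 2" for N
  have yK: "norm (y N) \<le> K" for N using x(2)[of N] by (simp add: y_def)
  have K0: "K \<ge> 0" using norm_ge_zero yK[of 0] by (rule order_trans)
  have yK2: "(norm (y N))\<^sup>2 \<le> K\<^sup>2" for N using yK[of N] by (intro power_mono) auto
  obtain B where B: "\<And>N. \<bar>h N\<bar> \<le> B"
  proof -
    have "\<bar>h N\<bar> \<le> (\<Sum>i\<in>UNIV. \<Sum>k\<in>UNIV. \<bar>(?A - ?H) $ i $ k\<bar>) * K\<^sup>2" for N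
    proof -
      have "\<bar>h N\<bar> \<le> \<bar>y N \<bullet> ((?A - ?H) *v y N)\<bar>"
        unfolding h_def by (simp add: matrix_vector_mult_diff_rdistrib inner_diff_right)
      also have "\<dots> \<le> (\<Sum>i\<in>UNIV. \<Sum>k\<in>UNIV. \<bar>(?A - ?H) $ i $ k\<bar>) * (norm (y N))\<^sup>2" by (rule quadratic_form_bound)
      also have "\<dots> \<le> (\<Sum>i\<in>UNIV. \<Sum>k\<in>UNIV. \<bar>(?A - ?H) $ i $ k\<bar>) * K\<^sup>2"
        using yK2 by (intro mult_left_mono sum_nonneg) auto
      finally show ?thesis .
    qed
    then show thesis by (rule that)
  qed
  define R where "R N = mixture_density N (x N) / exp (real N * logPM j (x N))" for N
  have "(\<lambda>N. (weight F (M j) * (Q j N (x N) / exp (real N * logPM j (x N))) - exp (h N))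
     + (\<Sum>i\<in>{1..p} - {j}. weight F (M i) * (Q i N (x N) / exp (real N * logPM j (x N))))) \<longlonglongrightarrow> 0 + (\<Sum>i\<in>{1..p} - {j}. weight F (M i) * 0)"
    unfolding h_def y_def
    by (intro tendsto_add local_mixture_limit[OF j x] tendsto_sum tendsto_mult tendsto_const mixture_other_component[OF j _ _ x]) auto
  moreover have "(weight F (M j) * (Q j N (x N) / exp (real N * logPM j (x N))) - exp (h N))
     + (\<Sum>i\<in>{1..p} - {j}. weight F (M i) * (Q i N (x N) / exp (real N * logPM j (x N)))) = R N - exp (h N)" for N
  proof -
    have "R N = (\<Sum>i=1..p. weight F (M i) * (Q i N (x N) / exp (real N * logPM j (x N))))"
      by (simp add: R_def mixture_density_def sum_divide_distrib)
    then show ?thesis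
      using j sum.remove[of "{1..p}" j "\<lambda>i. weight F (M i) * (Q i N (x N) / exp (real N * logPM j (x N)))"] by simp
  qed
  ultimately have "(\<lambda>N. R N - exp (h N)) \<longlonglongrightarrow> 0"
    by (simp only: mult_zero_right sum.neutral_const add_0)
  \<comment> \<open>As \<open>h\<close> is bounded, the difference tending to 0 becomes a ratio
    tending to 1, to which the logarithm applies.\<close>
  then have "(\<lambda>N. exp (- h N) * (R N - exp (h N))) \<longlonglongrightarrow> 0"
  proof (rule tendsto_bounded_mult_zero)
    show "\<bar>exp (- h N)\<bar> \<le> exp B" for N using B[of N] by (simp add: abs_le_iff)
  qed
  then have "(\<lambda>N. exp (- h N) * R N) \<longlonglongrightarrow> 1"
    using tendsto_add[of "\<lambda>N. exp (- h N) * (R N - exp (h N))" 0 sequentially "\<lambda>_. 1" 1]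
    by (simp add: right_diff_distrib exp_minus)
  from tendsto_ln[OF this] have lnR: "(\<lambda>N. ln (exp (- h N) * R N)) \<longlonglongrightarrow> 0" by simp
  have phi: "(\<lambda>N. real N * phi j (x N) - h N) \<longlonglongrightarrow> 0"
  proof (rule tendstoI)
    fix e :: real assume e: "e > 0"
    \<comment> \<open>Rescaled by \<open>N\<close>, the Taylor error is at most
      \<open>e' * K\<^sup>2\<close>; adding 1 in the denominator covers
      \<open>K = 0\<close>.\<close>
    define e' where "e' = e / (2 * (K\<^sup>2 + 1))"
    have e': "e' > 0" "e' * K\<^sup>2 < e"
    proof -
      have "K\<^sup>2 + 1 > 0" by (rule add_nonneg_pos) auto
      then show "e' > 0" using e by (simp add: e'_def)
      have "e' * K\<^sup>2 \<le> e' * (K\<^sup>2 + 1)" using \<open>e' > 0\<close> by (intro mult_left_mono) auto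
      also have "\<dots> = e / 2"
      proof -
        have "e / (2 * k) * k = e / 2" if "k > 0" for k :: real using that by simp
        from this[OF \<open>K\<^sup>2 + 1 > 0\<close>] show ?thesis unfolding e'_def .
      qed
      finally show "e' * K\<^sup>2 < e" using e by simp
    qed
    obtain r where r: "r > 0" "\<And>z. norm z < r \<Longrightarrow>
       \<bar>phi j (M j + z) - (z \<bullet> (?A *v z) - z \<bullet> (?H *v z)) / 2\<bar> \<le> e' * (norm z)\<^sup>2"
      using local_expansion[OF j e'(1)] by metis
    have "(\<lambda>N. K / sqrt (real N)) \<longlonglongrightarrow> 0" by real_asymp
    then have "\<forall>\<^sub>F N in sequentially. K / sqrt (real N) < r" using r(1) by (rule order_tendstoD)
    then show "\<forall>\<^sub>F N in sequentially. dist (real N * phi j (x N) - h N) 0 < e"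
      using eventually_gt_at_top[of 0]
    proof eventually_elim
      case (elim N)
      let ?z = "x N - M j"
      have "norm ?z \<le> K / sqrt (real N)" using x(2)[of N] elim(2) by (simp add: field_simps)
      then have "\<bar>phi j (x N) - (?z \<bullet> (?A *v ?z) - ?z \<bullet> (?H *v ?z)) / 2\<bar> \<le> e' * (norm ?z)\<^sup>2"
        using r(2)[of ?z] elim(1) by simp
      then have "real N * \<bar>phi j (x N) - (?z \<bullet> (?A *v ?z) - ?z \<bullet> (?H *v ?z)) / 2\<bar> \<le> real N * (e' * (norm ?z)\<^sup>2)"
        by (rule mult_left_mono) simp
      also have "real N * (e' * (norm ?z)\<^sup>2) = e' * (norm (y N))\<^sup>2"
        by (simp add: y_def power_mult_distrib)
      also have "\<dots> \<le> e' * K\<^sup>2" using yK2 e' by (intro mult_left_mono) auto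
      also have "real N * \<bar>phi j (x N) - (?z \<bullet> (?A *v ?z) - ?z \<bullet> (?H *v ?z)) / 2\<bar> = \<bar>real N * phi j (x N) - h N\<bar>"
      proof -
        have "h N = real N * ((?z \<bullet> (?A *v ?z) - ?z \<bullet> (?H *v ?z)) / 2)"
        proof -
          have sq: "sqrt (real N) * (sqrt (real N) * t) = real N * t" for t by (simp flip: mult.assoc)
          show ?thesis
            unfolding h_def y_def by (simp add: matrix_vector_mult_scaleR right_diff_distrib diff_divide_distrib sq)
        qed
        then have "real N * phi j (x N) - h N = real N * (phi j (x N) - (?z \<bullet> (?A *v ?z) - ?z \<bullet> (?H *v ?z)) / 2)"
          by (simp only: right_diff_distrib)
        then show ?thesis by (simp add: abs_mult)
      qed
      finally show ?case using e' by (simp add: dist_norm)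
    qed
  qed
  have "(\<lambda>N. (real N * phi j (x N) - h N) - ln (exp (- h N) * R N)) \<longlonglongrightarrow> 0 - 0"
    by (intro tendsto_diff phi lnR)
  moreover have "\<forall>\<^sub>F N in sequentially. (real N * phi j (x N) - h N) - ln (exp (- h N) * R N) = log_ratio N (x N)"
    using eventually_good
  proof eventually_elim
    case (elim N)
    have g: "mixture_density N (x N) > 0" by (rule mixture_density_pos[OF elim x(1)])
    then have "R N > 0" "ln (R N) = ln (mixture_density N (x N)) - real N * logPM j (x N)"
      by (simp_all add: R_def ln_div)
    then show ?case
      using g unfolding log_ratio_def gibbs_density_eq[of N "x N" j] by (simp add: ln_mult ln_div)
  qed
  ultimately show ?thesis unfolding diff_zero by (rule Lim_transform_eventually)
qed

text \<open>
  Uniformity follows from the sequential statement by choosing a point violating the bound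
  wherever there is one.
\<close>

lemma log_ratio_uniform:
  assumes j: "j \<in> {1..p}" and e: "e > 0"
  shows "\<forall>\<^sub>F N in sequentially. \<forall>x\<in>hat_simplex. sqrt (real N) * norm (x - M j) \<le> K \<longrightarrow> \<bar>log_ratio N x\<bar> \<le> e"
proof (cases "K \<ge> 0")
  case False
  have "sqrt (real N) * norm (x - M j) \<ge> 0" for N x by simp
  then show ?thesis using False by (intro always_eventually) (meson order_trans)
next
  case True
  define bad where "bad N x \<longleftrightarrow> x \<in> hat_simplex \<and> sqrt (real N) * norm (x - M j) \<le> K \<and> \<bar>log_ratio N x\<bar> > e" for N x
  \<comment> \<open>The default \<open>M j\<close> satisfies both constraints since
    \<open>K \<ge> 0\<close>.\<close>
  define x where "x N = (if \<exists>z. bad N z then SOME z. bad N z else M j)" for N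
  have bad: "bad N (x N)" if "\<exists>z. bad N z" for N
    using that someI_ex[OF that] by (simp add: x_def)
  have "x N \<in> hat_simplex \<and> sqrt (real N) * norm (x N - M j) \<le> K" for N
  proof (cases "\<exists>z. bad N z")
    case True
    from bad[OF this] show ?thesis by (simp add: bad_def)
  next
    case False
    then show ?thesis using M_maximizer(1)[OF j] \<open>K \<ge> 0\<close> by (simp add: x_def)
  qed
  then have "(\<lambda>N. log_ratio N (x N)) \<longlonglongrightarrow> 0" by (intro log_ratio_tendsto_zero[OF j, of x K]) auto
  then have "\<forall>\<^sub>F N in sequentially. \<bar>log_ratio N (x N)\<bar> < e"
    using e unfolding tendsto_iff by (simp add: dist_norm)
  then show ?thesis
  proof eventually_elim
    case (elim N)
    have "\<not> bad N (x N)" using elim by (simp add: bad_def)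
    then have "\<not> bad N z" for z using bad by blast
    then show ?case unfolding bad_def by (auto simp: not_less)
  qed
qed

section \<open>Moments of the Gibbs measure and convergence\<close>

lemma gibbs_density_eq_free_energy:
  "gibbs_density N x = exp (real N * (free_energy F x - Gmax)) * exp (- real N * ent (full_point x))"
  by (simp add: gibbs_density_def free_energy_def algebra_simps flip: exp_add)

text \<open>
  The entropy factor \<open>exp (- N ent m)\<close> is comparable to the probability of the configuration under
  every product measure whose parameter is within \<open>1 / sqrt N\<close> of \<open>m\<close>. So near a maximizer the
  Gibbs weight is dominated by a Gaussian mixture of product measures.
\<close>

lemma gibbs_density_near:
  obtains r c C where "r > 0" "c > 0" "C > 0"
    "\<And>N j \<sigma> \<eta>. N \<ge> 1 \<Longrightarrow> 1 \<le> r * sqrt (real N) \<Longrightarrow> j \<in> {1..p} \<Longrightarrow> norm (hat_mag N \<sigma> - M j) < r \<Longrightarrow>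
      norm (\<eta> - sqrt (real N) *\<^sub>R (hat_mag N \<sigma> - M j)) \<le> 1 \<Longrightarrow>
      full_point (M j + \<eta> /\<^sub>R sqrt (real N)) \<in> prob_simplex \<and>
      gibbs_density N (hat_mag N \<sigma>) \<le> C * exp (- c * (norm \<eta>)\<^sup>2) * (\<Prod>i=1..N. full_point (M j + \<eta> /\<^sub>R sqrt (real N)) $ \<sigma> i)"
proof -
  obtain c r0 where cr: "c > 0" "r0 > 0"
    "\<And>j x. j \<in> {1..p} \<Longrightarrow> norm (x - M j) < r0 \<Longrightarrow> x \<in> hat_simplex \<and> free_energy F x \<le> Gmax - c * (norm (x - M j))\<^sup>2"
    by (rule free_energy_near) blast
  \<comment> \<open>The parameter may lie up to \<open>2 * r\<close> from \<open>M j\<close>: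
    \<open>r\<close> for the magnetization and \<open>1 / sqrt N \<le> r\<close> for the offset of
    \<open>\<eta>\<close>. Its coordinates must still be at least \<open>amin / 2\<close>.\<close>
  define r where "r = min r0 (amin / (4 * dim_const))"
  have r: "r > 0" "r \<le> r0" "dim_const * (2 * r) \<le> amin / 2"
  proof -
    show "r > 0" "r \<le> r0" using cr amin_pos dim_const_pos by (auto simp: r_def)
    have "r \<le> amin / (4 * dim_const)" by (simp add: r_def)
    then show "dim_const * (2 * r) \<le> amin / 2" using dim_const_pos by (simp add: field_simps)
  qed
  \<comment> \<open>\<open>exp c\<close> pays for replacing the rescaled magnetization by
    \<open>\<eta>\<close> within distance 1 in the Gaussian factor, the other factor for the
    relative entropy between the two parameters.\<close>
  define C where "C = exp (c + 2 * dim_const\<^sup>2 / amin)"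
  show thesis
  proof (rule that[of r "c / 2" C])
    show "r > 0" "c / 2 > 0" "C > 0" using r cr by (auto simp: C_def)
    fix N j \<sigma> and \<eta> :: "real^'n"
    assume N: "N \<ge> 1" and rN: "1 \<le> r * sqrt (real N)" and j: "j \<in> {1..p}" and near: "norm (hat_mag N \<sigma> - M j) < r"
      and \<eta>: "norm (\<eta> - sqrt (real N) *\<^sub>R (hat_mag N \<sigma> - M j)) \<le> 1"
    let ?s = "sqrt (real N)" and ?x = "hat_mag N \<sigma>"
    let ?\<pi> = "full_point (M j + \<eta> /\<^sub>R ?s)"
    have s: "?s > 0" using N by simp
    define e where "e = \<eta> - ?s *\<^sub>R (?x - M j)"
    have e: "norm e \<le> 1" using \<eta> by (simp add: e_def)
    have eta: "\<eta> /\<^sub>R ?s = (?x - M j) + e /\<^sub>R ?s" using s by (simp add: e_def scaleR_right_diff_distrib)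
    have es: "norm (e /\<^sub>R ?s) \<le> 1 / ?s" using e s by (simp add: divide_inverse mult_left_le_one_le)
    have "1 / ?s \<le> r" using rN s by (simp add: field_simps)
    then have "norm (\<eta> /\<^sub>R ?s) \<le> 2 * r"
      unfolding eta using norm_triangle_ineq[of "?x - M j" "e /\<^sub>R ?s"] es near by linarith
    then have "dim_const * norm (\<eta> /\<^sub>R ?s) \<le> amin / 2"
      using r(3) dim_const_pos by (meson mult_left_mono less_imp_le order_trans)
    then have \<pi>_ge: "?\<pi> $ k \<ge> amin / 2" for k
      using component_le_norm_cart[of "?\<pi> - full_point (M j)" k] norm_full_point_diff[of "M j + \<eta> /\<^sub>R ?s" "M j"]
        amin_le[OF j, of k] unfolding vector_minus_component by (simp del: full_point_simps)
    have \<pi>_pos: "?\<pi> $ k > 0" for k using \<pi>_ge[of k] amin_pos by linarith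
    have \<pi>_le: "?\<pi> $ k \<le> 1" for k
    proof -
      have "?\<pi> $ k \<le> (\<Sum>k\<in>UNIV. ?\<pi> $ k)" by (rule member_le_sum) (use \<pi>_pos in \<open>auto simp: less_imp_le simp del: full_point_simps\<close>)
      then show ?thesis by (simp only: sum_full_point)
    qed
    have \<pi>S: "?\<pi> \<in> prob_simplex"
      unfolding prob_simplex_def using \<pi>_pos \<pi>_le sum_full_point by (simp add: less_imp_le del: full_point_simps)
    have m: "full_point ?x = magnetization N \<sigma>" by (rule full_hat_mag[OF N])
    have mS: "magnetization N \<sigma> \<in> prob_simplex" by (rule magnetization_in_prob_simplex[OF N])
    have ent0: "- ent (full_point ?x) \<le> (\<Sum>k\<in>UNIV. magnetization N \<sigma> $ k * ln (?\<pi> $ k)) + (norm (full_point ?x - ?\<pi>))\<^sup>2 / (amin / 2)"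
      unfolding m using mS \<pi>_ge amin_pos by (intro neg_ent_le_sum_mult_ln sum_full_point) auto
    have dist0: "(norm (full_point ?x - ?\<pi>))\<^sup>2 / (amin / 2) \<le> (dim_const * (1 / ?s))\<^sup>2 / (amin / 2)"
    proof (intro divide_right_mono power_mono)
      have "norm (full_point ?x - ?\<pi>) \<le> dim_const * norm (?x - (M j + \<eta> /\<^sub>R ?s))" by (rule norm_full_point_diff)
      also have "?x - (M j + \<eta> /\<^sub>R ?s) = - (e /\<^sub>R ?s)" unfolding eta by simp
      also have "dim_const * norm (- (e /\<^sub>R ?s)) \<le> dim_const * (1 / ?s)"
        using es dim_const_pos by (intro mult_left_mono) (simp_all only: norm_minus_cancel less_imp_le)
      finally show "norm (full_point ?x - ?\<pi>) \<le> dim_const * (1 / ?s)" .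
    qed (use amin_pos in auto)
    have "real N * (- ent (full_point ?x)) \<le> real N * ((\<Sum>k\<in>UNIV. magnetization N \<sigma> $ k * ln (?\<pi> $ k)) + (dim_const * (1 / ?s))\<^sup>2 / (amin / 2))"
      using ent0 dist0 by (intro mult_left_mono) auto
    also have "\<dots> = real N * (\<Sum>k\<in>UNIV. magnetization N \<sigma> $ k * ln (?\<pi> $ k)) + 2 * dim_const\<^sup>2 / amin"
    proof -
      have "real N * ((dim_const * (1 / ?s))\<^sup>2 / (amin / 2)) = 2 * dim_const\<^sup>2 / amin"
        using N by (simp add: power_divide power_mult_distrib)
      then show ?thesis by (simp only: distrib_left)
    qed
    finally have ent: "- real N * ent (full_point ?x)
      \<le> real N * (\<Sum>k\<in>UNIV. magnetization N \<sigma> $ k * ln (?\<pi> $ k)) + 2 * dim_const\<^sup>2 / amin" by simp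
    have "free_energy F ?x - Gmax \<le> - c * (norm (?x - M j))\<^sup>2"
      using cr(3)[OF j, of ?x] near r(2) by simp
    then have "real N * (free_energy F ?x - Gmax) \<le> real N * (- c * (norm (?x - M j))\<^sup>2)" by (rule mult_left_mono) simp
    also have "\<dots> = - c * (norm (?s *\<^sub>R (?x - M j)))\<^sup>2" by (simp add: power_mult_distrib)
    also have "\<dots> \<le> - (c / 2) * (norm \<eta>)\<^sup>2 + c"
    proof -
      have sq: "(u + v)\<^sup>2 \<le> 2 * u\<^sup>2 + 2 * v\<^sup>2" for u v :: real
        using sum_squares_bound[of u v] by (simp add: power2_sum)
      have "norm \<eta> \<le> norm (?s *\<^sub>R (?x - M j)) + norm e"
        using norm_triangle_ineq[of "?s *\<^sub>R (?x - M j)" e] by (simp add: e_def)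
      then have "norm \<eta> \<le> norm (?s *\<^sub>R (?x - M j)) + 1" using e by linarith
      then have "(norm \<eta>)\<^sup>2 \<le> (norm (?s *\<^sub>R (?x - M j)) + 1)\<^sup>2" by (rule power_mono) simp
      also have "\<dots> \<le> 2 * (norm (?s *\<^sub>R (?x - M j)))\<^sup>2 + 2" using sq[of _ 1] by simp
      finally have "c / 2 * (norm \<eta>)\<^sup>2 \<le> c / 2 * (2 * (norm (?s *\<^sub>R (?x - M j)))\<^sup>2 + 2)"
        using cr(1) by (intro mult_left_mono) auto
      then show ?thesis by (simp only: distrib_left)
    qed
    finally have fe: "real N * (free_energy F ?x - Gmax) \<le> - (c / 2) * (norm \<eta>)\<^sup>2 + c" .
    have "gibbs_density N ?x \<le> exp ((- (c / 2) * (norm \<eta>)\<^sup>2 + c) + (real N * (\<Sum>k\<in>UNIV. magnetization N \<sigma> $ k * ln (?\<pi> $ k)) + 2 * dim_const\<^sup>2 / amin))"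
      unfolding gibbs_density_eq_free_energy exp_add[symmetric] using fe ent by simp
    also have "\<dots> = C * exp (- (c / 2) * (norm \<eta>)\<^sup>2) * exp (real N * (\<Sum>k\<in>UNIV. magnetization N \<sigma> $ k * ln (?\<pi> $ k)))"
      unfolding C_def exp_add[symmetric] by (simp add: algebra_simps)
    also have "exp (real N * (\<Sum>k\<in>UNIV. magnetization N \<sigma> $ k * ln (?\<pi> $ k))) = (\<Prod>i=1..N. ?\<pi> $ \<sigma> i)"
      by (rule prod_eq_exp_magnetization[OF N, where c = "\<lambda>k. ?\<pi> $ k" and \<sigma> = \<sigma>, symmetric]) (rule \<pi>_pos)
    finally show "?\<pi> \<in> prob_simplex \<and>
      gibbs_density N ?x \<le> C * exp (- (c / 2) * (norm \<eta>)\<^sup>2) * (\<Prod>i=1..N. ?\<pi> $ \<sigma> i)"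
      using \<pi>S by blast
  qed
qed

text \<open>The pointwise bound holds for every \<open>\<eta>\<close> in the unit ball around the
  rescaled magnetization, so it may be integrated over that ball, at the price of its volume, and
  then over the whole space. Exchanging sum and integral leaves the fourth moment of a product
  measure, a polynomial in \<open>norm \<eta>\<close> integrated against a Gaussian.\<close>

lemma gibbs_moment_near:
  obtains r C where "r > 0"
    "\<forall>\<^sub>F N in sequentially. \<forall>j\<in>{1..p}.
      (\<Sum>\<sigma>\<in>{\<sigma>\<in>configs N. norm (hat_mag N \<sigma> - M j) < r}. gibbs_density N (hat_mag N \<sigma>) * ((real N)\<^sup>2 * norm (hat_mag N \<sigma> - M j) ^ 4)) \<le> C"
proof -
  obtain r c C where r: "r > 0" and c: "c > 0" and C: "C > 0" and near:
    "\<And>N j \<sigma> \<eta>. N \<ge> 1 \<Longrightarrow> 1 \<le> r * sqrt (real N) \<Longrightarrow> j \<in> {1..p} \<Longrightarrow> norm (hat_mag N \<sigma> - M j) < r \<Longrightarrow>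
      norm (\<eta> - sqrt (real N) *\<^sub>R (hat_mag N \<sigma> - M j)) \<le> 1 \<Longrightarrow>
      full_point (M j + \<eta> /\<^sub>R sqrt (real N)) \<in> prob_simplex \<and>
      gibbs_density N (hat_mag N \<sigma>) \<le> C * exp (- c * (norm \<eta>)\<^sup>2) * (\<Prod>i=1..N. full_point (M j + \<eta> /\<^sub>R sqrt (real N)) $ \<sigma> i)"
    by (rule gibbs_density_near) blast
  define q2 where "q2 = 24 * (real CARD('n option))\<^sup>2 + 8"
  define vol where "vol = unit_ball_vol (real DIM(real^'n))"
  have vol: "vol > 0" unfolding vol_def by simp
  define J where "J = (\<integral>\<^sup>+(\<eta>::real^'n). ennreal (exp (- c * (norm \<eta>)\<^sup>2) * (1 + norm \<eta> ^ 4)) \<partial>lborel)"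
  have J: "J < \<infinity>" unfolding J_def by (rule integrable_gaussian_moment[OF c])
  have "\<forall>\<^sub>F N in sequentially. 1 \<le> r * sqrt (real N)"
    using r by real_asymp
  then have ev: "\<forall>\<^sub>F N in sequentially. \<forall>j\<in>{1..p}.
      (\<Sum>\<sigma>\<in>{\<sigma>\<in>configs N. norm (hat_mag N \<sigma> - M j) < r}. gibbs_density N (hat_mag N \<sigma>) * ((real N)\<^sup>2 * norm (hat_mag N \<sigma> - M j) ^ 4))
      \<le> C * q2 * enn2real J / vol"
    using eventually_ge_at_top[of 1]
  proof eventually_elim
    case (elim N)
    show ?case
    proof
      fix j assume j: "j \<in> {1..p}"
      define S where "S = {\<sigma>\<in>configs N. norm (hat_mag N \<sigma> - M j) < r}"
      have S: "finite S" unfolding S_def using finite_configs by (rule finite_subset[rotated]) auto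
      define pi where "pi \<eta> = full_point (M j + \<eta> /\<^sub>R sqrt (real N))" for \<eta>
      define G where "G = {\<eta>. pi \<eta> \<in> prob_simplex}"
      define d where "d \<sigma> = (real N)\<^sup>2 * norm (hat_mag N \<sigma> - M j) ^ 4" for \<sigma>
      \<comment> \<open>Outside \<open>G\<close> the shifted parameter leaves the simplex and the
        product could be negative; the indicator keeps \<open>W\<close> nonnegative.\<close>
      define W where "W \<sigma> \<eta> = indicator G \<eta> * (C * exp (- c * (norm \<eta>)\<^sup>2) * ((\<Prod>i=1..N. pi \<eta> $ \<sigma> i) * d \<sigma>))" for \<sigma> \<eta>
      have d0: "d \<sigma> \<ge> 0" for \<sigma> by (simp add: d_def)
      have W0: "W \<sigma> \<eta> \<ge> 0" for \<sigma> \<eta>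
        unfolding W_def using C d0 by (auto simp: indicator_def G_def prob_simplex_def intro!: mult_nonneg_nonneg prod_nonneg)
      have pi_cont: "continuous_on UNIV (\<lambda>\<eta>. pi \<eta> $ k)" for k
        unfolding pi_def by (intro continuous_intros continuous_on_compose2[OF continuous_on_full_point[of UNIV]]) auto
      have [measurable]: "(\<lambda>\<eta>. pi \<eta> $ k) \<in> borel_measurable borel" for k
        using pi_cont by (rule borel_measurable_continuous_onI)
      have [measurable]: "G \<in> sets borel"
      proof -
        have "G = {\<eta>\<in>space borel. \<forall>k. 0 \<le> pi \<eta> $ k \<and> pi \<eta> $ k \<le> 1}"
          by (auto simp: G_def prob_simplex_def pi_def sum_full_point simp del: full_point_simps)
        also have "\<dots> \<in> sets borel" by measurable
        finally show ?thesis .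
      qed
      have Wm[measurable]: "W \<sigma> \<in> borel_measurable borel" for \<sigma>
        unfolding W_def [abs_def] by measurable
      have low: "ennreal (gibbs_density N (hat_mag N \<sigma>) * d \<sigma>) * ennreal vol \<le> (\<integral>\<^sup>+\<eta>. ennreal (W \<sigma> \<eta>) \<partial>lborel)" if \<sigma>: "\<sigma> \<in> S" for \<sigma>
      proof -
        let ?y = "sqrt (real N) *\<^sub>R (hat_mag N \<sigma> - M j)"
        have "ennreal (gibbs_density N (hat_mag N \<sigma>) * d \<sigma>) * ennreal vol
          = (\<integral>\<^sup>+\<eta>. ennreal (gibbs_density N (hat_mag N \<sigma>) * d \<sigma>) * indicator (cball ?y 1) \<eta> \<partial>lborel)"
          by (subst nn_integral_cmult_indicator) (auto simp: emeasure_cball vol_def)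
        also have "\<dots> \<le> (\<integral>\<^sup>+\<eta>. ennreal (W \<sigma> \<eta>) \<partial>lborel)"
        proof (rule nn_integral_mono)
          fix \<eta> :: "real^'n"
          show "ennreal (gibbs_density N (hat_mag N \<sigma>) * d \<sigma>) * indicator (cball ?y 1) \<eta> \<le> ennreal (W \<sigma> \<eta>)"
          proof (cases "\<eta> \<in> cball ?y 1")
            case True
            then have "norm (\<eta> - ?y) \<le> 1" by (simp add: dist_norm norm_minus_commute)
            from near[OF elim(2,1) j _ this] \<sigma>
            have *: "\<eta> \<in> G" "gibbs_density N (hat_mag N \<sigma>) \<le> C * exp (- c * (norm \<eta>)\<^sup>2) * (\<Prod>i=1..N. pi \<eta> $ \<sigma> i)"
              by (auto simp: S_def G_def pi_def)
            have "gibbs_density N (hat_mag N \<sigma>) * d \<sigma> \<le> W \<sigma> \<eta>"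
              using mult_right_mono[OF *(2) d0[of \<sigma>]] *(1) by (simp add: W_def mult.assoc)
            then show ?thesis using True by (simp add: ennreal_leI)
          qed simp
        qed
        finally show ?thesis .
      qed
      have "ennreal ((\<Sum>\<sigma>\<in>S. gibbs_density N (hat_mag N \<sigma>) * d \<sigma>) * vol)
         = (\<Sum>\<sigma>\<in>S. ennreal (gibbs_density N (hat_mag N \<sigma>) * d \<sigma>) * ennreal vol)"
        using vol d0 by (simp add: ennreal_mult sum_ennreal[symmetric] sum_nonneg gibbs_density_def sum_distrib_right)
      also have "\<dots> \<le> (\<Sum>\<sigma>\<in>S. \<integral>\<^sup>+\<eta>. ennreal (W \<sigma> \<eta>) \<partial>lborel)" by (intro sum_mono low)
      also have "\<dots> = (\<integral>\<^sup>+\<eta>. (\<Sum>\<sigma>\<in>S. ennreal (W \<sigma> \<eta>)) \<partial>lborel)"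
        by (rule nn_integral_sum[symmetric]) simp
      also have "\<dots> \<le> (\<integral>\<^sup>+(\<eta>::real^'n). ennreal (C * q2) * ennreal (exp (- c * (norm \<eta>)\<^sup>2) * (1 + norm \<eta> ^ 4)) \<partial>lborel)"
      proof (rule nn_integral_mono)
        fix \<eta> :: "real^'n"
        have "(\<Sum>\<sigma>\<in>S. W \<sigma> \<eta>) \<le> C * q2 * (exp (- c * (norm \<eta>)\<^sup>2) * (1 + norm \<eta> ^ 4))"
        proof (cases "\<eta> \<in> G")
          case True
          have P0: "(\<Prod>i=1..N. pi \<eta> $ \<sigma> i) * d \<sigma> \<ge> 0" for \<sigma>
            using True d0 by (auto simp: G_def prob_simplex_def intro!: mult_nonneg_nonneg prod_nonneg)
          have "(\<Sum>\<sigma>\<in>S. (\<Prod>i=1..N. pi \<eta> $ \<sigma> i) * d \<sigma>) \<le> (\<Sum>\<sigma>\<in>configs N. (\<Prod>i=1..N. pi \<eta> $ \<sigma> i) * d \<sigma>)"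
            using P0 by (intro sum_mono2 finite_configs) (auto simp: S_def)
          also have "\<dots> \<le> 24 * (real CARD('n option))\<^sup>2 + 8 * norm \<eta> ^ 4"
            unfolding d_def pi_def by (rule fourth_moment_shifted[OF elim(2)]) (use True in \<open>simp add: G_def pi_def\<close>)
          also have "\<dots> \<le> q2 * (1 + norm \<eta> ^ 4)"
            unfolding q2_def by (simp add: distrib_left distrib_right)
          finally have "C * exp (- c * (norm \<eta>)\<^sup>2) * (\<Sum>\<sigma>\<in>S. (\<Prod>i=1..N. pi \<eta> $ \<sigma> i) * d \<sigma>)
            \<le> C * exp (- c * (norm \<eta>)\<^sup>2) * (q2 * (1 + norm \<eta> ^ 4))"
            using C by (intro mult_left_mono) auto
          then show ?thesis using True by (simp add: W_def sum_distrib_left mult_ac)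
        next
          case False
          then show ?thesis using C by (simp add: W_def q2_def)
        qed
        then show "(\<Sum>\<sigma>\<in>S. ennreal (W \<sigma> \<eta>)) \<le> ennreal (C * q2) * ennreal (exp (- c * (norm \<eta>)\<^sup>2) * (1 + norm \<eta> ^ 4))"
          using W0 C by (subst ennreal_mult[symmetric]) (auto simp: sum_ennreal q2_def intro!: ennreal_leI)
      qed
      also have "\<dots> = ennreal (C * q2) * J" unfolding J_def by (rule nn_integral_cmult) simp
      also have "\<dots> = ennreal (C * q2) * ennreal (enn2real J)" using J by simp
      also have "\<dots> = ennreal (C * q2 * enn2real J)" using C by (intro ennreal_mult[symmetric]) (auto simp: q2_def)
      finally have "(\<Sum>\<sigma>\<in>S. gibbs_density N (hat_mag N \<sigma>) * d \<sigma>) * vol \<le> C * q2 * enn2real J"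
        using C by (subst (asm) ennreal_le_iff) (auto simp: q2_def)
      then show "(\<Sum>\<sigma>\<in>{\<sigma>\<in>configs N. norm (hat_mag N \<sigma> - M j) < r}. gibbs_density N (hat_mag N \<sigma>) * ((real N)\<^sup>2 * norm (hat_mag N \<sigma> - M j) ^ 4))
        \<le> C * q2 * enn2real J / vol"
        using vol by (simp add: S_def d_def pos_le_divide_eq)
    qed
  qed
  show thesis by (rule that[OF r ev])
qed

text \<open>The free energy gap yields \<open>exp (- c * N)\<close>, against a polynomial number of
  types and the factor \<open>N\<^sup>2\<close>. On the bounded simplex the distance to
  \<open>M 1\<close> is as good as any other.\<close>

lemma gibbs_moment_far:
  assumes r: "r > 0"
  shows "\<forall>\<^sub>F N in sequentially.
    (\<Sum>\<sigma>\<in>{\<sigma>\<in>configs N. \<forall>j\<in>{1..p}. norm (hat_mag N \<sigma> - M j) \<ge> r}.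
       gibbs_density N (hat_mag N \<sigma>) * ((real N)\<^sup>2 * norm (hat_mag N \<sigma> - M 1) ^ 4)) \<le> 1"
proof -
  obtain c where c: "c > 0"
    "\<And>x. x \<in> hat_simplex \<Longrightarrow> (\<forall>j\<in>{1..p}. norm (x - M j) \<ge> r) \<Longrightarrow> free_energy F x \<le> Gmax - c"
    by (rule free_energy_far[OF r]) blast
  obtain D where D: "\<And>x. x \<in> (hat_simplex :: (real^'n) set) \<Longrightarrow> norm x \<le> D"
    using compact_imp_bounded[OF compact_hat_simplex] unfolding bounded_iff by blast
  define K where "K = (D + norm (M 1)) ^ 4"
  let ?q = "CARD('n option)"
  have lim: "(\<lambda>N. K * exp c * (1 / c) ^ (?q + 2) * ((c * (real N + 1)) ^ (?q + 2) / exp (c * (real N + 1)))) \<longlonglongrightarrow> 0"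
  proof (rule tendsto_mult_right_zero)
    have "filterlim (\<lambda>N. c * (real N + 1)) at_top sequentially" using c(1) by real_asymp
    then show "(\<lambda>N. (c * (real N + 1)) ^ (?q + 2) / exp (c * (real N + 1))) \<longlonglongrightarrow> 0"
      by (rule filterlim_compose[OF tendsto_power_div_exp_0])
  qed
  have "\<forall>\<^sub>F N in sequentially. K * exp c * (1 / c) ^ (?q + 2) * ((c * (real N + 1)) ^ (?q + 2) / exp (c * (real N + 1))) < 1"
    by (rule order_tendstoD(2)[OF lim]) simp
  then show ?thesis using eventually_ge_at_top[of 1]
  proof eventually_elim
    case (elim N)
    let ?S = "{\<sigma>\<in>configs N. \<forall>j\<in>{1..p}. norm (hat_mag N \<sigma> - M j) \<ge> r}"
    have "gibbs_density N (hat_mag N \<sigma>) * ((real N)\<^sup>2 * norm (hat_mag N \<sigma> - M 1) ^ 4)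
      \<le> (exp (- c * real N) * exp (- real N * ent (magnetization N \<sigma>))) * ((real N)\<^sup>2 * K)" if "\<sigma> \<in> ?S" for \<sigma>
    proof (intro mult_mono)
      have h: "hat_mag N \<sigma> \<in> hat_simplex" by (rule hat_mag_in_hat_simplex[OF elim(2)])
      have "real N * (free_energy F (hat_mag N \<sigma>) - Gmax) \<le> real N * (- c)"
        using c(2)[OF h] that by (intro mult_left_mono) auto
      then show "gibbs_density N (hat_mag N \<sigma>) \<le> exp (- c * real N) * exp (- real N * ent (magnetization N \<sigma>))"
        unfolding gibbs_density_eq_free_energy full_hat_mag[OF elim(2)] by (intro mult_right_mono) (auto simp: mult.commute)
      have "norm (hat_mag N \<sigma> - M 1) \<le> D + norm (M 1)"
        using norm_triangle_ineq4[of "hat_mag N \<sigma>" "M 1"] D[OF h] by linarith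
      then show "norm (hat_mag N \<sigma> - M 1) ^ 4 \<le> K" unfolding K_def by (intro power_mono) auto
    qed auto
    then have "(\<Sum>\<sigma>\<in>?S. gibbs_density N (hat_mag N \<sigma>) * ((real N)\<^sup>2 * norm (hat_mag N \<sigma> - M 1) ^ 4))
      \<le> (\<Sum>\<sigma>\<in>?S. (exp (- c * real N) * exp (- real N * ent (magnetization N \<sigma>))) * ((real N)\<^sup>2 * K))"
      by (rule sum_mono)
    also have "\<dots> \<le> (\<Sum>\<sigma>\<in>configs N. (exp (- c * real N) * exp (- real N * ent (magnetization N \<sigma> :: real^('n option)))) * ((real N)\<^sup>2 * K))"
      by (intro sum_mono2[OF finite_configs]) (auto simp: K_def)
    also have "\<dots> = exp (- c * real N) * (real N)\<^sup>2 * K * (\<Sum>\<sigma>\<in>configs N. exp (- real N * ent (magnetization N \<sigma> :: real^('n option))))"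
      by (simp add: sum_distrib_left mult_ac)
    also have "\<dots> \<le> exp (- c * real N) * (real N)\<^sup>2 * K * (real N + 1) ^ ?q"
      by (intro mult_left_mono sum_exp_ent_le[OF elim(2)]) (auto simp: K_def)
    also have "\<dots> \<le> exp (- c * real N) * (real N + 1)\<^sup>2 * K * (real N + 1) ^ ?q"
      by (intro mult_right_mono mult_left_mono power_mono) (auto simp: K_def)
    also have "\<dots> = K * exp c * (1 / c) ^ (?q + 2) * ((c * (real N + 1)) ^ (?q + 2) / exp (c * (real N + 1)))"
    proof -
      have powc: "(1 / c) ^ (?q + 2) * (c * (real N + 1)) ^ (?q + 2) = (real N + 1) ^ ?q * (real N + 1)\<^sup>2"
        using c(1) by (simp only: power_mult_distrib[symmetric]) (simp add: power_add power2_eq_square)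
      have perm: "K * exp c * u * (w / z) = K * (exp c / z) * (u * w)" for u w z :: real by simp
      have expc: "exp c / exp (c * (real N + 1)) = exp (- c * real N)"
        unfolding exp_diff[symmetric] by (simp add: algebra_simps)
      show ?thesis unfolding perm powc expc by (simp only: mult_ac)
    qed
    finally show ?case using elim(1) by linarith
  qed
qed

text \<open>\<open>real N * (dmin N \<sigma>)\<^sup>2\<close> is the quantity \<open>d\<close> of
  the overview.\<close>

definition dmin :: "nat \<Rightarrow> (nat \<Rightarrow> 'n option) \<Rightarrow> real" where
  "dmin N \<sigma> = Min ((\<lambda>j. norm (hat_mag N \<sigma> - M j)) ` {1..p})"

lemma dmin_le: "j \<in> {1..p} \<Longrightarrow> dmin N \<sigma> \<le> norm (hat_mag N \<sigma> - M j)"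
  unfolding dmin_def by (intro Min_le) auto

lemma dmin_attained: "\<exists>j\<in>{1..p}. dmin N \<sigma> = norm (hat_mag N \<sigma> - M j)"
proof -
  have "dmin N \<sigma> \<in> (\<lambda>j. norm (hat_mag N \<sigma> - M j)) ` {1..p}"
    unfolding dmin_def using p_pos by (intro Min_in) auto
  then show ?thesis by auto
qed

lemma dmin_nonneg: "dmin N \<sigma> \<ge> 0"
  using dmin_attained[of N \<sigma>] by auto

lemma scaled_dmin_square_le:
  assumes "j \<in> {1..p}"
  shows "(real N * (dmin N \<sigma>)\<^sup>2)\<^sup>2 \<le> (real N)\<^sup>2 * norm (hat_mag N \<sigma> - M j) ^ 4"
proof -
  have "(real N * (dmin N \<sigma>)\<^sup>2)\<^sup>2 = (real N)\<^sup>2 * dmin N \<sigma> ^ 4"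
    by (simp add: power_mult_distrib)
  also have "\<dots> \<le> (real N)\<^sup>2 * norm (hat_mag N \<sigma> - M j) ^ 4"
    using dmin_le[OF assms] dmin_nonneg by (intro mult_left_mono power_mono) auto
  finally show ?thesis .
qed

lemma gibbs_moment:
  obtains C where "\<forall>\<^sub>F N in sequentially.
    (\<Sum>\<sigma>\<in>configs N. gibbs_density N (hat_mag N \<sigma>) * (real N * (dmin N \<sigma>)\<^sup>2)\<^sup>2) \<le> C"
proof -
  obtain r C where r: "r > 0" and near: "\<forall>\<^sub>F N in sequentially. \<forall>j\<in>{1..p}.
      (\<Sum>\<sigma>\<in>{\<sigma>\<in>configs N. norm (hat_mag N \<sigma> - M j) < r}. gibbs_density N (hat_mag N \<sigma>) * ((real N)\<^sup>2 * norm (hat_mag N \<sigma> - M j) ^ 4)) \<le> C"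
    by (rule gibbs_moment_near) blast
  have "\<forall>\<^sub>F N in sequentially.
    (\<Sum>\<sigma>\<in>configs N. gibbs_density N (hat_mag N \<sigma>) * (real N * (dmin N \<sigma>)\<^sup>2)\<^sup>2) \<le> 1 + real p * C"
    using near gibbs_moment_far[OF r]
  proof eventually_elim
    case (elim N)
    let ?h = "\<lambda>j \<sigma>. gibbs_density N (hat_mag N \<sigma>) * ((real N)\<^sup>2 * norm (hat_mag N \<sigma> - M j) ^ 4)"
    let ?near = "\<lambda>j \<sigma>. norm (hat_mag N \<sigma> - M j) < r" and ?far = "\<lambda>\<sigma>. \<forall>j\<in>{1..p}. norm (hat_mag N \<sigma> - M j) \<ge> r"
    have h0: "?h j \<sigma> \<ge> 0" for j \<sigma> by (simp add: gibbs_density_def)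
    have hd: "gibbs_density N (hat_mag N \<sigma>) * (real N * (dmin N \<sigma>)\<^sup>2)\<^sup>2 \<le> ?h j \<sigma>" if "j \<in> {1..p}" for j \<sigma>
      using scaled_dmin_square_le[OF that] by (intro mult_left_mono) (auto simp: gibbs_density_def)
    have "gibbs_density N (hat_mag N \<sigma>) * (real N * (dmin N \<sigma>)\<^sup>2)\<^sup>2
       \<le> (if ?far \<sigma> then ?h 1 \<sigma> else 0) + (\<Sum>j=1..p. if ?near j \<sigma> then ?h j \<sigma> else 0)" for \<sigma>
    proof (cases "?far \<sigma>")
      case True
      have "(\<Sum>j=1..p. if ?near j \<sigma> then ?h j \<sigma> else 0) \<ge> 0" using h0 by (intro sum_nonneg) simp
      moreover have "1 \<in> {1..p}" using p_pos by simp
      ultimately show ?thesis using hd[of 1 \<sigma>] True by simp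
    next
      case False
      then obtain j where j: "j \<in> {1..p}" "?near j \<sigma>" by (auto simp: not_le)
      have "?h j \<sigma> = (if ?near j \<sigma> then ?h j \<sigma> else 0)" using j(2) by simp
      also have "\<dots> \<le> (\<Sum>j=1..p. if ?near j \<sigma> then ?h j \<sigma> else 0)"
        using j(1) h0 by (intro member_le_sum[of j "{1..p}" "\<lambda>j. if ?near j \<sigma> then ?h j \<sigma> else 0"]) auto
      finally show ?thesis unfolding if_not_P[OF False] using hd[OF j(1), of \<sigma>] by linarith
    qed
    then have "(\<Sum>\<sigma>\<in>configs N. gibbs_density N (hat_mag N \<sigma>) * (real N * (dmin N \<sigma>)\<^sup>2)\<^sup>2)
      \<le> (\<Sum>\<sigma>\<in>configs N. (if ?far \<sigma> then ?h 1 \<sigma> else 0) + (\<Sum>j=1..p. if ?near j \<sigma> then ?h j \<sigma> else 0))"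
      by (rule sum_mono)
    also have "\<dots> = (\<Sum>\<sigma>\<in>configs N. if ?far \<sigma> then ?h 1 \<sigma> else 0)
        + (\<Sum>j=1..p. \<Sum>\<sigma>\<in>configs N. if ?near j \<sigma> then ?h j \<sigma> else 0)"
      unfolding sum.distrib by (subst sum.swap[of _ "{1..p}"]) simp
    also have "\<dots> = (\<Sum>\<sigma>\<in>{\<sigma>\<in>configs N. ?far \<sigma>}. ?h 1 \<sigma>) + (\<Sum>j=1..p. \<Sum>\<sigma>\<in>{\<sigma>\<in>configs N. ?near j \<sigma>}. ?h j \<sigma>)"
      by (simp only: sum.inter_filter[OF finite_configs])
    also have "\<dots> \<le> 1 + (\<Sum>j=1..p. C)" using elim by (intro add_mono sum_mono) auto
    finally show ?case by simp
  qed
  then show thesis by (rule that)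
qed

lemma mixture_moment:
  obtains C where "\<forall>\<^sub>F N in sequentially.
    (\<Sum>\<sigma>\<in>configs N. mixture_density N (hat_mag N \<sigma>) * (real N * (dmin N \<sigma>)\<^sup>2)\<^sup>2) \<le> C"
proof -
  obtain C where C: "\<And>N j. good N \<Longrightarrow> j \<in> {1..p} \<Longrightarrow>
    (\<Sum>\<sigma>\<in>configs N. Q j N (hat_mag N \<sigma>) * ((real N)\<^sup>2 * norm (hat_mag N \<sigma> - M j) ^ 4)) \<le> C"
    by (rule Q_fourth_moment) blast
  have "\<forall>\<^sub>F N in sequentially.
    (\<Sum>\<sigma>\<in>configs N. mixture_density N (hat_mag N \<sigma>) * (real N * (dmin N \<sigma>)\<^sup>2)\<^sup>2) \<le> total_weight * C"
    using eventually_good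
  proof eventually_elim
    case (elim N)
    have "(\<Sum>\<sigma>\<in>configs N. mixture_density N (hat_mag N \<sigma>) * (real N * (dmin N \<sigma>)\<^sup>2)\<^sup>2)
      = (\<Sum>\<sigma>\<in>configs N. \<Sum>j=1..p. weight F (M j) * (Q j N (hat_mag N \<sigma>) * (real N * (dmin N \<sigma>)\<^sup>2)\<^sup>2))"
      by (simp add: mixture_density_def sum_distrib_right mult.assoc)
    also have "\<dots> \<le> (\<Sum>\<sigma>\<in>configs N. \<Sum>j=1..p. weight F (M j) * (Q j N (hat_mag N \<sigma>) * ((real N)\<^sup>2 * norm (hat_mag N \<sigma> - M j) ^ 4)))"
      using weight_pos Q_nonneg
      by (intro sum_mono mult_left_mono scaled_dmin_square_le) (auto simp: less_imp_le)
    also have "\<dots> = (\<Sum>j=1..p. weight F (M j) * (\<Sum>\<sigma>\<in>configs N. Q j N (hat_mag N \<sigma>) * ((real N)\<^sup>2 * norm (hat_mag N \<sigma> - M j) ^ 4)))"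
      by (subst sum.swap) (simp only: sum_distrib_left)
    also have "\<dots> \<le> (\<Sum>j=1..p. weight F (M j) * C)"
      using C[OF elim] weight_pos by (intro sum_mono mult_left_mono) (auto simp: less_imp_le)
    also have "\<dots> = total_weight * C" by (simp add: total_weight_def sum_distrib_right)
    finally show ?case .
  qed
  then show thesis by (rule that)
qed

lemma gibbs_weight_eq:
  "exp (real N * F (magnetization N \<sigma>)) / partition_function F N
    = gibbs_density N (hat_mag N \<sigma>) / (\<Sum>\<sigma>\<in>configs N. gibbs_density N (hat_mag N \<sigma>))" if N: "N \<ge> 1"
proof -
  have "gibbs_density N (hat_mag N \<sigma>) = exp (- real N * Gmax) * exp (real N * F (magnetization N \<sigma>))" for \<sigma>
    unfolding gibbs_density_def full_hat_mag[OF N] exp_add[symmetric] by (simp add: algebra_simps)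
  then show ?thesis by (simp add: partition_function_def flip: sum_distrib_left)
qed

lemma configs_nonempty: "configs N \<noteq> ({} :: (nat \<Rightarrow> 'n option) set)"
  by (simp add: configs_def PiE_eq_empty_iff)

theorem rel_entropy_tendsto_zero:
  "(\<lambda>N. rel_entropy (gibbs_measure F N) (mixture_measure F p M P \<xi> \<delta> N)) \<longlonglongrightarrow> 0"
  "(\<lambda>N. rel_entropy (mixture_measure F p M P \<xi> \<delta> N) (gibbs_measure F N)) \<longlonglongrightarrow> 0"
proof -
  obtain C1 where C1: "C1 \<ge> 0" "\<And>N j x. good N \<Longrightarrow> j \<in> {1..p} \<Longrightarrow> x \<in> hat_simplex \<Longrightarrow>
    \<bar>log_ratio N x\<bar> \<le> C1 * (1 + real N * (norm (x - M j))\<^sup>2)"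
    by (rule log_ratio_bound) blast
  obtain C2 where C2: "\<forall>\<^sub>F N in sequentially.
    (\<Sum>\<sigma>\<in>configs N. gibbs_density N (hat_mag N \<sigma>) * (real N * (dmin N \<sigma>)\<^sup>2)\<^sup>2) \<le> C2"
    by (rule gibbs_moment)
  obtain C3 where C3: "\<forall>\<^sub>F N in sequentially.
    (\<Sum>\<sigma>\<in>configs N. mixture_density N (hat_mag N \<sigma>) * (real N * (dmin N \<sigma>)\<^sup>2)\<^sup>2) \<le> C3"
    by (rule mixture_moment)
  define C where "C = max C1 (max C2 C3)"
  let ?f = "\<lambda>N \<sigma>. gibbs_density N (hat_mag N \<sigma>)" and ?g = "\<lambda>N \<sigma>. mixture_density N (hat_mag N \<sigma>)"
    and ?d = "\<lambda>N \<sigma>. real N * (dmin N \<sigma>)\<^sup>2"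
  have N1: "N \<ge> 1" if "good N" for N using that by (simp add: good_def)
  have gpos: "\<forall>\<^sub>F N in sequentially. \<forall>\<sigma>\<in>configs N. ?g N \<sigma> > 0"
    using eventually_good by eventually_elim (use mixture_density_pos hat_mag_in_hat_simplex N1 in blast)
  have gW: "\<forall>\<^sub>F N in sequentially. (\<Sum>\<sigma>\<in>configs N. ?g N \<sigma>) = total_weight"
    using eventually_good by eventually_elim (rule sum_mixture_density)
  have l: "\<forall>\<^sub>F N in sequentially. \<forall>\<sigma>\<in>configs N. \<bar>ln (?f N \<sigma> / ?g N \<sigma>)\<bar> \<le> C * (1 + ?d N \<sigma>)"
    using eventually_good
  proof eventually_elim
    case (elim N)
    show ?case
    proof
      fix \<sigma> :: "nat \<Rightarrow> 'n option"
      obtain j where j: "j \<in> {1..p}" "dmin N \<sigma> = norm (hat_mag N \<sigma> - M j)" using dmin_attained by blast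
      have "\<bar>log_ratio N (hat_mag N \<sigma>)\<bar> \<le> C1 * (1 + ?d N \<sigma>)"
        unfolding j(2) by (rule C1(2)[OF elim j(1) hat_mag_in_hat_simplex[OF N1[OF elim]]])
      also have "\<dots> \<le> C * (1 + ?d N \<sigma>)" by (intro mult_right_mono) (auto simp: C_def)
      finally show "\<bar>ln (?f N \<sigma> / ?g N \<sigma>)\<bar> \<le> C * (1 + ?d N \<sigma>)" by (simp add: log_ratio_def)
    qed
  qed
  have fd: "\<forall>\<^sub>F N in sequentially. (\<Sum>\<sigma>\<in>configs N. ?f N \<sigma> * (?d N \<sigma>)\<^sup>2) \<le> C"
    using C2 by eventually_elim (auto simp: C_def)
  have gd: "\<forall>\<^sub>F N in sequentially. (\<Sum>\<sigma>\<in>configs N. ?g N \<sigma> * (?d N \<sigma>)\<^sup>2) \<le> C"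
    using C3 by eventually_elim (auto simp: C_def)
  have unif: "\<forall>\<^sub>F N in sequentially. \<forall>\<sigma>\<in>configs N. ?d N \<sigma> \<le> K \<longrightarrow> \<bar>ln (?f N \<sigma> / ?g N \<sigma>)\<bar> \<le> e"
    if e: "e > 0" for K e
  proof -
    have "\<forall>\<^sub>F N in sequentially. \<forall>j\<in>{1..p}. \<forall>x\<in>hat_simplex.
        sqrt (real N) * norm (x - M j) \<le> sqrt K \<longrightarrow> \<bar>log_ratio N x\<bar> \<le> e"
      by (intro eventually_ball_finite ballI log_ratio_uniform e) auto
    then show ?thesis using eventually_good
    proof eventually_elim
      case (elim N)
      show ?case
      proof (intro ballI impI)
        fix \<sigma> :: "nat \<Rightarrow> 'n option" assume K: "?d N \<sigma> \<le> K"
        obtain j where j: "j \<in> {1..p}" "dmin N \<sigma> = norm (hat_mag N \<sigma> - M j)" using dmin_attained by blast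
        have "sqrt (real N) * norm (hat_mag N \<sigma> - M j) = sqrt (?d N \<sigma>)"
          unfolding j(2) by (simp add: real_sqrt_mult)
        also have "\<dots> \<le> sqrt K" using K by simp
        finally show "\<bar>ln (?f N \<sigma> / ?g N \<sigma>)\<bar> \<le> e"
          using elim(1) j(1) hat_mag_in_hat_simplex[OF N1[OF elim(2)]] unfolding log_ratio_def by blast
      qed
    qed
  qed
  note lim = relative_entropy_tendsto_zero[where A = configs and f = ?f and g = ?g and d = ?d and C = C,
      OF total_weight_pos finite_configs configs_nonempty _ _ gpos gW l fd gd unif]
  have fpos: "?f N \<sigma> > 0" for N \<sigma> by (simp add: gibbs_density_def)
  have d0: "?d N \<sigma> \<ge> 0" for N \<sigma> by simp
  have meas: "\<forall>\<^sub>F N in sequentially.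
      (\<forall>\<sigma>\<in>configs N. ?f N \<sigma> / sum (?f N) (configs N) > 0 \<and> ?g N \<sigma> / total_weight > 0) \<and>
      gibbs_measure F N = point_measure (configs N) (\<lambda>\<sigma>. ennreal (?f N \<sigma> / sum (?f N) (configs N))) \<and>
      mixture_measure F p M P \<xi> \<delta> N = point_measure (configs N) (\<lambda>\<sigma>. ennreal (?g N \<sigma> / total_weight))"
    using eventually_good gpos
  proof eventually_elim
    case (elim N)
    have "sum (?f N) (configs N) > 0" using fpos by (intro sum_pos finite_configs configs_nonempty)
    then show ?case
      using elim(2) fpos total_weight_pos
      unfolding gibbs_measure_def mixture_measure_def gibbs_weight_eq[OF N1[OF elim(1)]] mixture_weight_eq[OF elim(1)]
      by simp
  qed
  show "(\<lambda>N. rel_entropy (gibbs_measure F N) (mixture_measure F p M P \<xi> \<delta> N)) \<longlonglongrightarrow> 0"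
  proof (rule Lim_transform_eventually)
    show "(\<lambda>N. ereal (\<Sum>\<sigma>\<in>configs N. ?f N \<sigma> / sum (?f N) (configs N) *
        ln ((?f N \<sigma> / sum (?f N) (configs N)) / (?g N \<sigma> / total_weight)))) \<longlonglongrightarrow> 0"
      using lim(1)[OF fpos d0] unfolding zero_ereal_def lim_ereal .
    show "\<forall>\<^sub>F N in sequentially. ereal (\<Sum>\<sigma>\<in>configs N. ?f N \<sigma> / sum (?f N) (configs N) *
        ln ((?f N \<sigma> / sum (?f N) (configs N)) / (?g N \<sigma> / total_weight)))
      = rel_entropy (gibbs_measure F N) (mixture_measure F p M P \<xi> \<delta> N)"
      using meas by eventually_elim (simp only: rel_entropy_point_measure[OF finite_configs])
  qed
  show "(\<lambda>N. rel_entropy (mixture_measure F p M P \<xi> \<delta> N) (gibbs_measure F N)) \<longlonglongrightarrow> 0"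
  proof (rule Lim_transform_eventually)
    show "(\<lambda>N. ereal (\<Sum>\<sigma>\<in>configs N. ?g N \<sigma> / total_weight *
        ln ((?g N \<sigma> / total_weight) / (?f N \<sigma> / sum (?f N) (configs N))))) \<longlonglongrightarrow> 0"
      using lim(2)[OF fpos d0] unfolding zero_ereal_def lim_ereal .
    show "\<forall>\<^sub>F N in sequentially. ereal (\<Sum>\<sigma>\<in>configs N. ?g N \<sigma> / total_weight *
        ln ((?g N \<sigma> / total_weight) / (?f N \<sigma> / sum (?f N) (configs N))))
      = rel_entropy (mixture_measure F p M P \<xi> \<delta> N) (gibbs_measure F N)"
      using meas by eventually_elim (simp only: rel_entropy_point_measure[OF finite_configs])
  qed
qed

end

theorem theorem1p2:
  fixes F :: "real^('n::finite option) \<Rightarrow> real"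
    and p :: nat
    and M :: "nat \<Rightarrow> real^'n"
    and P :: "'w measure"
    and \<xi> :: "nat \<Rightarrow> 'w \<Rightarrow> real^'n"
    and \<delta> :: real
  assumes F_C2: "C2_on prob_simplex F"
    and A_enum: "bij_betw M {1..p} (global_maximizers (free_energy F) hat_simplex)"
    and A_isolated: "\<forall>j\<in>{1..p}. M j isolated_in global_maximizers (free_energy F) hat_simplex"
    and A_interior: "\<forall>j\<in>{1..p}. M j \<in> interior hat_simplex"
    and B: "\<forall>j\<in>{1..p}. pos_def_matrix (H_matrix F (M j))"
    and Sigma_pos_def: "\<forall>j\<in>{1..p}. pos_def_matrix (Sigma_matrix F (M j))"
    and prob: "prob_space P"
    and xi_normal: "\<forall>j\<in>{1..p}. distributed P lborel (\<xi> j)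
          (\<lambda>x. ennreal (multi_normal_density 0 (Sigma_matrix F (M j)) x))"
    and xi_indep: "prob_space.indep_vars P (\<lambda>_. borel) \<xi> {1..p}"
    and delta: "0 < \<delta>" "\<delta> < 1 / 6"
  shows "((\<lambda>N. rel_entropy (gibbs_measure F N) (mixture_measure F p M P \<xi> \<delta> N)) \<longlonglongrightarrow> 0) \<and>
         ((\<lambda>N. rel_entropy (mixture_measure F p M P \<xi> \<delta> N) (gibbs_measure F N)) \<longlonglongrightarrow> 0)"
proof -
  interpret gibbs_mixture F p M P \<xi> \<delta>
    by (rule gibbs_mixture.intro[OF F_C2 A_enum A_interior B Sigma_pos_def prob xi_normal delta(1)])
      (use delta(2) in simp)
  show ?thesis using rel_entropy_tendsto_zero by blast
qed

end
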